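(* Let $\Omega\subset\mathbb{R}^n$, $n\ge2$, be a bounded domain, let $\Phi\Subset\Omega$ be a strongly convex domain and $\bar r=\mathrm{diam}\,\Phi$. Let $\omega\in\mathcal{C}^0([0,\bar r])\cap\mathcal{C}^2((0,\bar r])$ be concave and strictly increasing with $\omega(0)=0$. Let $\mathcal{A}(x,z)$ be a smooth $n\times n$ matrix function on $\Omega\times\mathbb{R}$ satisfying the diagonal condition and the inequality: for every $\Omega'\Subset\Omega$ and $M_0\ge1$ there is $B_{\mathcal A}=B_{\mathcal A}(\Omega',M_0)$ with $$|\partial_z\mathcal{A}(x,z)\xi|^2\le B_{\mathcal A}^2\,k^*(x,z)\,\xi^t\mathcal{A}(x,z)\xi,\qquad(x,z)\in\Omega'\times[-M_0,M_0],\ \xi\in\mathbb{R}^n;$$ and let $\vec\gamma$ be of subunit type with respect to $\mathcal{A}$. For $m\in\mathbb{R}$ define $$\mathcal{L}_mh=\mathrm{div}\,\mathcal{A}(x,h(x)+m)\nabla h .$$ Then for every $x_0\in\partial\Phi$ and all positive constants $\eta,\nu,m_0,K$ there exist a neighborhood $\mathcal{N}$ of $x_0$ and a function $h\in\mathcal{C}^0(\overline{\mathcal{N}})\cap\mathcal{C}^\infty(\mathcal{N})$ such that $\mathcal{N}\subset\{|x-x_0|<\eta\}$ and $$\begin{cases}h(x_0)=0,\\ h(x)\le-\omega(|x-x_0|),&x\in\Phi\cap\mathcal{N},\\ h(x)\le-\nu,&x\in\Phi\cap\partial\mathcal{N},\\ \mathcal{L}_mh\ge K,&x\in\Phi\cap\mathcal{N},\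 |m|\le m_0,\\ \Delta h=\sum_{i=1}^n\partial_i^2h>0,&x\in\Phi\cap\mathcal{N}.\end{cases}$$
   Context: A domain is an open connected set; $\Phi\Subset\Omega$ means $\Phi$ has compact closure in $\Omega$. A convex domain $\Phi$ with $\mathcal{C}^2$ boundary is strongly convex if the infimum over $\partial\Phi$ of the principal curvatures of $\partial\Phi$ is a positive number $\lambda_0$. Standing assumptions on $\vec k=(k^1,\dots,k^n)$, with $\Gamma=\Omega\times\mathbb{R}$: the $k^i\ge0$ are $\mathcal{C}^2$ in $\Gamma$, $k^1\equiv1$, and for all $x\in\Omega$ and $0<\varepsilon<n^{-1/2}\mathrm{dist}(x,\partial\Omega)$ there is a box $\mathcal{R}=\prod_i[\tilde x_i-r^i,\tilde x_i+r^i]$ with $0<r^i<\varepsilon$ and $x\in\prod_i[\tilde x_i-r^i/3,\tilde x_i+r^i/3]$ such that $k^i(y,z)>0$ for all $i$, all $z\in\mathbb{R}$ and all $y\in\overline{\partial\mathcal{R}\setminus\{y:|y_i-\tilde x_i|=r^i\}}$. Also $k^*=\min_{1\le i\le n}k^i$. Diagonal condition. For some $\Lambda\ge1$: $\sum_ik^i(x,z)\xi_i^2\le\xi^t\mathcal{A}(x,z)\xi\le\Lambda\sum_ik^i(x,z)\xi_i^2$ for all $\xi\in\mathbb{R}^n$, $(x,z)\in\Gamma$. $\vec\gamma$ (with bounded coefficients) is of subunit type with respect to $\mathcal{A}$ in $\Gamma$ if for every $\Omega'\Subset\Omega$, $M_0\ge1$ there is $B_\gamma=B_\gamma(\Omega',M_0)>0$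 with $(\vec\gamma(x,z)\cdot\xi)^2\le B_\gamma^2\,\xi^t\mathcal{A}(x,z)\xi$ for all $(x,z)\in\Omega'\times[-M_0,M_0]$, $\xi\in\mathbb{R}^n$.
   Formalization: Smoothness of h is claimed on 𝒩∖{x_0} instead of 𝒩: as ω is concave and increasing, ω(t) ≥ ct, and h(x_0)=0 with h ≤ −ω(|x−x_0|) in Φ∩𝒩 rules out differentiability at x_0 (compare the tangential directions ±τ). Continuity on the closure of 𝒩 is kept. *)

theory Defs
  imports "HOL-Analysis.Analysis"
begin

definition is_domain :: "'a::topological_space set \<Rightarrow> bool" where
  "is_domain S \<longleftrightarrow> open S \<and> connected S"

definition compactly_contained :: "'a::topological_space set \<Rightarrow> 'a set \<Rightarrow> bool"
    (infix "\<Subset>\<Subset>" 50) where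
  "S \<Subset>\<Subset> T \<longleftrightarrow> compact (closure S) \<and> closure S \<subseteq> T"

(* C^k regularity on an open set. The derivative is taken direction by direction so that the
   type of the function does not change in the recursion. *)
primrec Ck_on :: "nat \<Rightarrow> 'a::real_normed_vector set \<Rightarrow> ('a \<Rightarrow> 'b::real_normed_vector) \<Rightarrow> bool" where
  "Ck_on 0 S f \<longleftrightarrow> continuous_on S f"
| "Ck_on (Suc k) S f \<longleftrightarrow>
     (\<forall>x\<in>S. f differentiable at x) \<and> (\<forall>v. Ck_on k S (\<lambda>x. frechet_derivative f (at x) v))"

definition smooth_on :: "'a::real_normed_vector set \<Rightarrow> ('a \<Rightarrow> 'b::real_normed_vector) \<Rightarrow> bool" where
  "smooth_on S f \<longleftrightarrow> (\<forall>k. Ck_on k S f)"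

(* For subsets of the line that need not be open, such as (0, r]: derivatives are one-sided at
   an endpoint belonging to the set. *)
definition C2_real_on :: "real set \<Rightarrow> (real \<Rightarrow> real) \<Rightarrow> bool" where
  "C2_real_on S f \<longleftrightarrow> (\<exists>f' f''.
     (\<forall>t\<in>S. (f has_real_derivative f' t) (at t within S)) \<and>
     (\<forall>t\<in>S. (f' has_real_derivative f'' t) (at t within S)) \<and>
     continuous_on S f'')"

definition partial_deriv :: "'n \<Rightarrow> (real^'n::finite \<Rightarrow> real) \<Rightarrow> real^'n \<Rightarrow> real" where
  "partial_deriv i f x = frechet_derivative f (at x) (axis i 1)"

definition gradient :: "(real^'n::finite \<Rightarrow> real) \<Rightarrow> real^'n \<Rightarrow> real^'n" where
  "gradient f x = (\<chi> i. partial_deriv i f x)"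

definition divergence :: "(real^'n::finite \<Rightarrow> real^'n) \<Rightarrow> real^'n \<Rightarrow> real" where
  "divergence F x = (\<Sum>i\<in>UNIV. partial_deriv i (\<lambda>y. F y $ i) x)"

definition laplacian :: "(real^'n::finite \<Rightarrow> real) \<Rightarrow> real^'n \<Rightarrow> real" where
  "laplacian f x = (\<Sum>i\<in>UNIV. partial_deriv i (partial_deriv i f) x)"

definition L_op :: "(real^'n::finite \<Rightarrow> real \<Rightarrow> real^'n^'n) \<Rightarrow> real \<Rightarrow> (real^'n \<Rightarrow> real) \<Rightarrow> real^'n \<Rightarrow> real" where
  "L_op A m h x = divergence (\<lambda>y. A y (h y + m) *v gradient h y) x"

(* rho is a C^2 local defining function, near x, for the boundary of Phi; its gradient points
   out of Phi. *)
definition C2_defining_function ::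
    "(real^'n::finite) set \<Rightarrow> real^'n \<Rightarrow> (real^'n) set \<Rightarrow> (real^'n \<Rightarrow> real) \<Rightarrow> bool" where
  "C2_defining_function \<Phi> x U \<rho> \<longleftrightarrow>
     open U \<and> x \<in> U \<and> Ck_on 2 U \<rho> \<and> (\<forall>y\<in>U. gradient \<rho> y \<noteq> 0) \<and> \<Phi> \<inter> U = {y\<in>U. \<rho> y < 0}"

definition has_C2_boundary :: "(real^'n::finite) set \<Rightarrow> bool" where
  "has_C2_boundary \<Phi> \<longleftrightarrow> (\<forall>x\<in>frontier \<Phi>. \<exists>U \<rho>. C2_defining_function \<Phi> x U \<rho>)"

(* Eigenvalues of the Weingarten map: the differential of the outer unit normal field, acting on
   the tangent space. Only tangential derivatives enter, so the choice of rho is immaterial.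
   With the outer normal, the unit sphere has all principal curvatures equal to 1. *)
definition principal_curvature :: "(real^'n::finite) set \<Rightarrow> real^'n \<Rightarrow> real \<Rightarrow> bool" where
  "principal_curvature \<Phi> x \<kappa> \<longleftrightarrow> (\<exists>U \<rho> v.
     C2_defining_function \<Phi> x U \<rho> \<and> v \<noteq> 0 \<and> v \<bullet> gradient \<rho> x = 0 \<and>
     frechet_derivative (\<lambda>y. gradient \<rho> y /\<^sub>R norm (gradient \<rho> y)) (at x) v = \<kappa> *\<^sub>R v)"

definition principal_curvatures :: "(real^'n::finite) set \<Rightarrow> real set" where
  "principal_curvatures \<Phi> = {\<kappa>. \<exists>x\<in>frontier \<Phi>. principal_curvature \<Phi> x \<kappa>}"

definition strongly_convex_domain :: "(real^'n::finite) set \<Rightarrow> bool" where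
  "strongly_convex_domain \<Phi> \<longleftrightarrow>
     is_domain \<Phi> \<and> convex \<Phi> \<and> has_C2_boundary \<Phi> \<and>
     bdd_below (principal_curvatures \<Phi>) \<and> Inf (principal_curvatures \<Phi>) > 0"

(* Every coordinate face of the box R, except the pair orthogonal to e_i, has to avoid the zeros
   of k i. That these points lie in Omega, where k is defined, is made explicit. *)
definition box_condition :: "(real^'n::finite) set \<Rightarrow> ('n \<Rightarrow> real^'n \<Rightarrow> real \<Rightarrow> real) \<Rightarrow> bool" where
  "box_condition \<Omega> k \<longleftrightarrow>
     (\<forall>x\<in>\<Omega>. \<forall>\<epsilon>. 0 < \<epsilon> \<and> \<epsilon> < infdist x (frontier \<Omega>) / sqrt (real CARD('n)) \<longrightarrow>
       (\<exists>c r :: real^'n.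
          (\<forall>i. 0 < r $ i \<and> r $ i < \<epsilon>) \<and>
          x \<in> cbox (c - (1/3) *\<^sub>R r) (c + (1/3) *\<^sub>R r) \<and>
          (\<forall>i. \<forall>y \<in> closure (frontier (cbox (c - r) (c + r)) - {y. \<bar>y $ i - c $ i\<bar> = r $ i}).
             y \<in> \<Omega> \<and> (\<forall>z. k i y z > 0))))"

(* The index called 1 in k^1 = 1 is a distinguished element i1 of the index type. *)
definition admissible_k ::
    "(real^'n::finite) set \<Rightarrow> 'n \<Rightarrow> ('n \<Rightarrow> real^'n \<Rightarrow> real \<Rightarrow> real) \<Rightarrow> bool" where
  "admissible_k \<Omega> i1 k \<longleftrightarrow>
     (\<forall>i. \<forall>x\<in>\<Omega>. \<forall>z. k i x z \<ge> 0) \<and>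
     (\<forall>i. Ck_on 2 (\<Omega> \<times> UNIV) (\<lambda>(x, z). k i x z)) \<and>
     (\<forall>x\<in>\<Omega>. \<forall>z. k i1 x z = 1) \<and>
     box_condition \<Omega> k"

definition k_star :: "('n::finite \<Rightarrow> real^'n \<Rightarrow> real \<Rightarrow> real) \<Rightarrow> real^'n \<Rightarrow> real \<Rightarrow> real" where
  "k_star k x z = Min (range (\<lambda>i. k i x z))"

definition diagonal_condition ::
    "(real^'n::finite) set \<Rightarrow> ('n \<Rightarrow> real^'n \<Rightarrow> real \<Rightarrow> real) \<Rightarrow>
     (real^'n \<Rightarrow> real \<Rightarrow> real^'n^'n) \<Rightarrow> bool" where
  "diagonal_condition \<Omega> k A \<longleftrightarrow>
     (\<exists>\<Lambda>\<ge>1. \<forall>x\<in>\<Omega>. \<forall>z. \<forall>\<xi>.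
        (\<Sum>i\<in>UNIV. k i x z * (\<xi> $ i)\<^sup>2) \<le> \<xi> \<bullet> (A x z *v \<xi>) \<and>
        \<xi> \<bullet> (A x z *v \<xi>) \<le> \<Lambda> * (\<Sum>i\<in>UNIV. k i x z * (\<xi> $ i)\<^sup>2))"

definition z_derivative_condition ::
    "(real^'n::finite) set \<Rightarrow> ('n \<Rightarrow> real^'n \<Rightarrow> real \<Rightarrow> real) \<Rightarrow>
     (real^'n \<Rightarrow> real \<Rightarrow> real^'n^'n) \<Rightarrow> bool" where
  "z_derivative_condition \<Omega> k A \<longleftrightarrow>
     (\<forall>\<Omega>' M0. \<Omega>' \<Subset>\<Subset> \<Omega> \<and> M0 \<ge> 1 \<longrightarrow>
       (\<exists>B::real. \<forall>x\<in>\<Omega>'. \<forall>z\<in>{-M0..M0}. \<forall>\<xi>.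
          (norm (vector_derivative (A x) (at z) *v \<xi>))\<^sup>2
            \<le> B\<^sup>2 * k_star k x z * (\<xi> \<bullet> (A x z *v \<xi>))))"

definition subunit_type ::
    "(real^'n::finite) set \<Rightarrow> (real^'n \<Rightarrow> real \<Rightarrow> real^'n^'n) \<Rightarrow> (real^'n \<Rightarrow> real \<Rightarrow> real^'n) \<Rightarrow> bool" where
  "subunit_type \<Omega> A \<gamma> \<longleftrightarrow>
     bounded ((\<lambda>(x, z). \<gamma> x z) ` (\<Omega> \<times> UNIV)) \<and>
     (\<forall>\<Omega>' M0. \<Omega>' \<Subset>\<Subset> \<Omega> \<and> M0 \<ge> 1 \<longrightarrow>
       (\<exists>B>0. \<forall>x\<in>\<Omega>'. \<forall>z\<in>{-M0..M0}. \<forall>\<xi>.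
          (\<gamma> x z \<bullet> \<xi>)\<^sup>2 \<le> B\<^sup>2 * (\<xi> \<bullet> (A x z *v \<xi>))))"

(* Smoothness of the barrier h on its neighbourhood N of the boundary point x0 has to be read as
   smoothness on N - {x0}. A concave omega satisfies omega t >= c * t with c > 0, so h x0 = 0
   together with h <= - omega (dist x x0) on the part of N in Phi forces both one-sided
   derivatives of h at x0 along +tau and -tau, tau tangent to the C^2 boundary, to be at most
   -c: no such h is differentiable at x0. *)

end

theory Submission
  imports Defs
begin

text \<open>
  The operator may degenerate in all directions but the one with index \<open>i1\<close>, where the diagonal
  condition and \<open>k i1 = 1\<close> give \<open>\<xi> \<bullet> A \<xi> \<ge> (\<xi> $ i1)\<^sup>2\<close>. The normal of the domain at \<open>x0\<close> may be a
  null direction of \<open>A\<close>, and the first order terms of the operator may push towards the interior, so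
  that a function of the distance to a sphere is not a barrier in general. What saves the argument
  is that the curvature of the level sets in the direction \<open>i1\<close> can be made as large as desired.

  Strong convexity places the domain near \<open>x0\<close> in a paraboloid \<open>s \<ge> c |x - x0|\<^sup>2\<close>, where \<open>s\<close> is the
  coordinate along the inner normal (\<open>strongly_convex_paraboloid\<close>). With \<open>l\<close> the coordinate of
  index \<open>i1\<close>, the quotient \<open>l\<^sup>2 / s\<close> is convex and, on the paraboloid, bounded. Therefore
  \<open>p = - ln s + 4 exp (C l\<^sup>2 / s)\<close> is convex, its Hessian is an explicit sum of rank one maps, and its
  second derivative in the direction \<open>i1\<close> dominates \<open>C |\<nabla>p|\<close>: the logarithm provides this if the
  normal has a component in that direction, the exponential if not. Since only
  quadratic forms \<open>\<xi> \<bullet> A \<xi>\<close> enter, each bounded below by \<open>(\<xi> $ i1)\<^sup>2\<close>, the function \<open>u = 1 / p\<close> is a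
  supersolution of the linear part of the operator, and of the Laplacian, uniformly in the
  value of \<open>z\<close> (\<open>inverse_profile_supersolution\<close>). It is positive in the domain and tends to 0 at
  \<open>x0\<close>, but only at a logarithmic rate.

  The barrier is \<open>h = - F(u)\<close>. The quadratic term \<open>\<nabla>h \<bullet> (\<partial>\<^sub>z A) \<nabla>h\<close> is at most
  \<open>B \<nabla>h \<bullet> A \<nabla>h\<close> in absolute value (\<open>z_derivative_form_bound\<close>), and is absorbed if
  \<open>F'' + B F'\<^sup>2 \<le> 0\<close>. The function \<open>F = ln (1 + V) / B\<close> has this property for every concave \<open>V\<close>. A
  smooth concave \<open>V\<close> that beats the given modulus \<open>\<omega>\<close>, saturates early, and still has a large
  slope is a sum of infinitely many hyperbolas and a linear function (\<open>saturating_majorant\<close>).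
  Early saturation gives \<open>h \<le> - \<nu>\<close> on the boundary of a small ball while \<open>|h| \<le> \<nu> + 1\<close> in it. This
  bound is known in advance, so the constants \<open>B\<close> and \<open>C\<close>, which depend on the range of \<open>z\<close>, can be
  fixed before the ball is chosen.
\<close>

section \<open>Calculus of the classes of differentiable functions\<close>

lemma frechet_derivative_eq: "(f has_derivative f') (at x) \<Longrightarrow> frechet_derivative f (at x) = f'"
  by (metis frechet_derivative_at)

lemma Ck_on_cong:
  assumes "open S" "\<And>x. x \<in> S \<Longrightarrow> f x = g x" "Ck_on k S f"
  shows "Ck_on k S g"
  using assms(2,3)
proof (induction k arbitrary: f g)
  case 0
  then show ?case
    using continuous_on_cong[of S S f g] by simp
next
  case (Suc k)
  have D: "(g has_derivative frechet_derivative f (at x)) (at x)" if "x \<in> S" for x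
    using Suc.prems that assms(1) has_derivative_transform_within_open[of f "frechet_derivative f (at x)" x UNIV S g]
    by (simp add: frechet_derivative_works)
  have "Ck_on k S (\<lambda>x. frechet_derivative g (at x) v)" for v
  proof (rule Suc.IH)
    show "frechet_derivative f (at x) v = frechet_derivative g (at x) v" if "x \<in> S" for x
      using frechet_derivative_eq[OF D[OF that]] by simp
    show "Ck_on k S (\<lambda>x. frechet_derivative f (at x) v)"
      using Suc.prems by simp
  qed
  then show ?case
    using D by (auto simp: differentiable_def)
qed

lemma Ck_on_subset: "Ck_on k S f \<Longrightarrow> T \<subseteq> S \<Longrightarrow> Ck_on k T f"
  by (induction k arbitrary: f) (auto intro: continuous_on_subset)

lemma Ck_on_continuous_on: "Ck_on k S f \<Longrightarrow> continuous_on S f"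
  by (cases k) (auto intro!: continuous_at_imp_continuous_on differentiable_imp_continuous_within)

lemma Ck_on_SucD: "Ck_on (Suc k) S f \<Longrightarrow> Ck_on k S f"
proof (induction k arbitrary: f)
  case 0
  then show ?case using Ck_on_continuous_on[of "Suc 0"] by (simp only: Ck_on.simps(1))
next
  case (Suc k)
  show ?case
    using Suc.prems Suc.IH by (subst Ck_on.simps(2)) (simp only: Ck_on.simps(2) simp_thms; blast)
qed

lemma Ck_on_Un:
  assumes "open S" "open T" "Ck_on k S f" "Ck_on k T f"
  shows "Ck_on k (S \<union> T) f"
  using assms(3,4)
proof (induction k arbitrary: f)
  case 0
  then show ?case using assms(1,2) continuous_on_open_Un by auto
next
  case (Suc k)
  then show ?case by auto
qed

lemma Ck_on_SucI:
  assumes "open S" "\<And>x. x \<in> S \<Longrightarrow> (f has_derivative D x) (at x)" "\<And>v. Ck_on k S (\<lambda>x. D x v)"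
  shows "Ck_on (Suc k) S f"
proof -
  have "Ck_on k S (\<lambda>x. frechet_derivative f (at x) v)" for v
    by (rule Ck_on_cong[OF assms(1) _ assms(3)[of v]]) (simp add: frechet_derivative_eq[OF assms(2)])
  then show ?thesis
    using assms(2) by (auto simp: differentiable_def)
qed

lemma Ck_on_SucE:
  assumes "Ck_on (Suc k) S f"
  obtains D where "\<And>x. x \<in> S \<Longrightarrow> (f has_derivative D x) (at x)" "\<And>v. Ck_on k S (\<lambda>x. D x v)"
proof (rule that)
  show "(f has_derivative frechet_derivative f (at x)) (at x)" if "x \<in> S" for x
    using assms that by (simp add: frechet_derivative_works)
qed (use assms in simp)

lemma Ck_on_const: "Ck_on k S (\<lambda>x. c)"
proof (induction k arbitrary: c)
  case (Suc k)
  then show ?case by simp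
qed simp

lemma Ck_on_linear: "bounded_linear f \<Longrightarrow> Ck_on k S f"
proof (induction k)
  case 0
  then show ?case by (simp add: linear_continuous_on)
next
  case (Suc k)
  have "(f has_derivative f) (at x)" for x
    using Suc.prems by (rule bounded_linear_imp_has_derivative)
  then show ?case using frechet_derivative_eq[of f f]
    by (auto simp: differentiable_def Ck_on_const)
qed

lemma Ck_on_add:
  assumes "open S" "Ck_on k S f" "Ck_on k S g"
  shows "Ck_on k S (\<lambda>x. f x + g x)"
  using assms(2,3)
proof (induction k arbitrary: f g)
  case 0
  then show ?case by (simp add: continuous_on_add)
next
  case (Suc k)
  obtain F where F: "\<And>x. x \<in> S \<Longrightarrow> (f has_derivative F x) (at x)" "\<And>v. Ck_on k S (\<lambda>x. F x v)"
    by (rule Ck_on_SucE[OF Suc.prems(1)]) (rule that)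
  obtain G where G: "\<And>x. x \<in> S \<Longrightarrow> (g has_derivative G x) (at x)" "\<And>v. Ck_on k S (\<lambda>x. G x v)"
    by (rule Ck_on_SucE[OF Suc.prems(2)]) (rule that)
  show ?case
    by (rule Ck_on_SucI[OF assms(1), where D="\<lambda>x v. F x v + G x v"])
      (auto intro!: has_derivative_add F G Suc.IH)
qed

lemma Ck_on_mult:
  fixes f g :: "'a::real_normed_vector \<Rightarrow> real"
  assumes "open S" "Ck_on k S f" "Ck_on k S g"
  shows "Ck_on k S (\<lambda>x. f x * g x)"
  using assms(2,3)
proof (induction k arbitrary: f g)
  case 0
  then show ?case by (simp add: continuous_on_mult)
next
  case (Suc k)
  obtain F where F: "\<And>x. x \<in> S \<Longrightarrow> (f has_derivative F x) (at x)" "\<And>v. Ck_on k S (\<lambda>x. F x v)"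
    by (rule Ck_on_SucE[OF Suc.prems(1)]) (rule that)
  obtain G where G: "\<And>x. x \<in> S \<Longrightarrow> (g has_derivative G x) (at x)" "\<And>v. Ck_on k S (\<lambda>x. G x v)"
    by (rule Ck_on_SucE[OF Suc.prems(2)]) (rule that)
  show ?case
    by (rule Ck_on_SucI[OF assms(1), where D="\<lambda>x v. f x * G x v + F x v * g x"])
      (auto intro!: has_derivative_mult Ck_on_add F G Suc.IH assms(1) Ck_on_SucD[OF Suc.prems(1)] Ck_on_SucD[OF Suc.prems(2)])
qed

lemma Ck_on_compose:
  fixes f :: "'a::real_normed_vector \<Rightarrow> real" and \<phi> :: "real \<Rightarrow> real"
  assumes "open S" "f ` S \<subseteq> T" "Ck_on k T \<phi>" "Ck_on k S f"
  shows "Ck_on k S (\<lambda>x. \<phi> (f x))"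
  using assms(3,4)
proof (induction k arbitrary: \<phi>)
  case 0
  then show ?case
    using assms(2) continuous_on_compose2 by fastforce
next
  case (Suc k)
  obtain F where F: "\<And>x. x \<in> S \<Longrightarrow> (f has_derivative F x) (at x)" "\<And>v. Ck_on k S (\<lambda>x. F x v)"
    by (rule Ck_on_SucE[OF Suc.prems(2)]) (rule that)
  obtain P where P: "\<And>x. x \<in> T \<Longrightarrow> (\<phi> has_derivative P x) (at x)" "\<And>v. Ck_on k T (\<lambda>x. P x v)"
    by (rule Ck_on_SucE[OF Suc.prems(1)]) (rule that)
  have lin: "P t s = s * P t 1" if "t \<in> T" for t s
    using linear_cmul[OF has_derivative_linear[OF P(1)[OF that]], of s 1] by simp
  show ?case
  proof (rule Ck_on_SucI[OF assms(1), where D="\<lambda>x v. P (f x) 1 * F x v"])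
    fix x assume x: "x \<in> S"
    have "((\<lambda>x. \<phi> (f x)) has_derivative (\<lambda>v. P (f x) (F x v))) (at x)"
      using has_derivative_compose[OF F(1)[OF x] P(1)] assms(2) x by blast
    moreover have "(\<lambda>v. P (f x) (F x v)) = (\<lambda>v. P (f x) 1 * F x v)"
      using lin assms(2) x by (metis image_subset_iff mult.commute)
    ultimately show "((\<lambda>x. \<phi> (f x)) has_derivative (\<lambda>v. P (f x) 1 * F x v)) (at x)" by simp
  next
    fix v
    show "Ck_on k S (\<lambda>x. P (f x) 1 * F x v)"
      by (intro Ck_on_mult assms(1) F(2) Suc.IH[OF P(2)] Ck_on_SucD[OF Suc.prems(2)])
  qed
qed

text \<open>
  Covers functions such as powers of the reciprocal, for which differentiation only moves along a
  sequence of functions of the same kind: all derivatives are then obtained by one induction over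
  the order of differentiability, for all members of the sequence at once.
\<close>

lemma Ck_on_family:
  fixes F :: "nat \<Rightarrow> real \<Rightarrow> real"
  assumes "open S"
    and "\<And>n x. x \<in> S \<Longrightarrow> (F n has_real_derivative a n * F (n+1) x + b n * F (n+2) x) (at x)"
  shows "Ck_on k S (F n)"
proof (induction k arbitrary: n)
  case 0
  have "continuous_on S (F n)"
    using assms(2) by (meson DERIV_isCont continuous_at_imp_continuous_on)
  then show ?case by simp
next
  case (Suc k)
  show ?case
  proof (rule Ck_on_SucI[OF assms(1)])
    fix x assume "x \<in> S"
    then show "(F n has_derivative (\<lambda>v. (a n * F (n+1) x + b n * F (n+2) x) * v)) (at x)"
      using assms(2) by (simp add: has_field_derivative_def)
  next
    fix v
    show "Ck_on k S (\<lambda>x. (a n * F (n + 1) x + b n * F (n + 2) x) * v)"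
      by (intro Ck_on_mult Ck_on_add Ck_on_const Suc assms(1))
  qed
qed

lemma smooth_on_mult:
  fixes f g :: "'a::real_normed_vector \<Rightarrow> real"
  shows "open S \<Longrightarrow> smooth_on S f \<Longrightarrow> smooth_on S g \<Longrightarrow> smooth_on S (\<lambda>x. f x * g x)"
  by (simp add: smooth_on_def Ck_on_mult)

lemma smooth_on_add: "open S \<Longrightarrow> smooth_on S f \<Longrightarrow> smooth_on S g \<Longrightarrow> smooth_on S (\<lambda>x. f x + g x)"
  by (simp add: smooth_on_def Ck_on_add)

lemma smooth_on_const: "smooth_on S (\<lambda>x. c)"
  by (simp add: smooth_on_def Ck_on_const)

lemma smooth_on_linear: "bounded_linear f \<Longrightarrow> smooth_on S f"
  by (simp add: smooth_on_def Ck_on_linear)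

lemma smooth_on_compose:
  fixes f :: "'a::real_normed_vector \<Rightarrow> real" and \<phi> :: "real \<Rightarrow> real"
  shows "open S \<Longrightarrow> smooth_on T \<phi> \<Longrightarrow> smooth_on S f \<Longrightarrow> f ` S \<subseteq> T \<Longrightarrow> smooth_on S (\<lambda>x. \<phi> (f x))"
  by (simp add: smooth_on_def Ck_on_compose)

lemma smooth_on_minus:
  fixes f :: "'a::real_normed_vector \<Rightarrow> real"
  assumes "open S" "smooth_on S f"
  shows "smooth_on S (\<lambda>x. - f x)"
  using smooth_on_mult[OF assms(1) smooth_on_const[of S "-1"] assms(2)] by simp

lemma smooth_on_cong:
  assumes "open S" "\<And>x. x \<in> S \<Longrightarrow> f x = g x" "smooth_on S f"
  shows "smooth_on S g"
proof -
  have "Ck_on k S g" for k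
    by (rule Ck_on_cong[OF assms(1), of f]) (use assms(2,3) in \<open>auto simp: smooth_on_def\<close>)
  then show ?thesis by (simp add: smooth_on_def)
qed

lemma smooth_on_Un: "open S \<Longrightarrow> open T \<Longrightarrow> smooth_on S f \<Longrightarrow> smooth_on T f \<Longrightarrow> smooth_on (S \<union> T) f"
  by (simp add: smooth_on_def Ck_on_Un)

lemma smooth_on_subset: "smooth_on S f \<Longrightarrow> T \<subseteq> S \<Longrightarrow> smooth_on T f"
  by (auto simp: smooth_on_def intro: Ck_on_subset)

lemma smooth_on_exp: "smooth_on UNIV (exp :: real \<Rightarrow> real)"
proof -
  have "Ck_on k UNIV (exp :: real \<Rightarrow> real)" for k
    by (rule Ck_on_family[where F="\<lambda>n. exp" and a="\<lambda>n. 1" and b="\<lambda>n. 0"])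
      (auto intro!: derivative_eq_intros)
  then show ?thesis by (simp add: smooth_on_def)
qed

lemma smooth_on_inverse: "smooth_on (- {0}) (inverse :: real \<Rightarrow> real)"
proof -
  have "Ck_on k (- {0::real}) (\<lambda>x. inverse x ^ (n+1))" for k n
  proof (rule Ck_on_family[where F="\<lambda>n x. inverse x ^ (n+1)" and a="\<lambda>n. - real (n+1)" and b="\<lambda>n. 0"])
    fix n and x :: real assume "x \<in> - {0}"
    then show "((\<lambda>x. inverse x ^ (n+1)) has_real_derivative
        - real (n+1) * inverse x ^ (n+1+1) + 0 * inverse x ^ (n+2+1)) (at x)"
      using DERIV_power_Suc[OF DERIV_inverse[of x], of n] by (simp add: algebra_simps numeral_2_eq_2)
  qed auto
  from this[of _ 0] show ?thesis by (simp add: smooth_on_def)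
qed

lemma smooth_on_ln: "smooth_on {0<..} (ln :: real \<Rightarrow> real)"
  unfolding smooth_on_def
proof
  fix k
  show "Ck_on k {0<..} (ln :: real \<Rightarrow> real)"
  proof (cases k)
    case 0
    then show ?thesis by (auto intro!: continuous_intros)
  next
    case (Suc j)
    have "Ck_on j {0<..} (inverse :: real \<Rightarrow> real)"
      using smooth_on_inverse Ck_on_subset[of j "-{0}" inverse "{0<..}"] by (auto simp: smooth_on_def)
    then show ?thesis
      unfolding Suc
    proof (intro Ck_on_SucI)
      show "(ln has_derivative (\<lambda>v. inverse x * v)) (at x)" if "x \<in> {0<..}" for x :: real
        using DERIV_ln[of x] that by (simp add: has_field_derivative_def)
      show "Ck_on j {0<..} (\<lambda>x. inverse x * v)" for v :: real
        using \<open>Ck_on j {0<..} inverse\<close> by (intro Ck_on_mult Ck_on_const) auto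
    qed auto
  qed
qed

lemma smooth_on_affine: "smooth_on S (\<lambda>y. n \<bullet> (y - x0))"
proof -
  have "Ck_on k S (\<lambda>y. n \<bullet> (y - x0))" for k
  proof (cases k)
    case 0
    then show ?thesis by (auto intro!: continuous_intros)
  next
    case (Suc j)
    have "((\<lambda>y. n \<bullet> (y - x0)) has_derivative (\<lambda>v. n \<bullet> v)) (at x)" for x
      by (auto intro!: derivative_eq_intros)
    from frechet_derivative_eq[OF this] this show ?thesis
      unfolding Suc by (auto simp: differentiable_def Ck_on_const)
  qed
  then show ?thesis by (simp add: smooth_on_def)
qed

lemma smooth_on_norm_square:
  fixes x0 :: "'a::euclidean_space"
  assumes "open S"
  shows "smooth_on S (\<lambda>y. (norm (y - x0))\<^sup>2)"
proof -
  have sum: "smooth_on S (\<lambda>y. \<Sum>b\<in>I. (b \<bullet> (y - x0)) * (b \<bullet> (y - x0)))" if "finite I" for I :: "'a set"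
    using that by (induction I rule: finite_induct) (simp_all add: smooth_on_const smooth_on_add smooth_on_mult smooth_on_affine assms)
  have "(\<lambda>y. (norm (y - x0))\<^sup>2) = (\<lambda>y. \<Sum>b\<in>Basis. (b \<bullet> (y - x0)) * (b \<bullet> (y - x0)))"
    by (auto simp: power2_norm_eq_inner euclidean_inner[of "_ - _"] inner_commute)
  then show ?thesis using sum[OF finite_Basis] by simp
qed

section \<open>A smooth cutoff function\<close>

text \<open>
  Derivatives of \<open>exp (- 1 / t)\<close>, extended by zero, are combinations of these functions.
\<close>

definition flat :: "nat \<Rightarrow> real \<Rightarrow> real" where
  "flat n t = (if t \<le> 0 then 0 else inverse t ^ n * exp (- inverse t))"

text \<open>
  The difference quotient of \<open>flat n\<close> at 0. On the right the exponential beats every power of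
  \<open>1 / t\<close>.
\<close>

lemma flat_lim: "((\<lambda>h. flat n h / h) \<longlongrightarrow> 0) (at 0)"
proof -
  have "((\<lambda>x::real. x ^ (n+1) / exp x) \<longlongrightarrow> 0) at_top"
    by (rule tendsto_power_div_exp_0)
  then have "((\<lambda>t::real. inverse t ^ (n+1) / exp (inverse t)) \<longlongrightarrow> 0) (at_right 0)"
    by (rule filterlim_compose[OF _ filterlim_inverse_at_top_right])
  then have "((\<lambda>h. flat n h / h) \<longlongrightarrow> 0) (at_right 0)"
  proof (rule Lim_transform_eventually)
    show "\<forall>\<^sub>F t in at_right 0. inverse t ^ (n+1) / exp (inverse t) = flat n t / t"
      using eventually_at_right_less[of 0]
      by eventually_elim (simp add: flat_def exp_minus field_simps)
  qed
  moreover have "((\<lambda>h. flat n h / h) \<longlongrightarrow> 0) (at_left 0)"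
  proof (rule Lim_transform_eventually[OF tendsto_const])
    show "\<forall>\<^sub>F t in at_left 0. 0 = flat n t / t"
      by (rule eventually_at_leftI[of "-1"]) (auto simp: flat_def)
  qed
  ultimately show ?thesis
    using filterlim_split_at by blast
qed

lemma flat_deriv:
  "(flat n has_real_derivative - real n * flat (n+1) t + 1 * flat (n+2) t) (at t)"
proof -
  consider "t < 0" | "t = 0" | "t > 0" by linarith
  then show ?thesis
  proof cases
    case 1
    have "(flat n has_real_derivative 0) (at t)"
      by (rule has_field_derivative_transform_within_open[OF DERIV_const[of 0], of "{..<0}"])
        (use 1 in \<open>auto simp: flat_def\<close>)
    then show ?thesis using 1 by (simp add: flat_def)
  next
    case 2
    have "(flat n has_real_derivative 0) (at 0)"
      unfolding has_field_derivative_iff using flat_lim[of n] by (simp add: flat_def)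
    then show ?thesis using 2 by (simp add: flat_def)
  next
    case 3
    have inv: "(inverse has_real_derivative - (inverse t ^ 2)) (at t)"
      using DERIV_inverse[of t] 3 by (simp add: numeral_2_eq_2)
    have "((\<lambda>t. inverse t ^ n) has_real_derivative - real n * inverse t ^ (n+1)) (at t)"
    proof (cases n)
      case (Suc m)
      show ?thesis
        unfolding Suc using DERIV_power_Suc[OF inv, of m] by (simp add: power2_eq_square algebra_simps)
    qed simp
    moreover have "((\<lambda>t. exp (- inverse t)) has_real_derivative exp (- inverse t) * inverse t ^ 2) (at t)"
      using DERIV_chain2[OF DERIV_exp DERIV_minus[OF inv]] by simp
    ultimately have "((\<lambda>t. inverse t ^ n * exp (- inverse t)) has_real_derivative
        - real n * inverse t ^ (n+1) * exp (- inverse t) + exp (- inverse t) * inverse t ^ 2 * inverse t ^ n) (at t)"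
      using DERIV_mult by blast
    moreover have "- real n * inverse t ^ (n+1) * exp (- inverse t) + exp (- inverse t) * inverse t ^ 2 * inverse t ^ n = - real n * flat (n+1) t + 1 * flat (n+2) t"
      using 3 by (simp add: flat_def power_add power2_eq_square mult_ac)
    ultimately have "((\<lambda>t. inverse t ^ n * exp (- inverse t)) has_real_derivative
        - real n * flat (n+1) t + 1 * flat (n+2) t) (at t)" by simp
    then show ?thesis
      by (rule has_field_derivative_transform_within_open[where S="{0<..}"])
        (use 3 in \<open>auto simp: flat_def\<close>)
  qed
qed

lemma smooth_on_flat: "smooth_on UNIV (flat 0)"
  unfolding smooth_on_def
  using Ck_on_family[where F=flat and S=UNIV and a="\<lambda>n. - real n" and b="\<lambda>n. 1"] flat_deriv by auto

text \<open>
  The usual quotient of flat functions: the denominator never vanishes because the two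
  arguments cannot both be nonpositive.
\<close>

lemma smooth_cutoff:
  assumes "a < (b::real)"
  obtains \<psi> :: "real \<Rightarrow> real" where "smooth_on UNIV \<psi>" "\<And>t. t \<le> a \<Longrightarrow> \<psi> t = 0"
    "\<And>t. t \<ge> b \<Longrightarrow> \<psi> t = 1" "\<And>t. 0 \<le> \<psi> t" "\<And>t. \<psi> t \<le> 1"
proof
  define p q where "p = (\<lambda>t. flat 0 (t - a))" and "q = (\<lambda>t. flat 0 (b - t))"
  have pos: "p t + q t > 0" "p t \<ge> 0" "q t \<ge> 0" for t
    using assms by (auto simp: p_def q_def flat_def add_pos_nonneg)
  have sh: "smooth_on UNIV (\<lambda>t. t + c)" "smooth_on UNIV (\<lambda>t. c - t)" for c :: real
    using smooth_on_add[OF open_UNIV smooth_on_linear[OF bounded_linear_ident] smooth_on_const[of UNIV c]]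
      smooth_on_add[OF open_UNIV smooth_on_const[of UNIV c] smooth_on_linear[OF bounded_linear_minus[OF bounded_linear_ident]]]
    by simp_all
  have p: "smooth_on UNIV p" unfolding p_def
    using smooth_on_compose[OF open_UNIV smooth_on_flat sh(1)[of "-a"]] by simp
  have q: "smooth_on UNIV q" unfolding q_def
    using smooth_on_compose[OF open_UNIV smooth_on_flat sh(2)[of b]] by simp
  let ?\<psi> = "\<lambda>t. p t * inverse (p t + q t)"
  show "smooth_on UNIV ?\<psi>"
  proof (intro smooth_on_mult p open_UNIV smooth_on_compose[OF open_UNIV smooth_on_inverse])
    show "smooth_on UNIV (\<lambda>t. p t + q t)" by (intro smooth_on_add p q open_UNIV)
    show "range (\<lambda>t. p t + q t) \<subseteq> - {0}" proof (rule image_subsetI)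
      show "p t + q t \<in> - {0}" for t
        using pos(1)[of t] by simp
    qed
  qed
  show "?\<psi> t = 0" if "t \<le> a" for t using that by (simp add: p_def flat_def)
  show "?\<psi> t = 1" if "t \<ge> b" for t
    using that pos(1)[of t] by (simp add: q_def flat_def)
  show "0 \<le> ?\<psi> t" "?\<psi> t \<le> 1" for t using pos[of t] by (auto simp: field_simps)
qed

text \<open>
  Extends a function by zero from a paraboloid touching \<open>x0\<close> to a punctured ball. This is
  possible because the cutoff depends on \<open>s / |x - x0|\<^sup>2\<close>, which is smooth away from \<open>x0\<close>, and vanishes
  already in a neighbourhood of the part of the boundary of the paraboloid other than \<open>x0\<close>.
\<close>

lemma smooth_on_paraboloid_cutoff:
  fixes x0 n :: "'a::euclidean_space" and f :: "'a \<Rightarrow> real"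
  assumes c: "c > 0"
    and f: "smooth_on {x \<in> ball x0 R. c / 4 * (norm (x - x0))\<^sup>2 < n \<bullet> (x - x0)} f"
    and \<psi>: "smooth_on UNIV \<psi>" "\<And>t. t \<le> c / 2 \<Longrightarrow> \<psi> t = 0"
  shows "smooth_on (ball x0 R - {x0}) (\<lambda>x. \<psi> ((n \<bullet> (x - x0)) / (norm (x - x0))\<^sup>2) * f x)"
proof -
  let ?g = "\<lambda>x. \<psi> ((n \<bullet> (x - x0)) / (norm (x - x0))\<^sup>2) * f x"
  let ?D = "{x \<in> ball x0 R. c / 4 * (norm (x - x0))\<^sup>2 < n \<bullet> (x - x0)}"
  let ?E = "ball x0 R \<inter> {x. n \<bullet> (x - x0) < c / 2 * (norm (x - x0))\<^sup>2}"
  have D: "?D = ball x0 R \<inter> {x. c / 4 * (norm (x - x0))\<^sup>2 < n \<bullet> (x - x0)}" by auto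
  have oD: "open ?D" unfolding D
    by (intro open_Int open_Collect_less continuous_intros open_ball)
  have oD0: "open ?E"
    by (intro open_Int open_Collect_less continuous_intros open_ball)
  have "smooth_on ?D ?g"
  proof (intro smooth_on_mult oD f)
    have "smooth_on ?D (\<lambda>x. (n \<bullet> (x - x0)) * inverse ((norm (x - x0))\<^sup>2))"
    proof (intro smooth_on_mult oD smooth_on_affine smooth_on_compose[OF oD smooth_on_inverse])
      show "smooth_on ?D (\<lambda>x. (norm (x - x0))\<^sup>2)" by (rule smooth_on_norm_square[OF oD])
      show "(\<lambda>x. (norm (x - x0))\<^sup>2) ` ?D \<subseteq> - {0}" by auto
    qed
    then have "smooth_on ?D (\<lambda>x. (n \<bullet> (x - x0)) / (norm (x - x0))\<^sup>2)"
      by (simp only: divide_inverse)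
    then show "smooth_on ?D (\<lambda>x. \<psi> ((n \<bullet> (x - x0)) / (norm (x - x0))\<^sup>2))"
      by (rule smooth_on_compose[OF oD \<psi>(1)]) simp
  qed
  moreover have "smooth_on ?E ?g"
  proof (rule smooth_on_cong[OF oD0 _ smooth_on_const[of _ 0]])
    fix x assume x: "x \<in> ?E"
    then have "x \<noteq> x0" by auto
    then have "(n \<bullet> (x - x0)) / (norm (x - x0))\<^sup>2 \<le> c / 2" using x by (auto simp: divide_simps)
    then show "0 = ?g x" using \<psi>(2) by simp
  qed
  ultimately have "smooth_on (?D \<union> ?E) ?g" by (rule smooth_on_Un[OF oD oD0])
  then show ?thesis
  proof (rule smooth_on_subset)
    show "ball x0 R - {x0} \<subseteq> ?D \<union> ?E"
    proof
      fix x assume x: "x \<in> ball x0 R - {x0}"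
      then have "c / 4 * (norm (x - x0))\<^sup>2 < c / 2 * (norm (x - x0))\<^sup>2" using c by simp
      then have "c / 4 * (norm (x - x0))\<^sup>2 < n \<bullet> (x - x0) \<or> n \<bullet> (x - x0) < c / 2 * (norm (x - x0))\<^sup>2"
        by linarith
      then show "x \<in> ?D \<union> ?E" using x by auto
    qed
  qed
qed

section \<open>Smooth concave majorants of a modulus of continuity\<close>

text \<open>
  For \<open>n = 0\<close> this is one minus the average, with weights \<open>2\<^sup>-\<^sup>1, 2\<^sup>-\<^sup>2, \<dots>\<close>, of the concave
  functions \<open>u / (u + a j)\<close>, each of which rises from 0 to almost 1 near the scale \<open>a j\<close>. Sending
  the scales to 0 fast enough makes the average larger than any prescribed modulus of continuity,
  while it stays smooth for \<open>u > 0\<close>. The higher \<open>n\<close> give its derivatives up to factors.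
\<close>

definition hyperbola_sum :: "(nat \<Rightarrow> real) \<Rightarrow> nat \<Rightarrow> real \<Rightarrow> real" where
  "hyperbola_sum a n u = (\<Sum>j. (1/2)^Suc j * (a j / (u + a j)^(n+1)))"

text \<open>
  Majorant for the Weierstrass test on half lines \<open>{\<delta>..}\<close> away from 0.
\<close>

lemma hyperbola_sum_summand_bound:
  fixes u \<delta> :: real
  assumes "\<And>j. a j > 0" "\<delta> > 0" "u \<ge> \<delta>" "\<And>j. a j \<le> 1"
  shows "norm ((1/2)^Suc j * (a j / (u + a j)^(n+1))) \<le> (1/2)^Suc j * (1/\<delta>^(n+1))"
proof -
  have "a j / (u + a j)^(n+1) \<le> 1 / \<delta>^(n+1)"
    using assms(1)[of j] assms(2-4) by (intro frac_le power_mono) (auto simp: add_increasing2 less_imp_le)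
  moreover have "0 \<le> a j / (u + a j)^(n+1)"
    using assms(1)[of j] assms(2,3) by simp
  ultimately have "\<bar>a j / (u + a j)^(n+1)\<bar> \<le> 1 / \<delta>^(n+1)" by (simp only: abs_of_nonneg)
  then show ?thesis
    unfolding real_norm_def abs_mult by (intro mult_mono) auto
qed

lemma summable_half: "summable (\<lambda>j. (1/2)^Suc j * (c::real))"
  by (intro summable_mult2 sums_summable[OF power_half_series])

lemma hyperbola_sum_deriv:
  assumes "\<And>j. a j > 0" "\<And>j. a j \<le> 1" "u > 0"
  shows "(hyperbola_sum a n has_real_derivative - real (n+1) * hyperbola_sum a (n+1) u) (at u)"
proof -
  let ?f = "\<lambda>n j u. (1/2)^Suc j * (a j / (u + a j)^(n+1))"
  let ?S = "{u/2<..}"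
  have sm: "summable (\<lambda>j. ?f m j x)" if "x > 0" for m x
    by (rule summable_comparison_test'[OF summable_half, of 0])
      (rule hyperbola_sum_summand_bound[where \<delta>=x], use that assms in auto)
  have "((\<lambda>x. \<Sum>j. ?f n j x) has_field_derivative (\<Sum>j. - real (n+1) * ?f (n+1) j u)) (at u)"
  proof (rule has_field_derivative_series'(2)[where S="?S" and ?x0.0=u])
    fix j x assume "x \<in> ?S"
    then have "x + a j > 0" "x > 0" using assms(1)[of j] assms(3) by (auto intro: add_pos_pos)
    then have "x + a j \<noteq> 0" by simp
    have "((\<lambda>x. inverse (x + a j)) has_real_derivative - (inverse (x + a j) ^ 2)) (at x)"
      using \<open>x + a j \<noteq> 0\<close> by (auto intro!: derivative_eq_intros simp: power2_eq_square)
    note D = DERIV_power_Suc[OF this, of n]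
    have e: "inverse (y^(n+1)) = inverse y ^ Suc n"
      "- real (n+1) * (1 / y^(n+1+1)) = (1 + real n) * (- (inverse y ^ 2) * inverse y ^ n)" for y :: real
      by (simp_all add: power_inverse divide_inverse power2_eq_square algebra_simps)
    have "((\<lambda>x. inverse ((x + a j)^(n+1))) has_real_derivative
        - real (n+1) * (1 / (x + a j)^(n+1+1))) (at x)"
      unfolding e by (rule D)
    note D = DERIV_cmult[OF this, of "(1/2)^Suc j * a j"]
    have e: "c * (b / y) = c * b * inverse y" "- r * (c * (b / y)) = c * b * (- r * (1 / y))" for b c r y :: real
      by (simp_all add: divide_inverse)
    show "(?f n j has_field_derivative - real (n+1) * ?f (n+1) j x) (at x within ?S)"
      by (subst e(2), subst e(1)) (rule has_field_derivative_at_within[OF D])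
  next
    have "uniformly_convergent_on ?S (\<lambda>k x. \<Sum>i<k. - real (n+1) * ?f (n+1) i x)"
    proof (rule Weierstrass_m_test')
      show "summable (\<lambda>j. real (n+1) * ((1/2)^Suc j * (1/(u/2)^(n+1+1))))"
        by (intro summable_mult summable_half)
      fix j x assume "x \<in> ?S"
      then show "norm (- real (n+1) * ?f (n+1) j x) \<le> real (n+1) * ((1/2)^Suc j * (1/(u/2)^(n+1+1)))"
        unfolding norm_mult[of "- real (n+1)"]
        using hyperbola_sum_summand_bound[where \<delta>="u/2" and u=x and a=a and n="n+1" and j=j] assms
        by (intro mult_mono) auto
    qed
    then show "uniformly_convergent_on ?S (\<lambda>k x. \<Sum>i<k. - real (n+1) * ?f (n+1) i x)" .
  qed (use assms sm in \<open>auto simp: interior_open\<close>)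
  also have "(\<Sum>j. - real (n+1) * ?f (n+1) j u) = - real (n+1) * hyperbola_sum a (n+1) u"
    unfolding hyperbola_sum_def by (rule suminf_mult[OF sm[OF assms(3)]])
  finally show ?thesis unfolding hyperbola_sum_def .
qed

lemma smooth_on_hyperbola_sum:
  assumes "\<And>j. a j > 0" "\<And>j. a j \<le> 1"
  shows "smooth_on {0<..} (hyperbola_sum a n)"
proof -
  have "Ck_on k {0<..} (hyperbola_sum a n)" for k
    by (rule Ck_on_family[where a="\<lambda>n. - real (n+1)" and b="\<lambda>n. 0"])
      (use hyperbola_sum_deriv[OF assms] in auto)
  then show ?thesis by (simp add: smooth_on_def)
qed

lemma hyperbola_sum_nonneg:
  assumes "\<And>j. a j > 0" "\<And>j. a j \<le> 1" "u > 0"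
  shows "hyperbola_sum a n u \<ge> 0"
proof -
  have "summable (\<lambda>j. (1/2)^Suc j * (a j / (u + a j)^(n+1)))"
    by (rule summable_comparison_test'[OF summable_half, of 0])
      (rule hyperbola_sum_summand_bound[where \<delta>=u], use assms in auto)
  then show ?thesis
    unfolding hyperbola_sum_def using assms by (intro suminf_nonneg) (auto simp: add_nonneg_nonneg less_imp_le)
qed

lemma one_minus_hyperbola_sum:
  assumes "\<And>j. a j > 0" "u \<ge> (0::real)"
  shows "(\<lambda>j. (1/2)^Suc j * (u / (u + a j))) sums (1 - hyperbola_sum a 0 u)"
proof -
  have b: "0 \<le> a j / (u + a j)" "a j / (u + a j) \<le> 1" "u / (u + a j) = 1 - a j / (u + a j)" for j
    using assms(1)[of j] assms(2) by (auto simp: field_simps)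
  have "summable (\<lambda>j. (1/2)^Suc j * (a j / (u + a j)))"
    by (rule summable_comparison_test'[OF summable_half[of 1], of 0])
      (use b(1,2) in \<open>simp only: real_norm_def abs_mult abs_of_nonneg zero_le_power zero_le_divide_1_iff
        zero_le_numeral; intro mult_left_mono; simp\<close>)
  then have "(\<lambda>j. (1/2)^Suc j * (a j / (u + a j))) sums hyperbola_sum a 0 u"
    by (simp add: hyperbola_sum_def summable_sums)
  from sums_diff[OF power_half_series this] show ?thesis
    by (simp only: b(3) right_diff_distrib mult_1_right)
qed

text \<open>
  Each summand \<open>u / (u + a j)\<close> is bounded by 1, so the series converges uniformly up to the
  endpoint 0, although its derivatives may blow up there.
\<close>

lemma hyperbola_sum_at_0:
  assumes "\<And>j. a j > 0"
  shows "((\<lambda>u. 1 - hyperbola_sum a 0 u) \<longlongrightarrow> 0) (at_right 0)"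
proof -
  let ?f = "\<lambda>j u. (1/2)^Suc j * (u / (u + a j))"
  have "uniform_limit {0..} (\<lambda>n u. \<Sum>j<n. ?f j u) (\<lambda>u. \<Sum>j. ?f j u) sequentially"
  proof (rule Weierstrass_m_test)
    fix j and u :: real assume "u \<in> {0..}"
    then have "0 \<le> u / (u + a j)" "u / (u + a j) \<le> 1" using assms[of j] by (auto simp: field_simps)
    then show "norm (?f j u) \<le> (1/2)^Suc j * 1"
      by (simp only: real_norm_def abs_mult abs_of_nonneg zero_le_power zero_le_divide_1_iff
        zero_le_numeral) (intro mult_left_mono; simp)
  qed (rule summable_half)
  then have "continuous_on {0..} (\<lambda>u. \<Sum>j. ?f j u)"
  proof (rule uniform_limit_theorem[rotated])
    have ne: "u + a j \<noteq> 0" if "u \<in> {0..}" for u j using that assms[of j] by auto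
    show "\<forall>\<^sub>F n in sequentially. continuous_on {0..} (\<lambda>u. \<Sum>j<n. ?f j u)"
      by (intro always_eventually allI continuous_intros) (use ne in auto)
  qed simp
  then have "((\<lambda>u. \<Sum>j. ?f j u) \<longlongrightarrow> (\<Sum>j. ?f j 0)) (at 0 within {0..})"
    unfolding continuous_on_def by (rule bspec) simp
  also have "(\<Sum>j. ?f j 0) = 0" by simp
  finally have "((\<lambda>u. \<Sum>j. ?f j u) \<longlongrightarrow> 0) (at 0 within {0<..})"
    by (rule tendsto_within_subset) auto
  then show ?thesis
  proof (rule Lim_transform_eventually)
    show "\<forall>\<^sub>F u in at_right 0. (\<Sum>j. ?f j u) = 1 - hyperbola_sum a 0 u"
      using eventually_at_right_less[of 0]
      by eventually_elim (use one_minus_hyperbola_sum[OF assms] in \<open>simp add: sums_unique[symmetric]\<close>)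
  qed
qed

lemma hyperbola_sum_ge:
  assumes "\<And>j. a j > 0" "u \<ge> a j"
  shows "1 - hyperbola_sum a 0 u \<ge> (1/2)^Suc j / 2"
proof -
  have u: "u > 0" using assms(1)[of j] assms(2) by linarith
  let ?f = "\<lambda>j. (1/2)^Suc j * (u / (u + a j))"
  have "1/2 \<le> u / (u + a j)" using u assms(1)[of j] assms(2) by (simp add: field_simps)
  then have "(1/2)^Suc j * (1/2) \<le> ?f j" by (intro mult_left_mono) auto
  also have "?f j = sum ?f {j}" by simp
  also have "\<dots> \<le> suminf ?f"
    by (rule sum_le_suminf)
      (use one_minus_hyperbola_sum[OF assms(1), of u] u assms(1) in \<open>auto simp: sums_iff add_nonneg_nonneg less_imp_le\<close>)
  finally show ?thesis using one_minus_hyperbola_sum[OF assms(1), of u] u by (simp add: sums_iff)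
qed

lemma hyperbola_sum_ge_half:
  assumes "\<And>j. a j > 0" "\<And>j. u \<ge> a j"
  shows "1 - hyperbola_sum a 0 u \<ge> 1/2"
proof -
  have u: "u > 0" using assms(1)[of 0] assms(2)[of 0] by linarith
  have "1/2 \<le> u / (u + a j)" for j using u assms(1)[of j] assms(2)[of j] by (simp add: field_simps)
  then have "(1/2)^Suc j * (1/2) \<le> (1/2)^Suc j * (u / (u + a j))" for j by (intro mult_left_mono) auto
  from sums_le[OF this sums_mult2[OF power_half_series] one_minus_hyperbola_sum[OF assms(1)]] u
  show ?thesis by simp
qed

text \<open>
  The function that is composed with the supersolution. It is \<open>F = ln (1 + V) / B\<close> with \<open>V\<close>
  concave and increasing. The logarithm gives \<open>F'' + B F'\<^sup>2 = V'' / (B (1 + V)) \<le> 0\<close>. The function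
  \<open>V\<close> is the average of hyperbolas times \<open>E0\<close>, which makes \<open>F\<close> larger than a prescribed modulus
  if the scales \<open>a j\<close> are well chosen, and nearly constant beyond the largest of them, plus \<open>\<Lambda> u\<close>, which keeps the slope away from 0.
\<close>

lemma saturating_majorant:
  fixes B E0 \<Lambda> :: real
  assumes B: "B \<ge> 1" and E0: "E0 > 0" and L: "\<Lambda> > 0"
    and a: "\<And>j. a j > 0" "\<And>j. a j \<le> 1"
  obtains F F1 F2 :: "real \<Rightarrow> real" where
    "smooth_on {0<..} F"
    "\<And>u. u > 0 \<Longrightarrow> (F has_real_derivative F1 u) (at u)"
    "\<And>u. u > 0 \<Longrightarrow> (F1 has_real_derivative F2 u) (at u)"
    "\<And>u. u > 0 \<Longrightarrow> F1 u > 0"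
    "\<And>u. u > 0 \<Longrightarrow> F2 u + B * (F1 u)\<^sup>2 \<le> 0"
    "\<And>u. u > 0 \<Longrightarrow> \<Lambda> * u \<le> 1 \<Longrightarrow> \<Lambda> / (B * (2 + E0)) \<le> F1 u"
    "\<And>u. u > 0 \<Longrightarrow> 0 \<le> F u"
    "\<And>u. u > 0 \<Longrightarrow> \<Lambda> * u \<le> 1 \<Longrightarrow> F u \<le> ln (2 + E0) / B"
    "(F \<longlongrightarrow> 0) (at_right 0)"
    "\<And>u j. u \<ge> a j \<Longrightarrow> \<Lambda> * u \<le> 1 \<Longrightarrow> E0 * ((1/2) ^ Suc j / 2) / (B * (2 + E0)) \<le> F u"
    "\<And>u. \<forall>j. u \<ge> a j \<Longrightarrow> ln (1 + E0 / 2) / B \<le> F u"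
proof -
  define V where "V = (\<lambda>u. E0 * (1 - hyperbola_sum a 0 u) + \<Lambda> * u)"
  define V1 where "V1 = (\<lambda>u. E0 * hyperbola_sum a 1 u + \<Lambda>)"
  define V2 where "V2 = (\<lambda>u. - 2 * E0 * hyperbola_sum a 2 u)"
  define F where "F = (\<lambda>u. ln (1 + V u) * (1 / B))"
  define F1 where "F1 = (\<lambda>u. V1 u / (1 + V u) * (1 / B))"
  define F2 where "F2 = (\<lambda>u. (V2 u * (1 + V u) - V1 u * V1 u) / ((1 + V u) * (1 + V u)) * (1 / B))"
  have h0: "0 \<le> hyperbola_sum a m u" if "u > 0" for m u using hyperbola_sum_nonneg[OF a that] .
  have V0: "V u \<ge> 0" if "u > 0" for u
  proof -
    have "0 \<le> 1 - hyperbola_sum a 0 u"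
      by (rule sums_le[OF _ sums_zero one_minus_hyperbola_sum]) (use that a in \<open>auto simp: add_nonneg_nonneg less_imp_le\<close>)
    then show ?thesis using E0 L that by (simp add: V_def)
  qed
  have Vle: "1 + V u \<le> 2 + E0" if "u > 0" "\<Lambda> * u \<le> 1" for u
  proof -
    have "E0 * (1 - hyperbola_sum a 0 u) \<le> E0 * 1" using h0[OF that(1), of 0] E0 by (intro mult_left_mono) auto
    then show ?thesis using that(2) unfolding V_def by linarith
  qed
  have V1p: "V1 u \<ge> \<Lambda>" if "u > 0" for u using h0[OF that, of 1] E0 by (simp add: V1_def)
  have dV: "(V has_real_derivative V1 u) (at u)" if "u > 0" for u
  proof -
    have "(hyperbola_sum a 0 has_real_derivative - hyperbola_sum a 1 u) (at u)"
      using hyperbola_sum_deriv[OF a that, where n=0] by simp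
    then show ?thesis unfolding V_def V1_def by (auto intro!: derivative_eq_intros)
  qed
  have dV1: "(V1 has_real_derivative V2 u) (at u)" if "u > 0" for u
  proof -
    have "(hyperbola_sum a 1 has_real_derivative - 2 * hyperbola_sum a 2 u) (at u)"
      using hyperbola_sum_deriv[OF a that, where n=1] by (simp add: numeral_2_eq_2)
    then show ?thesis unfolding V1_def V2_def by (auto intro!: derivative_eq_intros)
  qed
  have sV: "smooth_on {0<..} (\<lambda>u. 1 + V u)"
    unfolding V_def diff_conv_add_uminus
    by (intro smooth_on_add smooth_on_mult smooth_on_minus smooth_on_const smooth_on_hyperbola_sum a
        smooth_on_linear bounded_linear_ident open_greaterThan)
  show ?thesis
  proof (rule that[of F F1 F2])
    show "smooth_on {0<..} F"
      unfolding F_def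
    proof (intro smooth_on_mult smooth_on_const open_greaterThan)
      show "smooth_on {0<..} (\<lambda>u. ln (1 + V u))"
      proof (rule smooth_on_compose[OF _ smooth_on_ln sV])
        show "(\<lambda>u. 1 + V u) ` {0<..} \<subseteq> {0<..}" using V0 by (auto intro: add_pos_nonneg)
      qed simp
    qed
    show "(F has_real_derivative F1 u) (at u)" if "u > 0" for u
      unfolding F_def F1_def using V0[OF that] B
      by (auto intro!: derivative_eq_intros dV[OF that] simp: add_pos_nonneg)
    show "(F1 has_real_derivative F2 u) (at u)" if "u > 0" for u
    proof -
      have "1 + V u \<noteq> 0" using V0[OF that] by linarith
      have dW: "((\<lambda>u. 1 + V u) has_real_derivative V1 u) (at u)"
        by (auto intro!: derivative_eq_intros dV[OF that])
      have "((\<lambda>u. V1 u / (1 + V u)) has_real_derivative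
          (V2 u * (1 + V u) - V1 u * V1 u) / ((1 + V u) * (1 + V u))) (at u)"
        by (rule DERIV_divide[where f=V1 and g="\<lambda>u. 1 + V u", OF dV1[OF that] dW \<open>1 + V u \<noteq> 0\<close>])
      then show ?thesis unfolding F1_def F2_def by (rule DERIV_cmult_right)
    qed
    show "F1 u > 0" if "u > 0" for u
      unfolding F1_def using V1p[OF that] V0[OF that] L B by simp
    show "F2 u + B * (F1 u)\<^sup>2 \<le> 0" if "u > 0" for u
    proof -
      have "1 + V u > 0" using V0[OF that] by linarith
      then have "F2 u + B * (F1 u)\<^sup>2 = V2 u / ((1 + V u) * B)"
      proof -
        have "(v2 * w - v1 * v1) / (w * w) * (1 / B) + B * (v1 / w * (1 / B))\<^sup>2 = v2 / (w * B)"
          if "w > 0" for v1 v2 w :: real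
          using that B by (simp add: field_simps power2_eq_square)
        from this[OF \<open>1 + V u > 0\<close>] show ?thesis unfolding F1_def F2_def .
      qed
      also have "\<dots> \<le> 0"
        using \<open>1 + V u > 0\<close> B h0[OF that, of 2] E0 by (simp add: V2_def divide_le_0_iff mult_le_0_iff)
      finally show ?thesis .
    qed
    show "\<Lambda> / (B * (2 + E0)) \<le> F1 u" if "u > 0" "\<Lambda> * u \<le> 1" for u
    proof -
      have "\<Lambda> / (2 + E0) \<le> V1 u / (1 + V u)"
        using V1p[OF that(1)] Vle[OF that] V0[OF that(1)] L by (intro frac_le) auto
      then have "\<Lambda> / (2 + E0) * (1 / B) \<le> F1 u" unfolding F1_def using B by (intro mult_right_mono) auto
      then show ?thesis by (simp add: mult.commute)
    qed
    show "0 \<le> F u" if "u > 0" for u unfolding F_def using V0[OF that] B by simp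
    show "F u \<le> ln (2 + E0) / B" if "u > 0" "\<Lambda> * u \<le> 1" for u
      unfolding F_def using Vle[OF that] V0[OF that(1)] B by (simp add: divide_right_mono)
    show "(F \<longlongrightarrow> 0) (at_right 0)"
    proof -
      have "(V \<longlongrightarrow> E0 * 0 + \<Lambda> * 0) (at_right 0)"
        unfolding V_def by (intro tendsto_add tendsto_mult tendsto_const hyperbola_sum_at_0 a tendsto_ident_at)
      then have "(F \<longlongrightarrow> ln (1 + 0) * (1 / B)) (at_right 0)"
        unfolding F_def by (intro tendsto_mult tendsto_ln tendsto_add tendsto_const) auto
      then show ?thesis by simp
    qed
    show "E0 * ((1/2) ^ Suc j / 2) / (B * (2 + E0)) \<le> F u" if "u \<ge> a j" "\<Lambda> * u \<le> 1" for u j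
    proof -
      have u: "u > 0" using that(1) a(1)[of j] by linarith
      have "E0 * ((1/2) ^ Suc j / 2) \<le> E0 * (1 - hyperbola_sum a 0 u)"
        using hyperbola_sum_ge[of a, OF a(1) that(1)] E0 by (intro mult_left_mono) auto
      also have "\<dots> \<le> V u" using L u by (simp add: V_def)
      finally have "E0 * ((1/2) ^ Suc j / 2) / (2 + E0) \<le> V u / (1 + V u)"
        using Vle[OF u that(2)] V0[OF u] E0 by (intro frac_le) auto
      \<comment> \<open>\<open>ln y \<le> y - 1\<close> at the reciprocal of \<open>1 + V u\<close>\<close>
      also have "\<dots> \<le> ln (1 + V u)"
      proof -
        have "ln (inverse (1 + V u)) \<le> inverse (1 + V u) - 1"
          using V0[OF u] by (intro ln_le_minus_one) auto
        moreover have "inverse (1 + V u) - 1 = - (V u / (1 + V u))"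
          using V0[OF u] by (simp add: field_simps)
        ultimately show ?thesis using V0[OF u] by (simp add: ln_inverse)
      qed
      finally have "E0 * ((1/2) ^ Suc j / 2) / (2 + E0) * (1 / B) \<le> F u"
        unfolding F_def using B by (intro mult_right_mono) auto
      moreover have "y / (2 + E0) * (1 / B) = y / (B * (2 + E0))" for y by (simp add: mult.commute)
      ultimately show ?thesis by metis
    qed
    show "ln (1 + E0 / 2) / B \<le> F u" if "\<forall>j. u \<ge> a j" for u
    proof -
      have u: "u > 0" using that[rule_format, of 0] a(1)[of 0] by linarith
      have "E0 * (1 / 2) \<le> E0 * (1 - hyperbola_sum a 0 u)"
        using hyperbola_sum_ge_half[of a, OF a(1) that[rule_format]] E0 by (intro mult_left_mono) auto
      also have "\<dots> \<le> V u" using L u by (simp add: V_def)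
      finally show ?thesis unfolding F_def using E0 B by (simp add: divide_right_mono)
    qed
  qed
qed

section \<open>Strongly convex domains and paraboloids\<close>

text \<open>
  Peano form of the remainder: differentiability of the gradient at the single point \<open>x\<close> is
  enough, by the mean value theorem on the segment from \<open>x\<close> to \<open>x + w\<close>.
\<close>

lemma second_order_expansion:
  fixes f :: "'a::euclidean_space \<Rightarrow> real"
  assumes "open U" "x \<in> U" "\<And>y. y \<in> U \<Longrightarrow> (f has_derivative (\<lambda>v. G y \<bullet> v)) (at y)"
    and "(G has_derivative H) (at x)" "\<epsilon> > 0"
  shows "\<exists>\<delta>>0. \<forall>w. norm w < \<delta> \<longrightarrow> \<bar>f (x + w) - f x - G x \<bullet> w - (w \<bullet> H w) / 2\<bar> \<le> \<epsilon> * (norm w)\<^sup>2"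
proof -
  have lin: "linear H" using assms(4) by (rule has_derivative_linear)
  obtain d1 where d1: "d1 > 0" "ball x d1 \<subseteq> U" using assms(1,2) openE by blast
  obtain d2 where d2: "d2 > 0" "\<And>y. norm (y - x) < d2 \<Longrightarrow> norm (G y - G x - H (y - x)) \<le> \<epsilon> * norm (y - x)"
    using assms(4,5) unfolding has_derivative_at_alt by blast
  show ?thesis
  proof (intro exI[of _ "min d1 d2"] conjI allI impI)
    fix w :: 'a assume w: "norm w < min d1 d2"
    let ?\<phi> = "\<lambda>t. f (x + t *\<^sub>R w) - t * (G x \<bullet> w) - t\<^sup>2 * (w \<bullet> H w) / 2"
    let ?\<phi>' = "\<lambda>t. G (x + t *\<^sub>R w) \<bullet> w - G x \<bullet> w - t * (w \<bullet> H w)"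
    have small: "norm (t *\<^sub>R w) < min d1 d2" if "0 \<le> t" "t \<le> 1" for t
      using mult_left_le_one_le[of "norm w" t] that w by auto
    have d: "(?\<phi> has_real_derivative ?\<phi>' t) (at t)" if "0 \<le> t" "t \<le> 1" for t
    proof -
      have "x + t *\<^sub>R w \<in> U" using small[OF that] d1(2) by (auto simp: dist_norm)
      then have "((\<lambda>t. f (x + t *\<^sub>R w)) has_derivative (\<lambda>s. G (x + t *\<^sub>R w) \<bullet> (s *\<^sub>R w))) (at t)"
        by (intro has_derivative_compose[where f="\<lambda>t. x + t *\<^sub>R w" and g=f and x=t, OF _ assms(3)])
          (auto intro!: derivative_eq_intros)
      then have "((\<lambda>t. f (x + t *\<^sub>R w)) has_real_derivative G (x + t *\<^sub>R w) \<bullet> w) (at t)"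
        by (simp add: has_field_derivative_def mult_commute_abs)
      then show ?thesis by (auto intro!: derivative_eq_intros)
    qed
    obtain t where t: "0 < t" "t < 1" "?\<phi> 1 - ?\<phi> 0 = (1 - 0) * ?\<phi>' t"
      using MVT2[of 0 1 ?\<phi> ?\<phi>'] d by auto
    have "?\<phi>' t = (G (x + t *\<^sub>R w) - G x - H (t *\<^sub>R w)) \<bullet> w"
      by (simp add: inner_diff_left linear_cmul[OF lin] inner_commute[of "H w"])
    also have "\<bar>\<dots>\<bar> \<le> norm (G (x + t *\<^sub>R w) - G x - H (t *\<^sub>R w)) * norm w"
      by (rule Cauchy_Schwarz_ineq2)
    also have "\<dots> \<le> (\<epsilon> * norm (t *\<^sub>R w)) * norm w"
      using d2(2)[of "x + t *\<^sub>R w"] small[of t] t by (intro mult_right_mono) auto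
    also have "\<dots> \<le> (\<epsilon> * norm w) * norm w"
      using t assms(5) by (intro mult_right_mono mult_left_mono) (auto simp: mult_left_le_one_le)
    finally have "\<bar>?\<phi>' t\<bar> \<le> \<epsilon> * (norm w)\<^sup>2" by (simp add: power2_eq_square)
    then show "\<bar>f (x + w) - f x - G x \<bullet> w - (w \<bullet> H w) / 2\<bar> \<le> \<epsilon> * (norm w)\<^sup>2"
      using t(3) by simp
  qed (use d1 d2 in auto)
qed

text \<open>
  The second difference is symmetric in \<open>v\<close> and \<open>w\<close>, whereas its quotient by \<open>t\<^sup>2\<close> tends to
  \<open>v \<bullet> H w\<close>; this is how the symmetry of the Hessian comes about.
\<close>

lemma second_difference:
  fixes f :: "'a::euclidean_space \<Rightarrow> real"
  assumes "open U" "x \<in> U" "\<And>y. y \<in> U \<Longrightarrow> (f has_derivative (\<lambda>v. G y \<bullet> v)) (at y)"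
    and "(G has_derivative H) (at x)" "\<epsilon> > 0"
  shows "\<exists>\<delta>>0. \<forall>t. 0 < t \<and> t < \<delta> \<longrightarrow>
    \<bar>f (x + t *\<^sub>R v + t *\<^sub>R w) - f (x + t *\<^sub>R v) - f (x + t *\<^sub>R w) + f x - t\<^sup>2 * (v \<bullet> H w)\<bar> \<le> \<epsilon> * t\<^sup>2"
proof -
  define R where "R = norm v + norm w + 1"
  have R: "R > 0" "norm v \<le> R" "norm w \<le> R" "norm v + norm w \<le> R" by (auto simp: R_def add_nonneg_pos)
  have lin: "linear H" using assms(4) by (rule has_derivative_linear)
  obtain d1 where d1: "d1 > 0" "ball x d1 \<subseteq> U" using assms(1,2) openE by blast
  define e where "e = \<epsilon> / (2 * R\<^sup>2)"
  have e: "e > 0" using assms(5) R by (simp add: e_def)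
  obtain d2 where d2: "d2 > 0" "\<And>y. norm (y - x) < d2 \<Longrightarrow> norm (G y - G x - H (y - x)) \<le> e * norm (y - x)"
    using assms(4) e unfolding has_derivative_at_alt by blast
  define d where "d = min d1 d2"
  show ?thesis
  proof (intro exI[of _ "d / R"] conjI allI impI)
    fix t :: real assume t: "0 < t \<and> t < d / R"
    then have tR: "t * R < d" using R by (simp add: field_simps)
    let ?a = "\<lambda>s. (s * t) *\<^sub>R v" and ?b = "\<lambda>s. (s * t) *\<^sub>R v + t *\<^sub>R w"
    have ab: "norm (?a s) \<le> t * R" "norm (?b s) \<le> t * R" if "0 \<le> s" "s \<le> 1" for s
    proof -
      have st: "s * t \<le> t" using that t by (simp add: mult_left_le_one_le)
      have 1: "norm (?a s) \<le> t * norm v" using that t mult_right_mono[OF st, of "norm v"] by simp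
      also have "\<dots> \<le> t * R" using t R by (intro mult_left_mono) auto
      finally show "norm (?a s) \<le> t * R" .
      have "norm (?b s) \<le> norm (?a s) + norm (t *\<^sub>R w)" by (rule norm_triangle_ineq)
      also have "\<dots> \<le> t * norm v + t * norm w" using 1 t by simp
      also have "\<dots> \<le> t * R" using t R(4) by (simp add: distrib_left[symmetric])
      finally show "norm (?b s) \<le> t * R" .
    qed
    let ?\<phi> = "\<lambda>s. f (x + ?b s) - f (x + ?a s)"
    let ?\<phi>' = "\<lambda>s. t * ((G (x + ?b s) - G (x + ?a s)) \<bullet> v)"
    have d: "(?\<phi> has_real_derivative ?\<phi>' s) (at s)" if "0 \<le> s" "s \<le> 1" for s
    proof -
      have "x + z \<in> U" if "norm z < d" for z
        using that by (intro subsetD[OF d1(2)]) (simp add: dist_norm d_def)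
      then have U: "x + ?b s \<in> U" "x + ?a s \<in> U"
        using ab[OF that] tR by (meson le_less_trans)+
      have "((\<lambda>s. f (x + ?b s)) has_derivative (\<lambda>h. G (x + ?b s) \<bullet> ((h * t) *\<^sub>R v))) (at s)"
        using U(1) by (intro has_derivative_compose[where f="\<lambda>s. x + (?b s)" and g=f and x=s, OF _ assms(3)])
          (auto intro!: derivative_eq_intros)
      moreover have "((\<lambda>s. f (x + ?a s)) has_derivative (\<lambda>h. G (x + ?a s) \<bullet> ((h * t) *\<^sub>R v))) (at s)"
        using U(2) by (intro has_derivative_compose[where f="\<lambda>s. x + (?a s)" and g=f and x=s, OF _ assms(3)])
          (auto intro!: derivative_eq_intros)
      ultimately have "(?\<phi> has_derivative (\<lambda>h. G (x + ?b s) \<bullet> ((h * t) *\<^sub>R v) - G (x + ?a s) \<bullet> ((h * t) *\<^sub>R v))) (at s)"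
        by (rule has_derivative_diff)
      moreover have "(\<lambda>h. G (x + ?b s) \<bullet> ((h * t) *\<^sub>R v) - G (x + ?a s) \<bullet> ((h * t) *\<^sub>R v)) = (*) (?\<phi>' s)"
        by (auto simp: algebra_simps inner_diff_left)
      ultimately show ?thesis by (simp only: has_field_derivative_def)
    qed
    obtain s where s: "0 < s" "s < 1" "?\<phi> 1 - ?\<phi> 0 = (1 - 0) * ?\<phi>' s"
      using MVT2[of 0 1 ?\<phi> ?\<phi>'] d by auto
    define p where "p = G (x + ?b s) - G x - H (?b s)"
    define q where "q = G (x + ?a s) - G x - H (?a s)"
    have pq: "norm p \<le> e * (t * R)" "norm q \<le> e * (t * R)"
    proof -
      have "norm p \<le> e * norm (?b s)" unfolding p_def
        using d2(2)[of "x + ?b s"] ab(2)[of s] s tR by (auto simp: d_def)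
      also have "\<dots> \<le> e * (t * R)" using ab(2)[of s] s e by (intro mult_left_mono) auto
      finally show "norm p \<le> e * (t * R)" .
      have "norm q \<le> e * norm (?a s)" unfolding q_def
        using d2(2)[of "x + ?a s"] ab(1)[of s] s tR by (auto simp: d_def)
      also have "\<dots> \<le> e * (t * R)" using ab(1)[of s] s e by (intro mult_left_mono) auto
      finally show "norm q \<le> e * (t * R)" .
    qed
    have "H (?b s) = H (?a s) + t *\<^sub>R H w"
      by (simp add: linear_add[OF lin] linear_cmul[OF lin])
    then have "?\<phi>' s - t\<^sup>2 * (v \<bullet> H w) = t * ((p - q) \<bullet> v)"
      by (simp add: p_def q_def algebra_simps power2_eq_square inner_commute)
    also have "\<bar>\<dots>\<bar> = t * \<bar>(p - q) \<bullet> v\<bar>" using t by (simp add: abs_mult)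
    also have "\<dots> \<le> t * (norm (p - q) * norm v)"
      using t by (intro mult_left_mono Cauchy_Schwarz_ineq2) auto
    also have "\<dots> \<le> t * ((2 * (e * (t * R))) * R)"
    proof (intro mult_left_mono mult_mono)
      show "norm (p - q) \<le> 2 * (e * (t * R))" using norm_triangle_ineq4[of p q] pq by linarith
    qed (use t R e in auto)
    also have "\<dots> = \<epsilon> * t\<^sup>2" using R by (simp add: e_def power2_eq_square)
    finally have "\<bar>?\<phi>' s - t\<^sup>2 * (v \<bullet> H w)\<bar> \<le> \<epsilon> * t\<^sup>2" .
    then show "\<bar>f (x + t *\<^sub>R v + t *\<^sub>R w) - f (x + t *\<^sub>R v) - f (x + t *\<^sub>R w) + f x - t\<^sup>2 * (v \<bullet> H w)\<bar> \<le> \<epsilon> * t\<^sup>2"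
      using s(3) by (simp add: add.assoc)
  qed (use d1 d2 R in \<open>auto simp: d_def\<close>)
qed

lemma hessian_symmetric:
  fixes f :: "'a::euclidean_space \<Rightarrow> real"
  assumes "open U" "x \<in> U" "\<And>y. y \<in> U \<Longrightarrow> (f has_derivative (\<lambda>v. G y \<bullet> v)) (at y)"
    and "(G has_derivative H) (at x)"
  shows "v \<bullet> H w = w \<bullet> H v"
proof -
  have "\<bar>v \<bullet> H w - w \<bullet> H v\<bar> \<le> e" if "e > 0" for e
  proof -
    have e: "e/2 > 0" using that by simp
    obtain d1 where d1: "d1 > 0" "\<And>t. 0 < t \<and> t < d1 \<Longrightarrow>
       \<bar>f (x + t *\<^sub>R v + t *\<^sub>R w) - f (x + t *\<^sub>R v) - f (x + t *\<^sub>R w) + f x - t\<^sup>2 * (v \<bullet> H w)\<bar> \<le> e/2 * t\<^sup>2"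
      using second_difference[OF assms e, of v w] by auto
    obtain d2 where d2: "d2 > 0" "\<And>t. 0 < t \<and> t < d2 \<Longrightarrow>
       \<bar>f (x + t *\<^sub>R w + t *\<^sub>R v) - f (x + t *\<^sub>R w) - f (x + t *\<^sub>R v) + f x - t\<^sup>2 * (w \<bullet> H v)\<bar> \<le> e/2 * t\<^sup>2"
      using second_difference[OF assms e, of w v] by auto
    define t where "t = min d1 d2 / 2"
    have t: "0 < t" "t < d1" "t < d2" using d1(1) d2(1) by (auto simp: t_def min_def)
    have c: "x + t *\<^sub>R w + t *\<^sub>R v = x + t *\<^sub>R v + t *\<^sub>R w" by simp
    have "\<bar>t\<^sup>2 * (v \<bullet> H w) - t\<^sup>2 * (w \<bullet> H v)\<bar> \<le> e * t\<^sup>2"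
      using d1(2)[of t] d2(2)[of t] t unfolding c by linarith
    then have "t\<^sup>2 * \<bar>v \<bullet> H w - w \<bullet> H v\<bar> \<le> t\<^sup>2 * e"
      by (simp only: right_diff_distrib[symmetric] abs_mult abs_of_nonneg[OF zero_le_power2] mult.commute[of e])
    then show ?thesis using t by simp
  qed
  then have "\<bar>v \<bullet> H w - w \<bullet> H v\<bar> \<le> 0" by (rule field_le_epsilon) simp
  then show ?thesis by simp
qed

lemma linear_coeff_zero:
  fixes b c :: real
  assumes "\<And>t. 0 \<le> b * t + c * t\<^sup>2"
  shows "b = 0"
proof (rule ccontr)
  assume b: "b \<noteq> 0"
  define t where "t = - b / (2 * (\<bar>c\<bar> + 1))"
  have "b * t + c * t\<^sup>2 \<le> b * t + (\<bar>c\<bar> + 1) * t\<^sup>2" by (intro add_left_mono mult_right_mono) auto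
  also have "\<dots> = - b\<^sup>2 / (4 * (\<bar>c\<bar> + 1))"
    unfolding t_def by (simp add: field_simps power2_eq_square add_nonneg_eq_0_iff)
  also have "\<dots> < 0" using b by (simp add: divide_neg_pos add_nonneg_pos)
  finally show False using assms[of t] by linarith
qed

text \<open>
  The minimiser of the quadratic form on the unit sphere of the hyperplane orthogonal to \<open>g\<close> is
  an eigenvector of the form restricted to that hyperplane, by the vanishing of the first
  variation. The first case is that of a hyperplane reduced to 0.
\<close>

lemma constrained_eigenvector:
  fixes H :: "'a::euclidean_space \<Rightarrow> 'a"
  assumes lin: "linear H" and sym: "\<And>v w. v \<bullet> H w = w \<bullet> H v" and g: "g \<noteq> 0"
  obtains (trivial) "\<And>v. v \<bullet> g = 0 \<Longrightarrow> v = 0"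
  | (vec) v \<mu> \<alpha> where "v \<noteq> 0" "v \<bullet> g = 0" "H v = \<mu> *\<^sub>R v + \<alpha> *\<^sub>R g"
      "\<And>w. w \<bullet> g = 0 \<Longrightarrow> \<mu> * (norm w)\<^sup>2 \<le> w \<bullet> H w"
proof (cases "\<forall>v. v \<bullet> g = 0 \<longrightarrow> v = 0")
  case True
  then show ?thesis using trivial by blast
next
  case False
  then obtain u where u: "u \<bullet> g = 0" "u \<noteq> 0" by blast
  let ?K = "sphere 0 1 \<inter> {v. v \<bullet> g = 0}"
  have "closed {v. v \<bullet> g = 0}"
    by (intro closed_Collect_eq continuous_intros)
  then have "compact ?K" by (intro compact_Int_closed) auto
  moreover have "u /\<^sub>R norm u \<in> ?K" using u by simp
  then have "?K \<noteq> {}" by blast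
  moreover have "continuous_on ?K (\<lambda>v. v \<bullet> H v)"
    using linear_continuous_on[OF linear_conv_bounded_linear[THEN iffD1, OF lin]] by (intro continuous_intros)
  ultimately obtain v where v: "v \<in> ?K" and min: "\<And>w. w \<in> ?K \<Longrightarrow> v \<bullet> H v \<le> w \<bullet> H w"
    using continuous_attains_inf[of ?K "\<lambda>v. v \<bullet> H v"] by blast
  define \<mu> where "\<mu> = v \<bullet> H v"
  have vv: "v \<bullet> v = 1" "v \<bullet> g = 0" "v \<noteq> 0" using v by (auto simp: dot_square_norm)
  have low: "\<mu> * (norm w)\<^sup>2 \<le> w \<bullet> H w" if "w \<bullet> g = 0" for w
  proof (cases "w = 0")
    case False
    then have "w /\<^sub>R norm w \<in> ?K" using that by simp
    from min[OF this] have "\<mu> \<le> (w \<bullet> H w) / (norm w)\<^sup>2"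
      by (simp add: \<mu>_def linear_cmul[OF lin] power2_eq_square divide_inverse mult_ac)
    then show ?thesis using False by (simp add: field_simps)
  qed (simp add: linear_0[OF lin])
  \<comment> \<open>the nonnegative quadratic polynomial in \<open>t\<close> vanishes at \<open>t = 0\<close>, so its linear coefficient is zero\<close>
  have orth: "w \<bullet> (H v - \<mu> *\<^sub>R v) = 0" if w: "w \<bullet> g = 0" for w
  proof -
    have "0 \<le> (2 * (w \<bullet> (H v - \<mu> *\<^sub>R v))) * t + (w \<bullet> H w - \<mu> * (w \<bullet> w)) * t\<^sup>2" for t
    proof -
      have "(v + t *\<^sub>R w) \<bullet> g = 0" using w vv by (simp add: inner_add_left)
      from low[OF this]
      have "0 \<le> (v + t *\<^sub>R w) \<bullet> H (v + t *\<^sub>R w) - \<mu> * ((v + t *\<^sub>R w) \<bullet> (v + t *\<^sub>R w))"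
        by (simp add: dot_square_norm)
      also have "\<dots> = (v \<bullet> H v - \<mu> * (v \<bullet> v)) + (2 * (w \<bullet> (H v - \<mu> *\<^sub>R v))) * t + (w \<bullet> H w - \<mu> * (w \<bullet> w)) * t\<^sup>2"
        using sym[of v w] by (simp add: linear_add[OF lin] linear_cmul[OF lin] inner_add_left inner_add_right inner_diff_right
            algebra_simps power2_eq_square inner_commute[of v w])
      finally show ?thesis using vv by (simp add: \<mu>_def)
    qed
    from linear_coeff_zero[OF this] show ?thesis by simp
  qed
  define z where "z = H v - \<mu> *\<^sub>R v"
  define \<alpha> where "\<alpha> = (z \<bullet> g) / (g \<bullet> g)"
  have zg: "(z - \<alpha> *\<^sub>R g) \<bullet> g = 0" using g by (simp add: \<alpha>_def inner_diff_left)
  have "(z - \<alpha> *\<^sub>R g) \<bullet> z = 0" using orth[OF zg] by (simp add: z_def)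
  then have "(z - \<alpha> *\<^sub>R g) \<bullet> (z - \<alpha> *\<^sub>R g) = 0" using zg by (simp add: inner_diff_right)
  then have "z = \<alpha> *\<^sub>R g" unfolding inner_eq_zero_iff by simp
  then have "H v = \<mu> *\<^sub>R v + \<alpha> *\<^sub>R g" by (simp add: z_def algebra_simps)
  then show ?thesis using vec[OF vv(3,2) _ low] by blast
qed

text \<open>
  An eigenvector of the tangential part of the Hessian of a defining function is a principal
  direction. The normal component \<open>\<alpha>\<close> is removed by the normalisation of the gradient, and the
  eigenvalue is divided by the length of the gradient.
\<close>

lemma unit_normal_derivative:
  fixes G :: "'a::euclidean_space \<Rightarrow> 'a"
  assumes G: "(G has_derivative H) (at x)" and g: "G x \<noteq> 0"
    and v: "v \<bullet> G x = 0" "H v = \<mu> *\<^sub>R v + \<alpha> *\<^sub>R G x"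
  shows "frechet_derivative (\<lambda>y. G y /\<^sub>R norm (G y)) (at x) v = (\<mu> / norm (G x)) *\<^sub>R v"
proof -
  let ?g = "norm (G x)"
  have n: "((\<lambda>y. norm (G y)) has_derivative (\<lambda>w. H w \<bullet> sgn (G x))) (at x)"
    using has_derivative_compose[OF G has_derivative_norm[OF g]] .
  have i: "((\<lambda>y. inverse (norm (G y))) has_derivative (\<lambda>w. - (inverse ?g * (H w \<bullet> sgn (G x)) * inverse ?g))) (at x)"
    using g by (intro Deriv.has_derivative_inverse n) auto
  have "((\<lambda>y. inverse (norm (G y)) *\<^sub>R G y) has_derivative
     (\<lambda>w. inverse ?g *\<^sub>R H w + (- (inverse ?g * (H w \<bullet> sgn (G x)) * inverse ?g)) *\<^sub>R G x)) (at x)"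
    by (rule has_derivative_scaleR[OF i G])
  then have "frechet_derivative (\<lambda>y. inverse (norm (G y)) *\<^sub>R G y) (at x) v
    = inverse ?g *\<^sub>R H v + (- (inverse ?g * (H v \<bullet> sgn (G x)) * inverse ?g)) *\<^sub>R G x"
    by (simp add: frechet_derivative_eq)
  moreover have "H v \<bullet> sgn (G x) = \<alpha> * ?g"
    using v g by (simp add: sgn_div_norm inner_add_left dot_square_norm power2_eq_square)
  ultimately show ?thesis
    using g by (simp add: v(2) scaleR_add_right divide_inverse mult_ac)
qed

lemma gradient_eqI:
  assumes "(f has_derivative (\<lambda>v. g \<bullet> v)) (at x)"
  shows "gradient f x = g"
  using frechet_derivative_eq[OF assms] by (simp add: gradient_def partial_deriv_def inner_axis vec_eq_iff)

lemma has_derivative_gradient: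
  assumes "f differentiable at x"
  shows "(f has_derivative (\<lambda>v. gradient f x \<bullet> v)) (at x)"
proof -
  let ?D = "frechet_derivative f (at x)"
  have D: "(f has_derivative ?D) (at x)" using assms by (simp add: frechet_derivative_works)
  then have lin: "linear ?D" by (rule has_derivative_linear)
  have "?D v = gradient f x \<bullet> v" for v
  proof -
    have "?D v = ?D (\<Sum>i\<in>UNIV. v $ i *s axis i 1)" by (simp add: basis_expansion)
    also have "\<dots> = (\<Sum>i\<in>UNIV. v $ i * ?D (axis i 1))"
      by (simp add: linear_sum[OF lin] linear_cmul[OF lin] scalar_mult_eq_scaleR)
    also have "\<dots> = gradient f x \<bullet> v"
      by (simp add: inner_vec_def gradient_def partial_deriv_def mult.commute)
    finally show ?thesis .
  qed
  then have "?D = (\<lambda>v. gradient f x \<bullet> v)" by blast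
  then show ?thesis using D by simp
qed

lemma vec_lambda_differentiable:
  fixes F :: "'n::finite \<Rightarrow> 'a::real_normed_vector \<Rightarrow> real"
  assumes "\<And>i. F i differentiable at x"
  shows "(\<lambda>y. \<chi> i. F i y) differentiable at x"
proof -
  have "(\<lambda>y. \<chi> i. F i y) = (\<lambda>y. \<Sum>i\<in>UNIV. F i y *\<^sub>R axis i 1)"
    by (auto simp: vec_eq_iff axis_def if_distrib cong: if_cong)
  then show ?thesis using assms by (auto intro!: derivative_intros)
qed

lemma C2_gradient:
  fixes \<rho> :: "real^'n::finite \<Rightarrow> real"
  assumes "Ck_on 2 U \<rho>" "y \<in> U"
  shows "(\<rho> has_derivative (\<lambda>v. gradient \<rho> y \<bullet> v)) (at y)" "gradient \<rho> differentiable at y"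
proof -
  have C: "Ck_on (Suc (Suc 0)) U \<rho>" using assms(1) by (simp add: numeral_2_eq_2)
  then show "(\<rho> has_derivative (\<lambda>v. gradient \<rho> y \<bullet> v)) (at y)"
    using assms(2) by (intro has_derivative_gradient) simp
  have "partial_deriv i \<rho> differentiable at y" for i
    using C assms(2) unfolding partial_deriv_def[abs_def] by simp
  then show "gradient \<rho> differentiable at y"
    unfolding gradient_def[abs_def] by (rule vec_lambda_differentiable)
qed

text \<open>
  The smallest eigenvalue of the tangential Hessian of a defining function is a principal
  curvature times the length of the gradient, hence positive. The second order expansion of the
  defining function then confines the domain, near a boundary point, to a paraboloid with axis along
  the inner normal \<open>n\<close>.
\<close>

lemma strongly_convex_paraboloid:
  fixes \<Phi> :: "(real^'n::finite) set"
  assumes sc: "strongly_convex_domain \<Phi>" and x: "x \<in> frontier \<Phi>"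
  obtains n c r where "norm n = 1" "c > 0" "r > 0"
    "\<And>y. y \<in> \<Phi> \<Longrightarrow> norm (y - x) < r \<Longrightarrow> c * (norm (y - x))\<^sup>2 \<le> n \<bullet> (y - x)"
proof -
  have "open \<Phi>" using sc by (simp add: strongly_convex_domain_def is_domain_def)
  then have xn: "x \<notin> \<Phi>" using x by (simp add: frontier_def interior_open)
  obtain U \<rho> where UR: "C2_defining_function \<Phi> x U \<rho>"
    using sc x unfolding strongly_convex_domain_def has_C2_boundary_def by blast
  then have U: "open U" "x \<in> U" and C2: "Ck_on 2 U \<rho>" and g0: "gradient \<rho> x \<noteq> 0"
    and PhiU: "\<Phi> \<inter> U = {y \<in> U. \<rho> y < 0}"
    by (auto simp: C2_defining_function_def)
  define G where "G = gradient \<rho>"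
  define g where "g = G x"
  have gn: "g \<noteq> 0" "norm g > 0" using g0 by (auto simp: g_def G_def)
  have G: "(\<rho> has_derivative (\<lambda>v. G y \<bullet> v)) (at y)" if "y \<in> U" for y
    using C2_gradient(1)[OF C2 that] by (simp add: G_def)
  define H where "H = frechet_derivative G (at x)"
  have H: "(G has_derivative H) (at x)"
    using C2_gradient(2)[OF C2 U(2)] by (simp add: G_def H_def frechet_derivative_works)
  then have lin: "linear H" by (rule has_derivative_linear)
  have sym: "v \<bullet> H w = w \<bullet> H v" for v w
    by (rule hessian_symmetric[OF U G H])
  have "\<exists>\<mu>>0. \<forall>w. w \<bullet> g = 0 \<longrightarrow> \<mu> * (norm w)\<^sup>2 \<le> w \<bullet> H w"
  proof (rule constrained_eigenvector[OF lin sym gn(1)])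
    assume "\<And>v. v \<bullet> g = 0 \<Longrightarrow> v = 0"
    then show ?thesis using linear_0[OF lin] by (intro exI[of _ 1]) force
  next
    fix v \<mu> \<alpha>
    assume v: "v \<noteq> 0" "v \<bullet> g = 0" "H v = \<mu> *\<^sub>R v + \<alpha> *\<^sub>R g"
      and low: "\<And>w. w \<bullet> g = 0 \<Longrightarrow> \<mu> * (norm w)\<^sup>2 \<le> w \<bullet> H w"
    have "frechet_derivative (\<lambda>y. G y /\<^sub>R norm (G y)) (at x) v = (\<mu> / norm g) *\<^sub>R v"
      using unit_normal_derivative[OF H _ v(2)[unfolded g_def] v(3)[unfolded g_def]] gn(1) by (simp add: g_def)
    then have "principal_curvature \<Phi> x (\<mu> / norm g)"
      unfolding principal_curvature_def
      using UR v(1,2) by (intro exI[of _ U] exI[of _ \<rho>] exI[of _ v]) (simp add: G_def g_def)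
    then have "\<mu> / norm g \<in> principal_curvatures \<Phi>" using x by (auto simp: principal_curvatures_def)
    then have "Inf (principal_curvatures \<Phi>) \<le> \<mu> / norm g"
      using sc by (intro cInf_lower) (auto simp: strongly_convex_domain_def)
    then have "\<mu> / norm g > 0" using sc by (simp add: strongly_convex_domain_def)
    then have "\<mu> > 0" using gn by (simp add: zero_less_divide_iff)
    then show ?thesis using low by blast
  qed
  then obtain \<mu> where mu: "\<mu> > 0" and low: "\<And>w. w \<bullet> g = 0 \<Longrightarrow> \<mu> * (norm w)\<^sup>2 \<le> w \<bullet> H w" by blast
  obtain K where K: "K > 0" "\<And>w. norm (H w) \<le> norm w * K"
    using bounded_linear.pos_bounded[OF linear_conv_bounded_linear[THEN iffD1, OF lin]] by blast
  define n where "n = - (g /\<^sub>R norm g)"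
  have n: "norm n = 1" using gn by (simp add: n_def)
  define C where "C = (\<mu> + 3 * K) / 2"
  have C: "C > 0" using mu K by (simp add: C_def)
  obtain d1 where d1: "d1 > 0" "\<And>w. norm w < d1 \<Longrightarrow> \<bar>\<rho> (x + w) - \<rho> x - G x \<bullet> w - (w \<bullet> H w) / 2\<bar> \<le> \<mu>/4 * (norm w)\<^sup>2"
    using second_order_expansion[OF U G H, of "\<mu>/4"] mu by auto
  obtain d2 where d2: "d2 > 0" "ball x d2 \<subseteq> U" using U openE by blast
  \<comment> \<open>beyond the third bound the mixed term \<open>C |s| |w|\<close> would compete with the linear term \<open>norm g * s\<close>\<close>
  define r where "r = Min {d1, d2, norm g / (2 * C)}"
  have r: "r > 0" "r \<le> d1" "r \<le> d2" "r \<le> norm g / (2 * C)" using d1 d2 C gn by (auto simp: r_def)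
  show ?thesis
  proof (rule that[OF n, of "\<mu> / (6 * norm g)" r])
    show "\<mu> / (6 * norm g) > 0" using mu gn by simp
    fix y assume y: "y \<in> \<Phi>" "norm (y - x) < r"
    define w where "w = y - x"
    define s where "s = n \<bullet> w"
    define \<tau> where "\<tau> = w - s *\<^sub>R n"
    have yU: "y \<in> U" using y(2) r(3) d2(2) by (auto simp: dist_norm norm_minus_commute)
    then have "\<rho> y < 0" using y(1) PhiU by auto
    \<comment> \<open>the point \<open>x\<close> is not in the open set \<open>\<Phi>\<close>\<close>
    moreover have "\<rho> x \<ge> 0" using xn U(2) PhiU by force
    ultimately have "G x \<bullet> w + (w \<bullet> H w) / 2 \<le> \<mu>/4 * (norm w)\<^sup>2"
    proof -
      have "\<bar>\<rho> y - \<rho> x - G x \<bullet> w - (w \<bullet> H w) / 2\<bar> \<le> \<mu>/4 * (norm w)\<^sup>2"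
        using d1(2)[of w] y(2) r(2) by (simp add: w_def)
      then show ?thesis using \<open>\<rho> y < 0\<close> \<open>\<rho> x \<ge> 0\<close> by linarith
    qed
    moreover have "G x \<bullet> w = - norm g * s"
      using gn by (simp add: s_def n_def g_def)
    ultimately have 1: "(w \<bullet> H w) / 2 \<le> norm g * s + \<mu>/4 * (norm w)\<^sup>2" by simp
    have sw: "\<bar>s\<bar> \<le> norm w" unfolding s_def using Cauchy_Schwarz_ineq2[of n w] n by simp
    have nn: "n \<bullet> n = 1" using n by (simp add: dot_square_norm)
    have tn: "\<tau> \<bullet> n = 0" by (simp add: \<tau>_def s_def inner_diff_left nn inner_commute[of n w])
    have "g = - norm g *\<^sub>R n" using gn by (simp add: n_def)
    then have tg: "\<tau> \<bullet> g = 0" using tn by (metis inner_scaleR_right mult_zero_right)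
    have ww: "(norm w)\<^sup>2 = (norm \<tau>)\<^sup>2 + s\<^sup>2"
    proof -
      have "w = \<tau> + s *\<^sub>R n" by (simp add: \<tau>_def)
      then have "w \<bullet> w = \<tau> \<bullet> \<tau> + s\<^sup>2"
        using tn nn by (simp add: inner_add_left inner_add_right inner_commute[of n \<tau>] power2_eq_square)
      then show ?thesis by (simp add: dot_square_norm)
    qed
    have tw: "norm \<tau> \<le> norm w" by (rule power2_le_imp_le) (use ww in auto)
    have Hw: "w \<bullet> H w = \<tau> \<bullet> H \<tau> + 2 * s * (\<tau> \<bullet> H n) + s\<^sup>2 * (n \<bullet> H n)"
    proof -
      have "w = \<tau> + s *\<^sub>R n" by (simp add: \<tau>_def)
      then show ?thesis
        using sym[of n \<tau>] by (simp add: linear_add[OF lin] linear_cmul[OF lin] inner_add_left inner_add_right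
          algebra_simps power2_eq_square)
    qed
    have Hn: "norm (H n) \<le> K" using K(2)[of n] n by simp
    have a: "\<bar>\<tau> \<bullet> H n\<bar> \<le> norm w * K"
      using Cauchy_Schwarz_ineq2[of \<tau> "H n"] mult_mono[OF tw Hn] by force
    have b: "\<bar>n \<bullet> H n\<bar> \<le> K" using Cauchy_Schwarz_ineq2[of n "H n"] n Hn by simp
    have m1: "\<bar>2 * s * (\<tau> \<bullet> H n)\<bar> \<le> 2 * \<bar>s\<bar> * (norm w * K)"
      unfolding abs_mult using a by (intro mult_mono) auto
    have m2: "\<bar>s\<^sup>2 * (n \<bullet> H n)\<bar> \<le> \<bar>s\<bar> * norm w * K"
      unfolding abs_mult power2_eq_square using b sw by (intro mult_mono) auto
    have n1: "- (2 * ((\<bar>s\<bar> * norm w) * K)) \<le> 2 * s * (\<tau> \<bullet> H n)"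
    proof -
      have "2 * \<bar>s\<bar> * (norm w * K) = 2 * ((\<bar>s\<bar> * norm w) * K)" by simp
      then show ?thesis using abs_le_D2[OF m1] by (simp only: minus_le_iff)
    qed
    have n2: "- ((\<bar>s\<bar> * norm w) * K) \<le> s\<^sup>2 * (n \<bullet> H n)"
      using abs_le_D2[OF m2] by (simp only: minus_le_iff)
    have n3: "\<mu> * s\<^sup>2 \<le> \<mu> * (\<bar>s\<bar> * norm w)"
    proof -
      have "s\<^sup>2 = \<bar>s\<bar> * \<bar>s\<bar>" by (simp add: power2_eq_square)
      also have "\<dots> \<le> \<bar>s\<bar> * norm w" using sw by (rule mult_left_mono) simp
      finally show ?thesis using mu by (simp add: mult_left_mono)
    qed
    have n4: "\<mu> * (norm w)\<^sup>2 - \<mu> * s\<^sup>2 \<le> \<tau> \<bullet> H \<tau>"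
      using low[OF tg] ww by (simp add: algebra_simps)
    have n5: "2 * C * (\<bar>s\<bar> * norm w) = \<mu> * (\<bar>s\<bar> * norm w) + 3 * ((\<bar>s\<bar> * norm w) * K)"
      by (simp add: C_def algebra_simps)
    have "\<mu> * (norm w)\<^sup>2 - 2 * C * (\<bar>s\<bar> * norm w) \<le> w \<bullet> H w"
      using n1 n2 n3 n4 n5 unfolding Hw by argo
    moreover have "\<mu>/4 * (norm w)\<^sup>2 = \<mu> * (norm w)\<^sup>2 / 4" "\<bar>s\<bar> * (C * norm w) = C * (\<bar>s\<bar> * norm w)"
      by simp_all
    ultimately have 2: "\<mu>/4 * (norm w)\<^sup>2 \<le> norm g * s + \<bar>s\<bar> * (C * norm w)"
      using 1 by linarith
    have "C * norm w \<le> norm g / 2"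
    proof -
      have "norm w \<le> norm g / (2 * C)" using y(2) r(4) by (simp add: w_def)
      then show ?thesis using C by (simp add: field_simps)
    qed
    then have "\<bar>s\<bar> * (C * norm w) \<le> \<bar>s\<bar> * (norm g / 2)" by (intro mult_left_mono) auto
    then have 3: "\<mu>/4 * (norm w)\<^sup>2 \<le> norm g * s + \<bar>s\<bar> * (norm g / 2)" using 2 by simp
    \<comment> \<open>for \<open>s < 0\<close> the right-hand side of 3 would be negative\<close>
    have "s \<ge> 0"
    proof (rule ccontr)
      assume "\<not> s \<ge> 0"
      then have "norm g * s + \<bar>s\<bar> * (norm g / 2) < 0" using gn by (simp add: mult_neg_pos not_le)
      moreover have "0 \<le> \<mu>/4 * (norm w)\<^sup>2" using mu by simp
      ultimately show False using 3 by linarith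
    qed
    then have "\<mu> * (norm w)\<^sup>2 \<le> 6 * norm g * s" using 3 by (simp add: mult_ac)
    then show "\<mu> / (6 * norm g) * (norm (y - x))\<^sup>2 \<le> n \<bullet> (y - x)"
      using gn by (simp add: w_def[symmetric] s_def[symmetric] field_simps)
  qed (use r in auto)
qed

section \<open>Gradients and Hessians at a point\<close>

text \<open>
  A relation instead of two functions of \<open>f\<close>: the rules below then produce the gradient and the
  Hessian of a composite function together, the latter as a linear map.
\<close>

definition jet2 :: "('a::euclidean_space \<Rightarrow> real) \<Rightarrow> 'a \<Rightarrow> 'a \<Rightarrow> ('a \<Rightarrow> 'a) \<Rightarrow> bool" where
  "jet2 f x g H \<longleftrightarrow> (\<exists>U G. open U \<and> x \<in> U \<and> (\<forall>y\<in>U. (f has_derivative (\<lambda>v. G y \<bullet> v)) (at y)) \<and>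
     (G has_derivative H) (at x) \<and> G x = g)"

lemma jet2I:
  assumes "open U" "x \<in> U" "\<And>y. y \<in> U \<Longrightarrow> (f has_derivative (\<lambda>v. G y \<bullet> v)) (at y)"
    "(G has_derivative H) (at x)" "G x = g"
  shows "jet2 f x g H"
  using assms unfolding jet2_def by blast

lemma jet2E:
  assumes "jet2 f x g H"
  obtains U G where "open U" "x \<in> U" "\<And>y. y \<in> U \<Longrightarrow> (f has_derivative (\<lambda>v. G y \<bullet> v)) (at y)"
    "(G has_derivative H) (at x)" "G x = g"
  using assms unfolding jet2_def by blast

lemma jet2_cong:
  assumes "open S" "x \<in> S" "\<And>y. y \<in> S \<Longrightarrow> f y = f' y" "jet2 f x g H"
  shows "jet2 f' x g H"
proof -
  obtain U G where 1: "open U" "x \<in> U" "\<And>y. y \<in> U \<Longrightarrow> (f has_derivative (\<lambda>v. G y \<bullet> v)) (at y)"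
    "(G has_derivative H) (at x)" "G x = g" by (rule jet2E[OF assms(4)]) (rule that)
  show ?thesis
  proof (rule jet2I[of "U \<inter> S"])
    show "(f' has_derivative (\<lambda>v. G y \<bullet> v)) (at y)" if "y \<in> U \<inter> S" for y
      using has_derivative_transform_within_open[OF 1(3) assms(1)] assms(3) that by blast
  qed (use 1 assms(1,2) in auto)
qed

lemma jet2_add:
  assumes "jet2 f x g H" "jet2 f' x g' H'"
  shows "jet2 (\<lambda>y. f y + f' y) x (g + g') (\<lambda>v. H v + H' v)"
proof -
  obtain U G where 1: "open U" "x \<in> U" "\<And>y. y \<in> U \<Longrightarrow> (f has_derivative (\<lambda>v. G y \<bullet> v)) (at y)"
    "(G has_derivative H) (at x)" "G x = g" by (rule jet2E[OF assms(1)]) (rule that)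
  obtain U' G' where 2: "open U'" "x \<in> U'" "\<And>y. y \<in> U' \<Longrightarrow> (f' has_derivative (\<lambda>v. G' y \<bullet> v)) (at y)"
    "(G' has_derivative H') (at x)" "G' x = g'" by (rule jet2E[OF assms(2)]) (rule that)
  show ?thesis
  proof (rule jet2I[of "U \<inter> U'" _ _ "\<lambda>y. G y + G' y"])
    show "((\<lambda>y. f y + f' y) has_derivative (\<lambda>v. (G y + G' y) \<bullet> v)) (at y)" if "y \<in> U \<inter> U'" for y
      using has_derivative_add[OF 1(3)[of y] 2(3)[of y]] that by (simp add: inner_add_left)
  qed (use 1 2 in \<open>auto intro: has_derivative_add\<close>)
qed

text \<open>
  The Hessian of \<open>\<phi> \<circ> f\<close> is \<open>\<phi>'(f) D\<^sup>2f + \<phi>''(f) \<nabla>f \<otimes> \<nabla>f\<close>. Everything below is built from affine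
  functions and one quotient by means of this rule, so that Hessians always appear as explicit sums
  of rank one maps.
\<close>

lemma jet2_compose:
  fixes \<phi> \<phi>' :: "real \<Rightarrow> real"
  assumes "jet2 f x g H" "open T" "f x \<in> T"
    and d1: "\<And>t. t \<in> T \<Longrightarrow> (\<phi> has_real_derivative \<phi>' t) (at t)"
    and d2: "(\<phi>' has_real_derivative c) (at (f x))"
  shows "jet2 (\<lambda>y. \<phi> (f y)) x (\<phi>' (f x) *\<^sub>R g) (\<lambda>v. \<phi>' (f x) *\<^sub>R H v + (c * (g \<bullet> v)) *\<^sub>R g)"
proof -
  obtain U G where 1: "open U" "x \<in> U" "\<And>y. y \<in> U \<Longrightarrow> (f has_derivative (\<lambda>v. G y \<bullet> v)) (at y)"
    "(G has_derivative H) (at x)" "G x = g" by (rule jet2E[OF assms(1)]) (rule that)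
  have "continuous_on U f"
    by (rule continuous_at_imp_continuous_on) (use 1(3) has_derivative_continuous in blast)
  then have "open (U \<inter> f -` T)" using 1(1) assms(2) by (simp add: continuous_on_open_vimage Int_commute)
  then show ?thesis
  proof (rule jet2I[where G="\<lambda>y. \<phi>' (f y) *\<^sub>R G y"])
    fix y assume y: "y \<in> U \<inter> f -` T"
    have "((\<lambda>y. \<phi> (f y)) has_derivative (\<lambda>v. \<phi>' (f y) * (G y \<bullet> v))) (at y)"
      by (rule has_derivative_compose[where f=f and g=\<phi> and x=y, OF 1(3)])
        (use y d1[of "f y"] in \<open>auto simp: has_field_derivative_def\<close>)
    then show "((\<lambda>y. \<phi> (f y)) has_derivative (\<lambda>v. (\<phi>' (f y) *\<^sub>R G y) \<bullet> v)) (at y)" by simp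
  next
    have "((\<lambda>y. \<phi>' (f y)) has_derivative (\<lambda>v. c * (g \<bullet> v))) (at x)"
      by (rule has_derivative_compose[where f=f and g=\<phi>' and x=x])
        (use 1(3)[OF 1(2)] 1(5) d2 in \<open>auto simp: has_field_derivative_def\<close>)
    from has_derivative_scaleR[OF this 1(4)]
    show "((\<lambda>y. \<phi>' (f y) *\<^sub>R G y) has_derivative (\<lambda>v. \<phi>' (f x) *\<^sub>R H v + (c * (g \<bullet> v)) *\<^sub>R g)) (at x)"
      using 1(5) by simp
  qed (use 1 assms(3) in auto)
qed

lemma jet2_affine: "jet2 (\<lambda>y. n \<bullet> (y - x0)) x n (\<lambda>v. 0)"
  by (rule jet2I[of UNIV _ _ "\<lambda>y. n"]) (auto intro!: derivative_eq_intros)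

text \<open>
  The perspective of the square function is convex: its Hessian is \<open>2 / s\<close> times the rank one map
  \<open>e \<otimes> e\<close> with \<open>e = a - (l / s) n\<close>.
\<close>

lemma jet2_quadratic_over_linear:
  fixes a n :: "'a::euclidean_space"
  assumes s: "n \<bullet> (x - x0) > 0"
  defines "s \<equiv> n \<bullet> (x - x0)" and "l \<equiv> a \<bullet> (x - x0)"
  shows "jet2 (\<lambda>y. (a \<bullet> (y - x0))\<^sup>2 / (n \<bullet> (y - x0))) x
    ((2 * l / s) *\<^sub>R a - (l\<^sup>2 / s\<^sup>2) *\<^sub>R n)
    (\<lambda>v. (2 / s * ((a - (l / s) *\<^sub>R n) \<bullet> v)) *\<^sub>R (a - (l / s) *\<^sub>R n))"
proof (rule jet2I[where U="{y. n \<bullet> (y - x0) > 0}" and G="\<lambda>y. (2 * (a \<bullet> (y - x0)) / (n \<bullet> (y - x0))) *\<^sub>R a - ((a \<bullet> (y - x0))\<^sup>2 / (n \<bullet> (y - x0))\<^sup>2) *\<^sub>R n"])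
  show "open {y. n \<bullet> (y - x0) > 0}"
    by (intro open_Collect_less continuous_intros)
  fix y assume "y \<in> {y. n \<bullet> (y - x0) > 0}"
  then have y: "n \<bullet> (y - x0) \<noteq> 0" by simp
  show "((\<lambda>y. (a \<bullet> (y - x0))\<^sup>2 / (n \<bullet> (y - x0))) has_derivative
      (\<lambda>v. ((2 * (a \<bullet> (y - x0)) / (n \<bullet> (y - x0))) *\<^sub>R a - ((a \<bullet> (y - x0))\<^sup>2 / (n \<bullet> (y - x0))\<^sup>2) *\<^sub>R n) \<bullet> v)) (at y)"
    using y by (auto intro!: derivative_eq_intros ext simp: inner_diff_left field_simps power2_eq_square)
next
  have s0: "s > 0" using s by (simp add: s_def)
  have 1: "((\<lambda>y. 2 * (a \<bullet> (y - x0)) / (n \<bullet> (y - x0))) has_derivative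
      (\<lambda>v. 2 / s * (a \<bullet> v) - 2 * l / s\<^sup>2 * (n \<bullet> v))) (at x)"
    using s0 unfolding s_def l_def
    by (auto intro!: derivative_eq_intros ext simp: field_simps power2_eq_square)
  have 2: "((\<lambda>y. (a \<bullet> (y - x0))\<^sup>2 / (n \<bullet> (y - x0))\<^sup>2) has_derivative
      (\<lambda>v. 2 * l / s\<^sup>2 * (a \<bullet> v) - 2 * l\<^sup>2 / s ^ 3 * (n \<bullet> v))) (at x)"
    using s0 unfolding s_def l_def
    by (auto intro!: derivative_eq_intros ext simp: field_simps power2_eq_square power3_eq_cube)
  have eq: "(2 / s * (a \<bullet> v) - 2 * l / s\<^sup>2 * (n \<bullet> v)) *\<^sub>R a - (2 * l / s\<^sup>2 * (a \<bullet> v) - 2 * l\<^sup>2 / s ^ 3 * (n \<bullet> v)) *\<^sub>R n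
    = (2 / s * ((a - (l / s) *\<^sub>R n) \<bullet> v)) *\<^sub>R (a - (l / s) *\<^sub>R n)" for v
  proof -
    have "2 / s * ((a - (l / s) *\<^sub>R n) \<bullet> v) = 2 / s * (a \<bullet> v) - 2 * l / s\<^sup>2 * (n \<bullet> v)"
      using s0 by (simp add: inner_diff_left field_simps power2_eq_square)
    moreover have "(2 / s * (a \<bullet> v) - 2 * l / s\<^sup>2 * (n \<bullet> v)) * (l / s) = 2 * l / s\<^sup>2 * (a \<bullet> v) - 2 * l\<^sup>2 / s ^ 3 * (n \<bullet> v)"
      using s0 by (simp add: field_simps power2_eq_square power3_eq_cube)
    ultimately show ?thesis by (simp add: scaleR_diff_right)
  qed
  show "((\<lambda>y. (2 * (a \<bullet> (y - x0)) / (n \<bullet> (y - x0))) *\<^sub>R a - ((a \<bullet> (y - x0))\<^sup>2 / (n \<bullet> (y - x0))\<^sup>2) *\<^sub>R n)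
      has_derivative (\<lambda>v. (2 / s * ((a - (l / s) *\<^sub>R n) \<bullet> v)) *\<^sub>R (a - (l / s) *\<^sub>R n))) (at x)"
    using has_derivative_diff[OF has_derivative_scaleR_left[OF 1, of a] has_derivative_scaleR_left[OF 2, of n]]
    by (simp only: eq)
qed (use s in \<open>auto simp: s_def l_def\<close>)

section \<open>The operator in terms of the Hessian\<close>

text \<open>
  The second order part \<open>\<Sum>\<^sub>i\<^sub>j M\<^sub>i\<^sub>j H\<^sub>j\<^sub>i\<close> of the operator with coefficient matrix \<open>M\<close>.
\<close>

definition hess_trace :: "real^'n^'n \<Rightarrow> (real^'n \<Rightarrow> real^'n::finite) \<Rightarrow> real" where
  "hess_trace M H = (\<Sum>i\<in>UNIV. (M *v H (axis i 1)) $ i)"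

lemma hess_trace_add: "hess_trace M (\<lambda>v. H v + H' v) = hess_trace M H + hess_trace M H'"
  by (simp add: hess_trace_def matrix_vector_right_distrib sum.distrib)

lemma hess_trace_scale: "hess_trace M (\<lambda>v. c *\<^sub>R H v) = c * hess_trace M H"
  by (simp add: hess_trace_def matrix_vector_mult_scaleR sum_distrib_left)

text \<open>
  The reason for keeping Hessians as sums of rank one maps: lower bounds for the quadratic form
  of a matrix turn directly into bounds for the trace, without any diagonalisation.
\<close>

lemma hess_trace_rank_one: "hess_trace M (\<lambda>v. (c * (a \<bullet> v)) *\<^sub>R b) = c * (a \<bullet> (M *v b))"
proof -
  have "hess_trace M (\<lambda>v. (c * (a \<bullet> v)) *\<^sub>R b) = (\<Sum>i\<in>UNIV. c * (a $ i * (M *v b) $ i))"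
    by (simp add: hess_trace_def matrix_vector_mult_scaleR inner_axis mult.assoc)
  then show ?thesis by (simp add: inner_vec_def sum_distrib_left)
qed

lemma hess_trace_zero: "hess_trace M (\<lambda>v. 0) = 0"
  by (simp add: hess_trace_def)

lemma bounded_bilinear_matrix_vector_mult:
  "bounded_bilinear ((*v) :: real^'n::finite^'m::finite \<Rightarrow> real^'n \<Rightarrow> real^'m)"
proof -
  have "bilinear ((*v) :: real^'n^'m \<Rightarrow> real^'n \<Rightarrow> real^'m)"
    unfolding bilinear_def
    by (auto intro!: linearI simp: matrix_vector_right_distrib matrix_vector_mult_scaleR
        matrix_vector_mult_add_rdistrib scaleR_matrix_vector_assoc)
  then show ?thesis by (simp add: bilinear_conv_bounded_bilinear)
qed

lemma partial_deriv_eqI: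
  assumes "(f has_derivative D) (at x)"
  shows "partial_deriv i f x = D (axis i 1)"
  using frechet_derivative_eq[OF assms] by (simp add: partial_deriv_def)

lemma laplacian_jet2:
  assumes "jet2 h x g H"
  shows "laplacian h x = hess_trace (mat 1) H"
proof -
  obtain U G where 1: "open U" "x \<in> U" "\<And>y. y \<in> U \<Longrightarrow> (h has_derivative (\<lambda>v. G y \<bullet> v)) (at y)"
    "(G has_derivative H) (at x)" "G x = g" by (rule jet2E[OF assms]) (rule that)
  have "partial_deriv i (partial_deriv i h) x = H (axis i 1) $ i" for i
  proof (rule partial_deriv_eqI)
    have "((\<lambda>y. G y $ i) has_derivative (\<lambda>v. H v $ i)) (at x)"
      by (rule bounded_linear.has_derivative[OF bounded_linear_vec_nth 1(4)])
    then show "(partial_deriv i h has_derivative (\<lambda>v. H v $ i)) (at x)"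
      by (rule has_derivative_transform_within_open[OF _ 1(1,2)])
        (use partial_deriv_eqI[OF 1(3)] in \<open>auto simp: inner_axis\<close>)
  qed
  then show ?thesis by (simp add: laplacian_def hess_trace_def)
qed

text \<open>
  The chain rule splits the divergence into a second order part, a drift from the
  \<open>x\<close>-derivatives of the coefficients, and a term quadratic in the gradient from their
  \<open>z\<close>-derivative.
\<close>

lemma L_op_jet2:
  fixes A :: "real^'n::finite \<Rightarrow> real \<Rightarrow> real^'n^'n"
  assumes "jet2 h x g H" and DA: "((\<lambda>(x, z). A x z) has_derivative DA) (at (x, h x + m))"
  shows "L_op A m h x = hess_trace (A x (h x + m)) H + (\<Sum>i\<in>UNIV. (DA (axis i 1, 0) *v g) $ i)
     + g \<bullet> (DA (0, 1) *v g)"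
proof -
  obtain U G where 1: "open U" "x \<in> U" "\<And>y. y \<in> U \<Longrightarrow> (h has_derivative (\<lambda>v. G y \<bullet> v)) (at y)"
    "(G has_derivative H) (at x)" "G x = g" by (rule jet2E[OF assms(1)]) (rule that)
  have "((\<lambda>y. (y, h y + m)) has_derivative (\<lambda>v. (v, g \<bullet> v))) (at x)"
    using 1(3)[OF 1(2)] 1(5) by (auto intro!: derivative_eq_intros)
  from has_derivative_compose[OF this, of "\<lambda>(x, z). A x z"] DA
  have A': "((\<lambda>y. A y (h y + m)) has_derivative (\<lambda>v. DA (v, g \<bullet> v))) (at x)" by simp
  have lin: "linear DA" using DA by (rule has_derivative_linear)
  have W: "((\<lambda>y. A y (h y + m) *v G y) has_derivative (\<lambda>v. A x (h x + m) *v H v + DA (v, g \<bullet> v) *v g)) (at x)"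
    using bounded_bilinear.FDERIV[OF bounded_bilinear_matrix_vector_mult A' 1(4)] 1(5) by simp
  have "partial_deriv i (\<lambda>y. (A y (h y + m) *v gradient h y) $ i) x
      = (A x (h x + m) *v H (axis i 1) + DA (axis i 1, g \<bullet> axis i 1) *v g) $ i" for i
  proof (rule partial_deriv_eqI)
    have "((\<lambda>y. (A y (h y + m) *v G y) $ i) has_derivative
        (\<lambda>v. (A x (h x + m) *v H v + DA (v, g \<bullet> v) *v g) $ i)) (at x)"
      by (rule bounded_linear.has_derivative[OF bounded_linear_vec_nth W])
    then show "((\<lambda>y. (A y (h y + m) *v gradient h y) $ i) has_derivative
        (\<lambda>v. (A x (h x + m) *v H v + DA (v, g \<bullet> v) *v g) $ i)) (at x)"
      by (rule has_derivative_transform_within_open[OF _ 1(1,2)])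
        (use gradient_eqI[OF 1(3)] in auto)
  qed
  moreover have "DA (axis i 1, g \<bullet> axis i 1) = DA (axis i 1, 0) + (g $ i) *\<^sub>R DA (0, 1)" for i
  proof -
    have "(axis i 1, g \<bullet> axis i 1) = (axis i 1, 0) + (g $ i) *\<^sub>R (0, 1::real)"
      by (simp add: inner_axis)
    then have "DA (axis i 1, g \<bullet> axis i 1) = DA ((axis i 1, 0) + (g $ i) *\<^sub>R (0, 1))"
      by (rule arg_cong)
    also have "\<dots> = DA (axis i 1, 0) + (g $ i) *\<^sub>R DA (0, 1)"
      unfolding linear_add[OF lin] linear_cmul[OF lin] ..
    finally show ?thesis .
  qed
  ultimately have "L_op A m h x = (\<Sum>i\<in>UNIV. (A x (h x + m) *v H (axis i 1)) $ i
      + (DA (axis i 1, 0) *v g) $ i + g $ i * (DA (0, 1) *v g) $ i)"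
    by (simp add: L_op_def divergence_def matrix_vector_mult_add_rdistrib scaleR_matrix_vector_assoc[symmetric] add.assoc)
  then show ?thesis by (simp add: hess_trace_def sum.distrib inner_vec_def)
qed

text \<open>
  The parallelogram identity, in which the form is nonnegative at the difference \<open>x - y\<close>.
\<close>

lemma quadratic_form_add_le:
  fixes M :: "real^'n::finite^'n"
  assumes "\<And>\<xi>. 0 \<le> \<xi> \<bullet> (M *v \<xi>)"
  shows "(x + y) \<bullet> (M *v (x + y)) \<le> 2 * (x \<bullet> (M *v x)) + 2 * (y \<bullet> (M *v y))"
  using assms[of "x - y"]
  by (simp add: matrix_vector_right_distrib matrix_vector_mult_diff_distrib inner_add_left inner_add_right
      inner_diff_left inner_diff_right)

lemma quadratic_form_scale:
  fixes M :: "real^'n::finite^'n"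
  shows "(c *\<^sub>R x) \<bullet> (M *v (c *\<^sub>R x)) = c\<^sup>2 * (x \<bullet> (M *v x))"
  by (simp add: matrix_vector_mult_scaleR power2_eq_square)

text \<open>
  Combines \<open>k\<^sup>* |\<xi>|\<^sup>2 \<le> \<xi> \<bullet> M \<xi>\<close> with the Cauchy-Schwarz inequality: the \<open>z\<close>-derivative of the
  coefficients is controlled, as a quadratic form, by the coefficients themselves. This is what
  allows the quadratic gradient term to be absorbed even where the operator degenerates.
\<close>

lemma z_derivative_form_bound:
  fixes M Z :: "real^'n::finite^'n" and B :: real
  assumes k: "\<And>i. k i x z \<ge> 0"
    and lower: "\<And>\<xi>. (\<Sum>i\<in>UNIV. k i x z * (\<xi> $ i)\<^sup>2) \<le> \<xi> \<bullet> (M *v \<xi>)"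
    and Z: "\<And>\<xi>. (norm (Z *v \<xi>))\<^sup>2 \<le> B\<^sup>2 * k_star k x z * (\<xi> \<bullet> (M *v \<xi>))"
  shows "\<bar>\<xi> \<bullet> (Z *v \<xi>)\<bar> \<le> \<bar>B\<bar> * (\<xi> \<bullet> (M *v \<xi>))"
proof -
  let ?q = "\<xi> \<bullet> (M *v \<xi>)"
  have "k_star k x z * (norm \<xi>)\<^sup>2 = (\<Sum>i\<in>UNIV. k_star k x z * (\<xi> $ i)\<^sup>2)"
    unfolding power2_norm_eq_inner inner_vec_def sum_distrib_left by (simp add: power2_eq_square)
  also have "\<dots> \<le> (\<Sum>i\<in>UNIV. k i x z * (\<xi> $ i)\<^sup>2)"
    by (intro sum_mono mult_right_mono) (auto simp: k_star_def)
  also have "\<dots> \<le> ?q" by (rule lower)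
  finally have kq: "k_star k x z * (norm \<xi>)\<^sup>2 \<le> ?q" .
  have "0 \<le> (\<Sum>i\<in>UNIV. k i x z * (\<xi> $ i)\<^sup>2)" using k by (intro sum_nonneg mult_nonneg_nonneg) auto
  then have q0: "0 \<le> ?q" using lower[of \<xi>] by linarith
  have "(norm \<xi> * norm (Z *v \<xi>))\<^sup>2 \<le> (norm \<xi>)\<^sup>2 * (B\<^sup>2 * k_star k x z * ?q)"
    unfolding power_mult_distrib using Z by (intro mult_left_mono) auto
  also have "\<dots> = (B\<^sup>2 * ?q) * (k_star k x z * (norm \<xi>)\<^sup>2)" by (simp add: mult_ac)
  also have "\<dots> \<le> (B\<^sup>2 * ?q) * ?q" using kq q0 by (intro mult_left_mono) auto
  also have "\<dots> = (\<bar>B\<bar> * ?q)\<^sup>2" by (simp add: power2_eq_square)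
  finally have "norm \<xi> * norm (Z *v \<xi>) \<le> \<bar>B\<bar> * ?q"
    by (rule power2_le_imp_le) (use q0 in simp)
  then show ?thesis using Cauchy_Schwarz_ineq2[of \<xi> "Z *v \<xi>"] by linarith
qed

lemma drift_bound:
  fixes F :: "(real^'n::finite) \<times> real \<Rightarrow> real^'n^'n"
  assumes "smooth_on W F" "compact K" "K \<subseteq> W"
  obtains C where "C \<ge> 1"
    "\<And>p g. p \<in> K \<Longrightarrow> \<bar>\<Sum>i\<in>UNIV. (frechet_derivative F (at p) (axis i 1, 0) *v g) $ i\<bar> \<le> C * norm g"
proof -
  obtain b where b: "b > 0" "\<And>(M::real^'n^'n) (g::real^'n). norm (M *v g) \<le> norm M * norm g * b"
    using bounded_bilinear.pos_bounded[OF bounded_bilinear_matrix_vector_mult] by blast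
  have "\<exists>C. \<forall>p\<in>K. norm (frechet_derivative F (at p) (axis i 1, 0)) \<le> C" for i
  proof -
    have "Ck_on (Suc 0) W F" using assms(1) by (simp add: smooth_on_def)
    then have "continuous_on W (\<lambda>p. frechet_derivative F (at p) (axis i 1, 0))" by simp
    then have "compact ((\<lambda>p. frechet_derivative F (at p) (axis i 1, 0)) ` K)"
      using assms(2,3) by (intro compact_continuous_image) (auto intro: continuous_on_subset)
    then have "bounded ((\<lambda>p. frechet_derivative F (at p) (axis i 1, 0)) ` K)"
      by (rule compact_imp_bounded)
    then show ?thesis unfolding bounded_iff by auto
  qed
  then obtain c where c: "\<And>i p. p \<in> K \<Longrightarrow> norm (frechet_derivative F (at p) (axis i 1, 0)) \<le> c i"
    by metis
  show ?thesis
  proof (rule that[of "max 1 (\<Sum>i\<in>UNIV. c i * b)"])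
    fix p g assume p: "p \<in> K"
    have "\<bar>\<Sum>i\<in>UNIV. (frechet_derivative F (at p) (axis i 1, 0) *v g) $ i\<bar>
        \<le> (\<Sum>i\<in>UNIV. \<bar>(frechet_derivative F (at p) (axis i 1, 0) *v g) $ i\<bar>)" by (rule sum_abs)
    also have "\<dots> \<le> (\<Sum>i\<in>UNIV. c i * b * norm g)"
    proof (rule sum_mono)
      fix i
      have "\<bar>(frechet_derivative F (at p) (axis i 1, 0) *v g) $ i\<bar> \<le> norm (frechet_derivative F (at p) (axis i 1, 0) *v g)"
        by (rule component_le_norm_cart)
      also have "\<dots> \<le> norm (frechet_derivative F (at p) (axis i 1, 0)) * norm g * b" by (rule b)
      also have "\<dots> \<le> c i * norm g * b" using c[OF p] b(1) by (intro mult_right_mono) auto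
      finally show "\<bar>(frechet_derivative F (at p) (axis i 1, 0) *v g) $ i\<bar> \<le> c i * b * norm g"
        by (simp add: mult_ac)
    qed
    also have "\<dots> = (\<Sum>i\<in>UNIV. c i * b) * norm g" by (simp add: sum_distrib_right)
    also have "\<dots> \<le> max 1 (\<Sum>i\<in>UNIV. c i * b) * norm g" by (intro mult_right_mono) auto
    finally show "\<bar>\<Sum>i\<in>UNIV. (frechet_derivative F (at p) (axis i 1, 0) *v g) $ i\<bar>
      \<le> max 1 (\<Sum>i\<in>UNIV. c i * b) * norm g" .
  qed simp
qed

section \<open>The supersolution\<close>

lemma log_square_small: "((\<lambda>s. (- ln s + K)\<^sup>2 * s) \<longlongrightarrow> 0) (at_right (0::real))"
proof -
  have "filterlim (\<lambda>s::real. - ln s) at_top (at_right 0)"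
    using ln_at_0 by (simp add: filterlim_uminus_at_top)
  then have y: "filterlim (\<lambda>s. - ln s + K) at_top (at_right 0)"
    using filterlim_tendsto_add_at_top[OF tendsto_const[of K]] by (simp only: add.commute)
  have "((\<lambda>y::real. exp K * (y ^ 2 / exp y)) \<longlongrightarrow> exp K * 0) at_top"
    by (intro tendsto_mult tendsto_const tendsto_power_div_exp_0)
  then have "((\<lambda>s. exp K * ((- ln s + K) ^ 2 / exp (- ln s + K))) \<longlongrightarrow> 0) (at_right 0)"
    using filterlim_compose[OF _ y] by fastforce
  then show ?thesis
  proof (rule Lim_transform_eventually)
    show "\<forall>\<^sub>F s in at_right 0. exp K * ((- ln s + K) ^ 2 / exp (- ln s + K)) = (- ln s + K)\<^sup>2 * s"
      using eventually_at_right_less[of 0]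
      by eventually_elim (simp add: exp_diff)
  qed
qed

text \<open>
  A convex function tending to infinity at \<open>x0\<close>, where \<open>n\<close> is the inner normal of the domain
  and \<open>a\<close> the direction in which the operator does not degenerate. On a paraboloid
  \<open>c |y - x0|\<^sup>2 \<le> n \<bullet> (y - x0)\<close> the quotient in the exponent stays bounded.
\<close>

definition convex_profile :: "'a::euclidean_space \<Rightarrow> 'a \<Rightarrow> 'a \<Rightarrow> real \<Rightarrow> 'a \<Rightarrow> real" where
  "convex_profile x0 n a C y = - ln (n \<bullet> (y - x0)) + 4 * exp (C * ((a \<bullet> (y - x0))\<^sup>2 / (n \<bullet> (y - x0))))"

lemma smooth_on_convex_profile:
  assumes "open S" "\<And>y. y \<in> S \<Longrightarrow> n \<bullet> (y - x0) > 0"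
  shows "smooth_on S (convex_profile x0 n a C)"
proof -
  have inv: "smooth_on S (\<lambda>y. inverse (n \<bullet> (y - x0)))"
    by (rule smooth_on_compose[OF assms(1) smooth_on_inverse smooth_on_affine]) (use assms(2) in force)
  have ln: "smooth_on S (\<lambda>y. ln (n \<bullet> (y - x0)))"
    by (rule smooth_on_compose[OF assms(1) smooth_on_ln smooth_on_affine]) (use assms(2) in auto)
  have e: "smooth_on S (\<lambda>y. exp (C * ((a \<bullet> (y - x0)) * (a \<bullet> (y - x0)) * inverse (n \<bullet> (y - x0)))))"
    by (rule smooth_on_compose[OF assms(1) smooth_on_exp]) (auto intro!: smooth_on_mult smooth_on_const smooth_on_affine inv assms(1))
  show ?thesis
    unfolding convex_profile_def[abs_def] power2_eq_square divide_inverse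
    by (intro smooth_on_add smooth_on_minus smooth_on_mult smooth_on_const ln e assms(1))
qed

lemma jet2_convex_profile:
  fixes a n :: "'a::euclidean_space" and C :: real
  assumes s: "n \<bullet> (x - x0) > 0"
  defines "s \<equiv> n \<bullet> (x - x0)" and "l \<equiv> a \<bullet> (x - x0)"
  defines "E \<equiv> exp (C * (l\<^sup>2 / s))"
    and "gv \<equiv> (2 * l / s) *\<^sub>R a - (l\<^sup>2 / s\<^sup>2) *\<^sub>R n" and "e \<equiv> a - (l / s) *\<^sub>R n"
  shows "jet2 (convex_profile x0 n a C) x
    ((- (1 / s)) *\<^sub>R n + (4 * C * E) *\<^sub>R gv)
    (\<lambda>v. ((- (1 / s)) *\<^sub>R 0 + (1 / s\<^sup>2 * (n \<bullet> v)) *\<^sub>R n)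
       + ((4 * C * E) *\<^sub>R ((2 / s * (e \<bullet> v)) *\<^sub>R e) + (4 * C\<^sup>2 * E * (gv \<bullet> v)) *\<^sub>R gv))"
proof -
  have "jet2 (\<lambda>y. - ln (n \<bullet> (y - x0))) x ((- (1 / s)) *\<^sub>R n)
      (\<lambda>v. (- (1 / s)) *\<^sub>R 0 + (1 / s\<^sup>2 * (n \<bullet> v)) *\<^sub>R n)"
    unfolding s_def
    by (rule jet2_compose[OF jet2_affine, where T="{0<..}" and \<phi>="\<lambda>t. - ln t" and \<phi>'="\<lambda>t. - (1 / t)"])
      (use s in \<open>auto intro!: derivative_eq_intros simp: power2_eq_square\<close>)
  moreover have "jet2 (\<lambda>y. 4 * exp (C * ((a \<bullet> (y - x0))\<^sup>2 / (n \<bullet> (y - x0))))) x ((4 * C * E) *\<^sub>R gv)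
      (\<lambda>v. (4 * C * E) *\<^sub>R ((2 / s * (e \<bullet> v)) *\<^sub>R e) + (4 * C\<^sup>2 * E * (gv \<bullet> v)) *\<^sub>R gv)"
    unfolding s_def l_def E_def gv_def e_def
    by (rule jet2_compose[OF jet2_quadratic_over_linear[OF s], where T=UNIV and \<phi>="\<lambda>t. 4 * exp (C * t)"
          and \<phi>'="\<lambda>t. 4 * C * exp (C * t)"])
      (auto intro!: derivative_eq_intros simp: power2_eq_square)
  ultimately show ?thesis
    unfolding convex_profile_def[abs_def] by (rule jet2_add)
qed

text \<open>
  The number \<open>\<delta>\<close> stands for the first order part of an operator. Write \<open>p\<close> for the profile, \<open>s\<close> for
  the distance \<open>n \<bullet> (x - x0)\<close>, \<open>l\<close> for the coordinate in the direction \<open>a\<close>, \<open>v = l\<^sup>2 / s\<close> and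
  \<open>u = 1 / p\<close>.

  Let \<open>T\<close> be the trace of \<open>M D\<^sup>2p\<close>. Since \<open>p\<close> is convex and large, the term
  \<open>\<nabla>p \<otimes> \<nabla>p\<close> in the Hessian of \<open>1 / p\<close> costs at most half of \<open>T\<close>. It remains to compare
  \<open>T / 2\<close> with \<open>C |\<nabla>p|\<close>, which is of order \<open>1 / s\<close>. If \<open>n\<close> has a component in the direction
  \<open>i1\<close>, the logarithm alone contributes the much larger \<open>(n $ i1)\<^sup>2 / s\<^sup>2\<close>. Otherwise the exponential
  contributes \<open>(4 C E + 8 C\<^sup>2 E v) / s\<close> to \<open>T / 2\<close>, against a drift of at most
  \<open>(C + 4 C\<^sup>2 E (2 |l| + v)) / s\<close>: the factor 4 in the profile pays for the summand \<open>C\<close> and for the one with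
  the small number \<open>|l|\<close>, and the choice of \<open>C\<close> itself as the rate of the exponential pays for the
  summand with \<open>v\<close>.
\<close>

lemma inverse_profile_supersolution:
  fixes x x0 n :: "real^'n::finite" and i1 :: 'n and C :: real
  defines "a \<equiv> axis i1 1 :: real^'n"
  defines "s \<equiv> n \<bullet> (x - x0)" and "l \<equiv> a \<bullet> (x - x0)"
  defines "E \<equiv> exp (C * (l\<^sup>2 / s))" and "p \<equiv> convex_profile x0 n a C x"
  assumes s: "s > 0" and C: "C \<ge> 1" and n: "norm n = 1"
    and p1: "p \<ge> 32 * E" and p2: "p\<^sup>2 \<le> 1 / s"
    and p3: "n $ i1 = 0 \<and> \<bar>l\<bar> \<le> 1 / (8 * C)
      \<or> C * (1 + 4 * C * E * (2 * \<bar>l\<bar> + l\<^sup>2 / s)) + 1 \<le> (n $ i1)\<^sup>2 / (2 * s)"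
  obtains g H where "jet2 (\<lambda>y. inverse (convex_profile x0 n a C y)) x g H"
    "\<And>M \<delta>. (\<And>\<xi>. (\<xi> $ i1)\<^sup>2 \<le> \<xi> \<bullet> (M *v \<xi>)) \<Longrightarrow> \<delta> \<le> C * norm g \<Longrightarrow> hess_trace M H + \<delta> \<le> -1"
proof -
  define gv where "gv = (2 * l / s) *\<^sub>R a - (l\<^sup>2 / s\<^sup>2) *\<^sub>R n"
  define e where "e = a - (l / s) *\<^sub>R n"
  define gp where "gp = (- (1 / s)) *\<^sub>R n + (4 * C * E) *\<^sub>R gv"
  define Hp where "Hp = (\<lambda>v. ((- (1 / s)) *\<^sub>R 0 + (1 / s\<^sup>2 * (n \<bullet> v)) *\<^sub>R n)
       + ((4 * C * E) *\<^sub>R ((2 / s * (e \<bullet> v)) *\<^sub>R e) + (4 * C\<^sup>2 * E * (gv \<bullet> v)) *\<^sub>R gv))"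
  define v where "v = l\<^sup>2 / s"
  have v0: "v \<ge> 0" using s by (simp add: v_def)
  have "0 \<le> C * v" using v0 C by simp
  then have E1: "E \<ge> 1" by (simp add: E_def v_def)
  have pp: "p \<ge> 32" "p > 0" using p1 E1 by auto
  have jp: "jet2 (convex_profile x0 n a C) x gp Hp"
    unfolding gp_def Hp_def gv_def e_def E_def l_def s_def
    by (rule jet2_convex_profile) (use s in \<open>simp add: s_def\<close>)
  have ju: "jet2 (\<lambda>y. inverse (convex_profile x0 n a C y)) x ((- (1 / p\<^sup>2)) *\<^sub>R gp)
      (\<lambda>v. (- (1 / p\<^sup>2)) *\<^sub>R Hp v + (2 / p ^ 3 * (gp \<bullet> v)) *\<^sub>R gp)"
    unfolding p_def
    by (rule jet2_compose[OF jp, where T="{0<..}" and \<phi>=inverse and \<phi>'="\<lambda>t. - (1 / t\<^sup>2)"])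
      (use pp in \<open>auto intro!: derivative_eq_intros simp: p_def[symmetric] power2_eq_square power3_eq_cube divide_simps\<close>)
  have an: "a $ i1 = 1" "norm a = 1" by (simp_all add: a_def norm_axis_1)
  have gvn: "norm gv \<le> (2 * \<bar>l\<bar> + v) / s"
  proof -
    have "norm gv \<le> norm ((2 * l / s) *\<^sub>R a) + norm ((l\<^sup>2 / s\<^sup>2) *\<^sub>R n)"
      unfolding gv_def by (rule norm_triangle_ineq4)
    also have "\<dots> = (2 * \<bar>l\<bar> + v) / s"
      using s n an by (simp add: v_def abs_mult field_simps power2_eq_square)
    finally show ?thesis .
  qed
  have gpn: "norm gp \<le> (1 + 4 * C * E * (2 * \<bar>l\<bar> + v)) / s"
  proof -
    have "norm gp \<le> norm ((- (1 / s)) *\<^sub>R n) + norm ((4 * C * E) *\<^sub>R gv)"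
      unfolding gp_def by (rule norm_triangle_ineq)
    also have "\<dots> = 1 / s + 4 * C * E * norm gv" using s n C E1 by (simp add: abs_mult)
    also have "\<dots> \<le> 1 / s + 4 * C * E * ((2 * \<bar>l\<bar> + v) / s)"
      using gvn C E1 by (intro add_left_mono mult_left_mono) auto
    also have "\<dots> = (1 + 4 * C * E * (2 * \<bar>l\<bar> + v)) / s"
      by (simp only: add_divide_distrib[of 1] times_divide_eq_right)
    finally show ?thesis .
  qed
  have split: "(1 + C * Y) / s = 1 / s + C * (Y / s)" "(C * Y + 1) / s = 1 / s + C * (Y / s)" for Y
    by (simp_all add: add_divide_distrib)
  show ?thesis
  proof (rule that[OF ju])
    fix M :: "real^'n^'n" and \<delta> :: real
    assume M: "\<And>\<xi>. (\<xi> $ i1)\<^sup>2 \<le> \<xi> \<bullet> (M *v \<xi>)" and \<delta>: "\<delta> \<le> C * norm ((- (1 / p\<^sup>2)) *\<^sub>R gp)"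
    define q where "q = (\<lambda>\<xi>. \<xi> \<bullet> (M *v \<xi>))"
    have q0: "0 \<le> q \<xi>" for \<xi> using M[of \<xi>] zero_le_power2[of "\<xi> $ i1"] unfolding q_def by linarith
    define T where "T = q n / s\<^sup>2 + 8 * C * E / s * q e + 4 * C\<^sup>2 * E * q gv"
    have Tp: "hess_trace M Hp = T"
      unfolding Hp_def hess_trace_add hess_trace_scale hess_trace_rank_one hess_trace_zero by (simp add: T_def q_def)
    have tr: "hess_trace M (\<lambda>v. (- (1 / p\<^sup>2)) *\<^sub>R Hp v + (2 / p ^ 3 * (gp \<bullet> v)) *\<^sub>R gp) = - (1 / p\<^sup>2) * T + 2 / p ^ 3 * q gp"
      unfolding hess_trace_add hess_trace_scale hess_trace_rank_one Tp by (simp add: q_def)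
    have "q gp \<le> 2 * q ((- (1 / s)) *\<^sub>R n) + 2 * q ((4 * C * E) *\<^sub>R gv)"
      unfolding gp_def q_def by (rule quadratic_form_add_le) (use q0 in \<open>simp add: q_def\<close>)
    also have "\<dots> = 2 * (q n / s\<^sup>2) + 8 * E * (4 * C\<^sup>2 * E * q gv)"
      unfolding q_def quadratic_form_scale by (simp add: power2_eq_square)
    also have "\<dots> \<le> p / 4 * (q n / s\<^sup>2) + p / 4 * (4 * C\<^sup>2 * E * q gv)"
      using pp p1 q0 E1 by (intro add_mono mult_right_mono) auto
    also have "\<dots> \<le> p / 4 * T"
      unfolding T_def distrib_left[symmetric] using pp q0[of e] s C E1 by (intro mult_left_mono) auto
    finally have qgp: "q gp \<le> p / 4 * T" .
    have "2 / p ^ 3 * q gp \<le> 2 / p ^ 3 * (p / 4 * T)" using qgp pp by (intro mult_left_mono) auto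
    also have "\<dots> = 1 / p\<^sup>2 * (T / 2)" using pp by (simp add: power2_eq_square power3_eq_cube)
    finally have tr_le: "hess_trace M (\<lambda>v. (- (1 / p\<^sup>2)) *\<^sub>R Hp v + (2 / p ^ 3 * (gp \<bullet> v)) *\<^sub>R gp) \<le> - (1 / p\<^sup>2) * (T / 2)"
      unfolding tr by (simp add: field_simps)
    \<comment> \<open>the second order gain exceeds the drift by \<open>1 / s\<close>, which is at least \<open>p\<^sup>2\<close>\<close>
    have key: "1 / s + C * norm gp \<le> T / 2"
      using p3
    proof
      assume n1: "n $ i1 = 0 \<and> \<bar>l\<bar> \<le> 1 / (8 * C)"
      have "1 \<le> q e" using M[of e] n1 an by (simp add: q_def e_def)
      moreover have "4 * v / s \<le> q gv"
        using M[of gv] n1 an s by (simp add: q_def gv_def v_def power_divide power_mult_distrib power2_eq_square)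
      ultimately have "8 * C * E / s * 1 + 4 * C\<^sup>2 * E * (4 * v / s) \<le> T"
        unfolding T_def using q0[of n] s C E1 by (intro add_mono mult_left_mono add_increasing) auto
      then have "(4 * C * E + 8 * C\<^sup>2 * E * v) / s \<le> T / 2" by (simp add: add_divide_distrib)
      moreover have "1 / s + C * norm gp \<le> (4 * C * E + 8 * C\<^sup>2 * E * v) / s"
      proof -
        have l8: "8 * C * \<bar>l\<bar> \<le> 1" using n1 C by (simp add: field_simps)
        have CE: "1 \<le> C * E" "C \<le> C * E" using C E1 by (auto simp: mult_ge1_I)
        have "C * E * (8 * C * \<bar>l\<bar>) \<le> C * E * 1" using l8 CE by (intro mult_left_mono) auto
        moreover have "0 \<le> C\<^sup>2 * E * v" using v0 E1 by simp
        ultimately have "1 + C * (1 + 4 * C * E * (2 * \<bar>l\<bar> + v)) \<le> 4 * C * E + 8 * C\<^sup>2 * E * v"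
          using CE by (simp add: algebra_simps power2_eq_square)
        then have "(1 + C * (1 + 4 * C * E * (2 * \<bar>l\<bar> + v))) / s \<le> (4 * C * E + 8 * C\<^sup>2 * E * v) / s"
          using s by (intro divide_right_mono) auto
        moreover have "C * norm gp \<le> C * ((1 + 4 * C * E * (2 * \<bar>l\<bar> + v)) / s)"
          using gpn C by (intro mult_left_mono) auto
        ultimately show ?thesis unfolding split by linarith
      qed
      ultimately show ?thesis by linarith
    next
      assume n1: "C * (1 + 4 * C * E * (2 * \<bar>l\<bar> + l\<^sup>2 / s)) + 1 \<le> (n $ i1)\<^sup>2 / (2 * s)"
      have "C * norm gp \<le> C * ((1 + 4 * C * E * (2 * \<bar>l\<bar> + v)) / s)"
        using gpn C by (intro mult_left_mono) auto
      then have "1 / s + C * norm gp \<le> (C * (1 + 4 * C * E * (2 * \<bar>l\<bar> + v)) + 1) / s"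
        unfolding split by linarith
      also have "\<dots> \<le> ((n $ i1)\<^sup>2 / (2 * s)) / s"
        using n1 s unfolding v_def by (intro divide_right_mono) auto
      also have "\<dots> = (n $ i1)\<^sup>2 / s\<^sup>2 / 2" by (simp add: power2_eq_square)
      also have "\<dots> \<le> q n / s\<^sup>2 / 2"
        using M[of n] by (intro divide_right_mono) (auto simp: q_def)
      also have "\<dots> \<le> T / 2"
        unfolding T_def using q0[of e] q0[of gv] s C E1 by (intro divide_right_mono) auto
      finally show ?thesis .
    qed
    have "\<delta> \<le> 1 / p\<^sup>2 * (C * norm gp)" using \<delta> by (simp add: mult_ac)
    with tr_le have "hess_trace M (\<lambda>v. (- (1 / p\<^sup>2)) *\<^sub>R Hp v + (2 / p ^ 3 * (gp \<bullet> v)) *\<^sub>R gp) + \<delta>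
        \<le> - (1 / p\<^sup>2 * (T / 2 - C * norm gp))" by (simp add: right_diff_distrib)
    also have "\<dots> \<le> - (1 / p\<^sup>2 * p\<^sup>2)"
      using key p2 by (intro le_imp_neg_le mult_left_mono) auto
    also have "\<dots> = -1" using pp by simp
    finally show "hess_trace M (\<lambda>v. (- (1 / p\<^sup>2)) *\<^sub>R Hp v + (2 / p ^ 3 * (gp \<bullet> v)) *\<^sub>R gp) + \<delta> \<le> -1" .
  qed
qed

text \<open>
  Verifies the numerical hypotheses of the preceding lemma close to \<open>x0\<close>: on the paraboloid the
  exponential is bounded by \<open>exp (C / c)\<close>, and as \<open>s\<close> tends to 0 the logarithm \<open>- ln s\<close> exceeds any
  constant but its square stays below \<open>1 / s\<close>.
\<close>

lemma convex_profile_near: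
  fixes n a :: "'a::euclidean_space"
  assumes n: "norm n = 1" and a: "norm a = 1" and c: "c > 0" and C: "C \<ge> 1"
  obtains r K where "r > 0" "r \<le> 1" "K > 0"
    "\<And>x. x \<noteq> x0 \<Longrightarrow> norm (x - x0) < r \<Longrightarrow> c * (norm (x - x0))\<^sup>2 \<le> n \<bullet> (x - x0) \<Longrightarrow>
      n \<bullet> (x - x0) > 0 \<and>
      - ln (n \<bullet> (x - x0)) \<le> convex_profile x0 n a C x \<and>
      convex_profile x0 n a C x \<le> - ln (n \<bullet> (x - x0)) + K \<and>
      32 * exp (C * ((a \<bullet> (x - x0))\<^sup>2 / (n \<bullet> (x - x0)))) \<le> convex_profile x0 n a C x \<and>
      (convex_profile x0 n a C x)\<^sup>2 \<le> 1 / (n \<bullet> (x - x0)) \<and>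
      (n \<bullet> a = 0 \<and> \<bar>a \<bullet> (x - x0)\<bar> \<le> 1 / (8 * C) \<or>
       C * (1 + 4 * C * exp (C * ((a \<bullet> (x - x0))\<^sup>2 / (n \<bullet> (x - x0)))) *
         (2 * \<bar>a \<bullet> (x - x0)\<bar> + (a \<bullet> (x - x0))\<^sup>2 / (n \<bullet> (x - x0)))) + 1
         \<le> (n \<bullet> a)\<^sup>2 / (2 * (n \<bullet> (x - x0))))"
proof -
  define E1 where "E1 = exp (C / c)"
  have E1: "E1 \<ge> 1" using C c by (simp add: E1_def)
  define B where "B = C * (1 + 4 * C * E1 * (2 + 1 / c)) + 1"
  have B: "B > 0" using C c E1 by (simp add: B_def add_nonneg_pos)
  have "\<forall>\<^sub>F s in at_right 0. (- ln s + 4 * E1)\<^sup>2 * s < 1"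
    using order_tendstoD(2)[OF log_square_small, of 1] by simp
  moreover have "\<forall>\<^sub>F s in at_right (0::real). ln s \<le> - 32 * E1"
    using ln_at_0 by (simp add: filterlim_at_bot)
  ultimately have "\<forall>\<^sub>F s in at_right 0. (- ln s + 4 * E1)\<^sup>2 * s < 1 \<and> ln s \<le> - 32 * E1"
    by eventually_elim simp
  then obtain s0 where s0: "s0 > 0" "\<And>s. 0 < s \<Longrightarrow> s < s0 \<Longrightarrow> (- ln s + 4 * E1)\<^sup>2 * s < 1 \<and> ln s \<le> - 32 * E1"
    unfolding eventually_at_right_field by auto
  define r where "r = Min {s0, 1, 1 / (8 * C), if n \<bullet> a = 0 then 1 else (n \<bullet> a)\<^sup>2 / (2 * B)}"
  have r: "r > 0" "r \<le> s0" "r \<le> 1" "r \<le> 1 / (8 * C)" "n \<bullet> a \<noteq> 0 \<Longrightarrow> r \<le> (n \<bullet> a)\<^sup>2 / (2 * B)"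
    using s0(1) C B by (auto simp: r_def)
  show ?thesis
  proof (rule that[OF r(1,3), of "4 * E1"])
    show "4 * E1 > 0" using E1 by simp
    fix x assume x: "x \<noteq> x0" "norm (x - x0) < r" "c * (norm (x - x0))\<^sup>2 \<le> n \<bullet> (x - x0)"
    define w where "w = x - x0"
    define s where "s = n \<bullet> w"
    define l where "l = a \<bullet> w"
    define v where "v = l\<^sup>2 / s"
    define E where "E = exp (C * v)"
    have w: "norm w > 0" "norm w < r" "c * (norm w)\<^sup>2 \<le> s" using x by (auto simp: w_def s_def)
    have "0 < c * (norm w)\<^sup>2" using w(1) c by simp
    then have s: "s > 0" using w(3) by linarith
    have sw: "s \<le> norm w" using norm_cauchy_schwarz[of n w] n by (simp add: s_def)
    have lw: "\<bar>l\<bar> \<le> norm w" using Cauchy_Schwarz_ineq2[of a w] a by (simp add: l_def)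
    have "l\<^sup>2 \<le> (norm w)\<^sup>2" using power_mono[OF lw, of 2] by simp
    then have "c * l\<^sup>2 \<le> s" using w(3) c mult_left_mono[of "l\<^sup>2" "(norm w)\<^sup>2" c] by linarith
    then have v: "0 \<le> v" "v \<le> 1 / c" using s c by (auto simp: v_def field_simps)
    have "C * v \<le> C / c" using mult_left_mono[OF v(2), of C] C by simp
    then have E: "1 \<le> E" "E \<le> E1" using C v by (auto simp: E_def E1_def)
    have p: "convex_profile x0 n a C x = - ln s + 4 * E"
      by (simp add: convex_profile_def s_def l_def E_def v_def w_def)
    have s0': "(- ln s + 4 * E1)\<^sup>2 * s < 1" "ln s \<le> - 32 * E1"
      using s0(2)[of s] s sw w r by auto
    have "(- ln s + 4 * E)\<^sup>2 \<le> (- ln s + 4 * E1)\<^sup>2"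
      using s0' E by (intro power_mono) auto
    also have "\<dots> \<le> 1 / s" using s0'(1) s by (simp add: field_simps)
    finally have p2: "(- ln s + 4 * E)\<^sup>2 \<le> 1 / s" .
    have "n \<bullet> a = 0 \<and> \<bar>l\<bar> \<le> 1 / (8 * C) \<or> C * (1 + 4 * C * E * (2 * \<bar>l\<bar> + v)) + 1 \<le> (n \<bullet> a)\<^sup>2 / (2 * s)"
    proof (cases "n \<bullet> a = 0")
      case True
      then show ?thesis using lw w(2) r(4) by linarith
    next
      case False
      have "C * (1 + 4 * C * E * (2 * \<bar>l\<bar> + v)) + 1 \<le> B"
        unfolding B_def using lw w(2) r(3) E v C
        by (intro add_right_mono mult_left_mono add_left_mono mult_mono add_mono) auto
      also have "B \<le> (n \<bullet> a)\<^sup>2 / (2 * s)"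
      proof -
        have "s \<le> (n \<bullet> a)\<^sup>2 / (2 * B)" using sw w(2) r(5)[OF False] by linarith
        then show ?thesis using B s by (simp add: field_simps)
      qed
      finally show ?thesis by blast
    qed
    then show "n \<bullet> (x - x0) > 0 \<and>
      - ln (n \<bullet> (x - x0)) \<le> convex_profile x0 n a C x \<and>
      convex_profile x0 n a C x \<le> - ln (n \<bullet> (x - x0)) + 4 * E1 \<and>
      32 * exp (C * ((a \<bullet> (x - x0))\<^sup>2 / (n \<bullet> (x - x0)))) \<le> convex_profile x0 n a C x \<and>
      (convex_profile x0 n a C x)\<^sup>2 \<le> 1 / (n \<bullet> (x - x0)) \<and>
      (n \<bullet> a = 0 \<and> \<bar>a \<bullet> (x - x0)\<bar> \<le> 1 / (8 * C) \<or>
       C * (1 + 4 * C * exp (C * ((a \<bullet> (x - x0))\<^sup>2 / (n \<bullet> (x - x0)))) *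
         (2 * \<bar>a \<bullet> (x - x0)\<bar> + (a \<bullet> (x - x0))\<^sup>2 / (n \<bullet> (x - x0)))) + 1
         \<le> (n \<bullet> a)\<^sup>2 / (2 * (n \<bullet> (x - x0))))"
      using s p p2 E s0'(2) unfolding p
      by (simp only: w_def[symmetric] s_def[symmetric] l_def[symmetric] v_def[symmetric] E_def[symmetric]) auto
  qed
qed

section \<open>The barrier\<close>

text \<open>
  Passing from a supersolution \<open>u\<close> to the barrier \<open>h = - F(u)\<close>. With \<open>q = \<nabla>u \<bullet> A \<nabla>u\<close>, the terms
  with \<open>q\<close> add up to at least \<open>- (F'' + B F'\<^sup>2) q \<ge> 0\<close>, and what remains is \<open>F'(u)\<close> times a
  quantity that is at least 1. The Laplacian is the case of the identity matrix without drift.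
\<close>

lemma barrier_bounds:
  fixes A :: "real^'n::finite \<Rightarrow> real \<Rightarrow> real^'n^'n" and F F1 F2 :: "real \<Rightarrow> real"
  assumes ju: "jet2 u x g H" and u: "u x > 0" and C: "C \<ge> 0"
    and sup: "\<And>M \<delta>. (\<And>\<xi>. (\<xi> $ i1)\<^sup>2 \<le> \<xi> \<bullet> (M *v \<xi>)) \<Longrightarrow> \<delta> \<le> C * norm g \<Longrightarrow> hess_trace M H + \<delta> \<le> -1"
    and F: "\<And>t. t > 0 \<Longrightarrow> (F has_real_derivative F1 t) (at t)"
    and F1: "(F1 has_real_derivative F2 (u x)) (at (u x))" "F1 (u x) > 0"
    and F2: "F2 (u x) + B * (F1 (u x))\<^sup>2 \<le> 0"
    and B: "B \<ge> 0"
    and h: "open S" "x \<in> S" "\<And>y. y \<in> S \<Longrightarrow> - F (u y) = h y"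
  shows laplacian_barrier_pos: "laplacian h x > 0"
    and L_op_barrier_ge: "\<And>m DA. ((\<lambda>(x, z). A x z) has_derivative DA) (at (x, h x + m)) \<Longrightarrow>
      (\<And>\<xi>. (\<xi> $ i1)\<^sup>2 \<le> \<xi> \<bullet> (A x (h x + m) *v \<xi>)) \<Longrightarrow>
      (\<And>\<xi>. \<bar>\<Sum>i\<in>UNIV. (DA (axis i 1, 0) *v \<xi>) $ i\<bar> \<le> C * norm \<xi>) \<Longrightarrow>
      (\<And>\<xi>. \<bar>\<xi> \<bullet> (DA (0, 1) *v \<xi>)\<bar> \<le> B * (\<xi> \<bullet> (A x (h x + m) *v \<xi>))) \<Longrightarrow>
      F1 (u x) \<le> L_op A m h x"
proof -
  define d1 where "d1 = F1 (u x)"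
  define d2 where "d2 = F2 (u x)"
  have d1: "d1 > 0" using F1 by (simp add: d1_def)
  have d2: "d2 + B * d1\<^sup>2 \<le> 0" using F2 by (simp add: d1_def d2_def)
  have "0 \<le> B * d1\<^sup>2" using B by simp
  then have d2': "d2 \<le> 0" using d2 by linarith
  have "jet2 (\<lambda>y. - F (u y)) x ((- d1) *\<^sub>R g) (\<lambda>v. (- d1) *\<^sub>R H v + ((- d2) * (g \<bullet> v)) *\<^sub>R g)"
    unfolding d1_def d2_def
    by (rule jet2_compose[OF ju, where T="{0<..}" and \<phi>="\<lambda>t. - F t" and \<phi>'="\<lambda>t. - F1 t"])
      (use u in \<open>auto intro!: DERIV_minus F F1\<close>)
  then have jh: "jet2 h x ((- d1) *\<^sub>R g) (\<lambda>v. (- d1) *\<^sub>R H v + ((- d2) * (g \<bullet> v)) *\<^sub>R g)"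
    using jet2_cong[OF h(1,2), of "\<lambda>y. - F (u y)" h] h(3) by blast
  have tr: "hess_trace M (\<lambda>v. (- d1) *\<^sub>R H v + ((- d2) * (g \<bullet> v)) *\<^sub>R g) = - d1 * hess_trace M H - d2 * (g \<bullet> (M *v g))" for M
    unfolding hess_trace_add hess_trace_scale hess_trace_rank_one by simp
  show "laplacian h x > 0"
  proof -
    have "hess_trace (mat 1) H + 0 \<le> -1"
    proof (rule sup)
      show "(\<xi> $ i1)\<^sup>2 \<le> \<xi> \<bullet> (mat 1 *v \<xi>)" for \<xi> :: "real^'n"
        using power_mono[OF component_le_norm_cart[of \<xi> i1], of 2] by (simp add: dot_square_norm)
    qed (use C in simp)
    then have "d1 * hess_trace (mat 1) H \<le> d1 * (-1)" using d1 by (intro mult_left_mono) auto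
    moreover have "d2 * (g \<bullet> g) \<le> 0" using d2' by (simp add: mult_nonpos_nonneg)
    ultimately show ?thesis using d1 unfolding laplacian_jet2[OF jh] tr by simp
  qed
  fix m DA
  assume DA: "((\<lambda>(x, z). A x z) has_derivative DA) (at (x, h x + m))"
    and ell: "\<And>\<xi>. (\<xi> $ i1)\<^sup>2 \<le> \<xi> \<bullet> (A x (h x + m) *v \<xi>)"
    and drift: "\<And>\<xi>. \<bar>\<Sum>i\<in>UNIV. (DA (axis i 1, 0) *v \<xi>) $ i\<bar> \<le> C * norm \<xi>"
    and Z: "\<And>\<xi>. \<bar>\<xi> \<bullet> (DA (0, 1) *v \<xi>)\<bar> \<le> B * (\<xi> \<bullet> (A x (h x + m) *v \<xi>))"
  define M where "M = A x (h x + m)"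
  define q where "q = g \<bullet> (M *v g)"
  have q0: "q \<ge> 0" using ell[of g] zero_le_power2[of "g $ i1"] unfolding q_def M_def by linarith
  define b where "b = (\<Sum>i\<in>UNIV. (DA (axis i 1, 0) *v g) $ i)"
  have "b \<le> C * norm g" using drift[of g] by (simp add: b_def)
  then have sb: "hess_trace M H + b \<le> -1" using ell by (intro sup) (auto simp: M_def)
  have b': "(\<Sum>i\<in>UNIV. (DA (axis i 1, 0) *v ((- d1) *\<^sub>R g)) $ i) = - d1 * b"
    unfolding matrix_vector_mult_scaleR b_def by (simp add: sum_distrib_left sum_negf)
  have z: "- (d1\<^sup>2 * (B * q)) \<le> ((- d1) *\<^sub>R g) \<bullet> (DA (0, 1) *v ((- d1) *\<^sub>R g))"
  proof -
    have "d1\<^sup>2 * (- (B * q)) \<le> d1\<^sup>2 * (g \<bullet> (DA (0, 1) *v g))"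
      using Z[of g] by (intro mult_left_mono) (auto simp: q_def M_def)
    then show ?thesis unfolding quadratic_form_scale by simp
  qed
  have "d1 * (hess_trace M H + b) \<le> d1 * (-1)" using sb d1 by (intro mult_left_mono) auto
  moreover have "(d2 + B * d1\<^sup>2) * q \<le> 0" using d2 q0 by (rule mult_nonpos_nonneg)
  moreover have "L_op A m h x = - d1 * hess_trace M H - d2 * q + - d1 * b
      + ((- d1) *\<^sub>R g) \<bullet> (DA (0, 1) *v ((- d1) *\<^sub>R g))"
    unfolding L_op_jet2[OF jh DA] b' tr by (simp add: M_def q_def)
  ultimately show "F1 (u x) \<le> L_op A m h x"
    using z unfolding d1_def[symmetric] by (simp add: algebra_simps)
qed

theorem lemma7p6:
  fixes \<Omega> \<Phi> :: "(real^'n::finite) set"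
    and i1 :: 'n
    and k :: "'n \<Rightarrow> real^'n \<Rightarrow> real \<Rightarrow> real"
    and A :: "real^'n \<Rightarrow> real \<Rightarrow> real^'n^'n"
    and \<gamma> :: "real^'n \<Rightarrow> real \<Rightarrow> real^'n"
    and \<omega> :: "real \<Rightarrow> real"
  assumes "CARD('n) \<ge> 2"
    and "is_domain \<Omega>" and "bounded \<Omega>"
    and "strongly_convex_domain \<Phi>" and "\<Phi> \<Subset>\<Subset> \<Omega>"
    and "continuous_on {0..diameter \<Phi>} \<omega>"
    and "C2_real_on {0<..diameter \<Phi>} \<omega>"
    and "concave_on {0..diameter \<Phi>} \<omega>"
    and "strict_mono_on {0..diameter \<Phi>} \<omega>"
    and "\<omega> 0 = 0"
    and "admissible_k \<Omega> i1 k"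
    and "smooth_on (\<Omega> \<times> UNIV) (\<lambda>(x, z). A x z)"
    and "diagonal_condition \<Omega> k A"
    and "z_derivative_condition \<Omega> k A"
    and "subunit_type \<Omega> A \<gamma>"
  shows "\<forall>x0\<in>frontier \<Phi>. \<forall>\<eta>>0. \<forall>\<nu>>0. \<forall>m0>0. \<forall>K>0.
    \<exists>(N :: (real^'n) set) (h :: real^'n \<Rightarrow> real).
      open N \<and> x0 \<in> N \<and> N \<subseteq> {x. norm (x - x0) < \<eta>} \<and>
      continuous_on (closure N) h \<and> smooth_on (N - {x0}) h \<and>
      h x0 = 0 \<and>
      (\<forall>x\<in>\<Phi> \<inter> N. h x \<le> - \<omega> (norm (x - x0))) \<and>
      (\<forall>x\<in>\<Phi> \<inter> frontier N. h x \<le> - \<nu>) \<and>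
      (\<forall>x\<in>\<Phi> \<inter> N. \<forall>m. \<bar>m\<bar> \<le> m0 \<longrightarrow> L_op A m h x \<ge> K) \<and>
      (\<forall>x\<in>\<Phi> \<inter> N. laplacian h x > 0)"
proof (intro ballI allI impI)
  fix x0 \<eta> \<nu> m0 K
  assume x0: "x0 \<in> frontier \<Phi>" and \<eta>: "\<eta> > (0::real)" and \<nu>: "\<nu> > (0::real)" and m0: "m0 > (0::real)" and K: "K > (0::real)"

  have opPhi: "open \<Phi>" using assms(4) by (simp add: strongly_convex_domain_def is_domain_def)
  have bPhi: "bounded \<Phi>" using assms(5) compact_imp_bounded bounded_subset closure_subset
    unfolding compactly_contained_def by metis
  have x0c: "x0 \<in> closure \<Phi>" "x0 \<notin> \<Phi>" using x0 opPhi by (auto simp: frontier_def interior_open)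
  have opOm: "open \<Omega>" using assms(2) by (simp add: is_domain_def)
  have x0Om: "x0 \<in> \<Omega>" using x0c(1) assms(5) by (auto simp: compactly_contained_def)
  obtain r1 where r1: "r1 > 0" "cball x0 r1 \<subseteq> \<Omega>" using opOm x0Om open_contains_cball by blast

  have knn: "k i x z \<ge> 0" and k1: "k i1 x z = 1" if "x \<in> \<Omega>" for i x z
    using assms(11) that by (auto simp: admissible_k_def)
  have lower: "(\<Sum>i\<in>UNIV. k i x z * (\<xi> $ i)\<^sup>2) \<le> \<xi> \<bullet> (A x z *v \<xi>)" if "x \<in> \<Omega>" for x z \<xi>
    using assms(13) that by (auto simp: diagonal_condition_def)
  have ell: "(\<xi> $ i1)\<^sup>2 \<le> \<xi> \<bullet> (A x z *v \<xi>)" if "x \<in> \<Omega>" for x z \<xi>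
  proof -
    have "(\<xi> $ i1)\<^sup>2 = k i1 x z * (\<xi> $ i1)\<^sup>2" using k1[OF that] by simp
    also have "\<dots> \<le> (\<Sum>i\<in>UNIV. k i x z * (\<xi> $ i)\<^sup>2)"
      using knn[OF that] by (intro member_le_sum mult_nonneg_nonneg) auto
    finally show ?thesis using lower[OF that, of z \<xi>] by linarith
  qed
  let ?A = "\<lambda>(x, z). A x z"
  have DA: "(?A has_derivative frechet_derivative ?A (at (x, z))) (at (x, z))" if "x \<in> \<Omega>" for x z
  proof -
    have "Ck_on (Suc 0) (\<Omega> \<times> UNIV) ?A" using assms(12) by (simp only: smooth_on_def)
    then show ?thesis using that unfolding Ck_on.simps by (simp add: frechet_derivative_works)
  qed

  \<comment> \<open>a bound for \<open>|h + m|\<close> that is available before \<open>h\<close> is constructed\<close>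
  define M0 where "M0 = m0 + \<nu> + 1"
  have "cball x0 r1 \<Subset>\<Subset> \<Omega>" using r1 by (simp add: compactly_contained_def)
  moreover have "M0 \<ge> 1" using m0 \<nu> by (simp add: M0_def)
  ultimately obtain B0 where B0: "\<And>x z \<xi>. x \<in> cball x0 r1 \<Longrightarrow> z \<in> {-M0..M0} \<Longrightarrow>
      (norm (vector_derivative (A x) (at z) *v \<xi>))\<^sup>2 \<le> B0\<^sup>2 * k_star k x z * (\<xi> \<bullet> (A x z *v \<xi>))"
    using assms(14) unfolding z_derivative_condition_def by blast
  define B where "B = max 1 \<bar>B0\<bar>"
  have B: "B \<ge> 1" by (simp add: B_def)
  have Zbound: "\<bar>\<xi> \<bullet> (frechet_derivative ?A (at (x, z)) (0, 1) *v \<xi>)\<bar> \<le> B * (\<xi> \<bullet> (A x z *v \<xi>))"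
    if x: "x \<in> cball x0 r1" and z: "z \<in> {-M0..M0}" for x z \<xi>
  proof -
    have xO: "x \<in> \<Omega>" using x r1 by blast
    have "((\<lambda>z. (x, z)) has_derivative (\<lambda>h. (0, h))) (at z)"
      by (auto intro!: derivative_eq_intros)
    from has_derivative_compose[OF this DA[OF xO]]
    have d: "(A x has_derivative (\<lambda>h. frechet_derivative ?A (at (x, z)) (0, h))) (at z)" by simp
    have "frechet_derivative ?A (at (x, z)) (0, h) = h *\<^sub>R frechet_derivative ?A (at (x, z)) (0, 1)" for h
    proof -
      have "(0, h) = h *\<^sub>R (0 :: real^'n, 1 :: real)" by simp
      then show ?thesis by (simp only: linear_cmul[OF has_derivative_linear[OF DA[OF xO]]])
    qed
    then have eq: "(\<lambda>h. frechet_derivative ?A (at (x, z)) (0, h))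
        = (\<lambda>h. h *\<^sub>R frechet_derivative ?A (at (x, z)) (0, 1))"
      by (rule ext)
    have "(A x has_vector_derivative frechet_derivative ?A (at (x, z)) (0, 1)) (at z)"
      using d unfolding has_vector_derivative_def eq .
    then have v: "vector_derivative (A x) (at z) = frechet_derivative ?A (at (x, z)) (0, 1)"
      by (rule vector_derivative_at)
    have "\<bar>\<xi> \<bullet> (frechet_derivative ?A (at (x, z)) (0, 1) *v \<xi>)\<bar> \<le> \<bar>B0\<bar> * (\<xi> \<bullet> (A x z *v \<xi>))"
      by (rule z_derivative_form_bound[of k x z]) (use knn[OF xO] lower[OF xO] B0[OF x z] v in auto)
    also have "\<dots> \<le> B * (\<xi> \<bullet> (A x z *v \<xi>))"
      using order_trans[OF zero_le_power2 ell[OF xO]] by (intro mult_right_mono) (auto simp: B_def)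
    finally show ?thesis .
  qed
  have "compact (cball x0 r1 \<times> {-M0..M0})" "cball x0 r1 \<times> {-M0..M0} \<subseteq> \<Omega> \<times> UNIV"
    using r1 by (auto intro: compact_Times)
  then obtain C where C: "C \<ge> 1" and drift: "\<And>p g. p \<in> cball x0 r1 \<times> {-M0..M0} \<Longrightarrow>
      \<bar>\<Sum>i\<in>UNIV. (frechet_derivative ?A (at p) (axis i 1, 0) *v g) $ i\<bar> \<le> C * norm g"
    using drift_bound[OF assms(12)] by blast

  obtain n c r2 where n: "norm n = 1" and c: "c > 0" and r2: "r2 > 0"
    and parab: "\<And>y. y \<in> \<Phi> \<Longrightarrow> norm (y - x0) < r2 \<Longrightarrow> c * (norm (y - x0))\<^sup>2 \<le> n \<bullet> (y - x0)"
    by (rule strongly_convex_paraboloid[OF assms(4) x0]) (rule that)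
  define a where "a = (axis i1 1 :: real^'n)"
  have a: "norm a = 1" by (simp add: a_def norm_axis_1)
  have na: "n \<bullet> a = n $ i1" by (simp add: a_def inner_axis)
  define s where "s = (\<lambda>x. n \<bullet> (x - x0))"
  define p where "p = convex_profile x0 n a C"
  define u where "u = (\<lambda>x. inverse (p x))"
  \<comment> \<open>the profile is studied on a wider paraboloid than the one containing \<open>\<Phi>\<close>, to leave room for the cutoff\<close>
  have c4: "c / 4 > 0" using c by simp
  obtain r3 K1 where r3: "r3 > 0" "r3 \<le> 1" and K1: "K1 > 0"
    and near0: "\<And>x. x \<noteq> x0 \<Longrightarrow> norm (x - x0) < r3 \<Longrightarrow> c / 4 * (norm (x - x0))\<^sup>2 \<le> n \<bullet> (x - x0) \<Longrightarrow>
      n \<bullet> (x - x0) > 0 \<and> - ln (n \<bullet> (x - x0)) \<le> convex_profile x0 n a C x \<and> convex_profile x0 n a C x \<le> - ln (n \<bullet> (x - x0)) + K1 \<and>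
      32 * exp (C * ((a \<bullet> (x - x0))\<^sup>2 / (n \<bullet> (x - x0)))) \<le> convex_profile x0 n a C x \<and> (convex_profile x0 n a C x)\<^sup>2 \<le> 1 / (n \<bullet> (x - x0)) \<and>
      (n \<bullet> a = 0 \<and> \<bar>a \<bullet> (x - x0)\<bar> \<le> 1 / (8 * C) \<or>
       C * (1 + 4 * C * exp (C * ((a \<bullet> (x - x0))\<^sup>2 / (n \<bullet> (x - x0)))) *
         (2 * \<bar>a \<bullet> (x - x0)\<bar> + (a \<bullet> (x - x0))\<^sup>2 / (n \<bullet> (x - x0)))) + 1 \<le> (n \<bullet> a)\<^sup>2 / (2 * (n \<bullet> (x - x0))))"
    by (rule convex_profile_near[OF n a c4 C, of x0]) (rule that)
  have s_eq: "n \<bullet> (x - x0) = s x" and p_eq: "convex_profile x0 n a C x = p x" for x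
    by (simp_all add: s_def p_def)
  note near = near0[unfolded s_eq p_eq]

  \<comment> \<open>then \<open>ln (1 + E0 / 2) / B = \<nu>\<close> and \<open>ln (2 + E0) / B = \<nu> + ln 2 / B \<le> \<nu> + 1\<close>\<close>
  define E0 where "E0 = 2 * (exp (B * \<nu>) - 1)"
  have "B * \<nu> > 0" using B \<nu> by simp
  then have E0: "E0 > 0" by (simp add: E0_def)
  \<comment> \<open>the least slope \<open>\<Lambda> / (B (2 + E0))\<close> of \<open>F\<close> then equals \<open>K\<close>\<close>
  define \<Lambda> where "\<Lambda> = K * (B * (2 + E0))"
  have L: "\<Lambda> > 0" using K B E0 by (simp add: \<Lambda>_def)
  \<comment> \<open>the value that \<open>F\<close> is sure to have reached at the scale \<open>aj j\<close> chosen below\<close>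
  define \<delta> where "\<delta> = (\<lambda>j::nat. E0 * ((1/2) ^ Suc j / 2) / (B * (2 + E0)))"
  have \<delta>: "\<delta> j > 0" for j using E0 B by (simp add: \<delta>_def)

  have diam: "norm (x - x0) \<le> diameter \<Phi>" if "x \<in> \<Phi>" for x
  proof -
    have "dist x x0 \<le> diameter (closure \<Phi>)"
      by (rule diameter_bounded_bound) (use that x0c bPhi closure_subset in \<open>auto simp: bounded_closure\<close>)
    then show ?thesis using bPhi by (simp add: dist_norm diameter_closure)
  qed
  have om: "\<exists>\<rho>>0. \<forall>x\<in>\<Phi>. norm (x - x0) < \<rho> \<longrightarrow> \<omega> (norm (x - x0)) \<le> e" if "e > 0" for e
  proof -
    have "0 \<in> {0..diameter \<Phi>}" using diameter_ge_0[OF bPhi] by simp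
    with assms(6) that have "\<exists>\<rho>>0. \<forall>t\<in>{0..diameter \<Phi>}. dist t 0 < \<rho> \<longrightarrow> dist (\<omega> t) (\<omega> 0) < e"
      unfolding continuous_on_iff by blast
    then obtain \<rho> where \<rho>: "\<rho> > 0" "\<And>t. t \<in> {0..diameter \<Phi>} \<Longrightarrow> dist t 0 < \<rho> \<Longrightarrow> dist (\<omega> t) (\<omega> 0) < e"
      by blast
    show ?thesis
    proof (intro exI[of _ \<rho>] conjI ballI impI)
      fix x assume "x \<in> \<Phi>" "norm (x - x0) < \<rho>"
      then have "dist (\<omega> (norm (x - x0))) (\<omega> 0) < e" using diam by (intro \<rho>(2)) auto
      then show "\<omega> (norm (x - x0)) \<le> e" using assms(10) by (simp add: dist_real_def)
    qed (rule \<rho>(1))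
  qed
  obtain r4 where r4: "r4 > 0" "\<And>x. x \<in> \<Phi> \<Longrightarrow> norm (x - x0) < r4 \<Longrightarrow> \<omega> (norm (x - x0)) \<le> \<delta> 0"
    using om[OF \<delta>] by blast

  \<comment> \<open>the last bound ensures \<open>\<Lambda> * u \<le> 1\<close> in the ball, because \<open>u \<le> 1 / (- ln |x - x0|)\<close>\<close>
  define R where "R = Min {\<eta>, r1, r2, r3, r4, exp (- \<Lambda>)}"
  have R: "R > 0" "R \<le> \<eta>" "R \<le> r1" "R \<le> r2" "R \<le> r3" "R \<le> r4" "R \<le> exp (- \<Lambda>)"
    using \<eta> r1 r2 r3 r4 by (auto simp: R_def)
  define r where "r = R / 2"
  have r: "r > 0" "r < R" using R by (auto simp: r_def)

  have up: "s x > 0" "p x > 0" "u x > 0" "\<Lambda> * u x \<le> 1" "- ln (norm (x - x0)) \<le> p x"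
    if "x \<noteq> x0" "norm (x - x0) < R" "c / 4 * (norm (x - x0))\<^sup>2 \<le> s x" for x
  proof -
    have nr: "s x > 0" "- ln (s x) \<le> p x" using near[of x] that R by auto
    have "s x \<le> norm (x - x0)" unfolding s_def using norm_cauchy_schwarz[of n "x - x0"] n by simp
    then have "ln (s x) \<le> ln (norm (x - x0))" using nr(1) by (subst ln_le_cancel_iff) linarith+
    then show pl: "- ln (norm (x - x0)) \<le> p x" using nr(2) by linarith
    have "ln (norm (x - x0)) \<le> ln (exp (- \<Lambda>))" using that R by (subst ln_le_cancel_iff) auto
    then have Lp: "\<Lambda> \<le> p x" using pl by simp
    then show "p x > 0" using L by linarith
    then show "u x > 0" "\<Lambda> * u x \<le> 1" using Lp by (auto simp: u_def divide_inverse[symmetric])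
    show "s x > 0" by (rule nr(1))
  qed
  have Phi4: "c * (norm (x - x0))\<^sup>2 \<le> s x" "c / 4 * (norm (x - x0))\<^sup>2 \<le> s x" "x \<noteq> x0"
    if "x \<in> \<Phi>" "norm (x - x0) < R" for x
  proof -
    show 1: "c * (norm (x - x0))\<^sup>2 \<le> s x" using parab[OF that(1)] that(2) R by (simp add: s_def)
    have "c / 4 * (norm (x - x0))\<^sup>2 \<le> c * (norm (x - x0))\<^sup>2" using c by (intro mult_right_mono) auto
    then show "c / 4 * (norm (x - x0))\<^sup>2 \<le> s x" using 1 by linarith
    show "x \<noteq> x0" using that(1) x0c(2) by blast
  qed
  have ulow: "\<exists>b>0. \<forall>x\<in>\<Phi>. norm (x - x0) < R \<and> \<rho> \<le> norm (x - x0) \<longrightarrow> b \<le> u x" if \<rho>: "\<rho> > 0" for \<rho>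
  proof (intro exI[of _ "inverse (\<bar>K1 - ln (c * \<rho>\<^sup>2)\<bar> + 1)"] conjI ballI impI)
    fix x assume x: "x \<in> \<Phi>" "norm (x - x0) < R \<and> \<rho> \<le> norm (x - x0)"
    note P = Phi4[OF x(1)]
    have "c * \<rho>\<^sup>2 \<le> c * (norm (x - x0))\<^sup>2" using x \<rho> c by (intro mult_left_mono power_mono) auto
    then have "c * \<rho>\<^sup>2 \<le> s x" using P x by linarith
    then have "ln (c * \<rho>\<^sup>2) \<le> ln (s x)" by (rule ln_mono) (use c \<rho> in simp)
    then have "p x \<le> \<bar>K1 - ln (c * \<rho>\<^sup>2)\<bar> + 1" using near[of x] P x R by force
    then show "inverse (\<bar>K1 - ln (c * \<rho>\<^sup>2)\<bar> + 1) \<le> u x"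
      unfolding u_def using up(2)[of x] P x by (intro le_imp_inverse_le) auto
  qed (simp add: add_nonneg_pos)

  \<comment> \<open>where \<open>u\<close> is below the scale \<open>aj j\<close>, the point is so close to \<open>x0\<close> that \<open>\<omega>\<close> is below the value reached at
      the next scale; on the sphere of radius \<open>r\<close> all scales have been passed\<close>
  have "\<exists>aj. 0 < aj \<and> aj \<le> 1 / real (Suc j) \<and>
      (\<forall>x\<in>\<Phi>. norm (x - x0) < R \<and> r \<le> norm (x - x0) \<longrightarrow> aj \<le> u x) \<and>
      (\<forall>x\<in>\<Phi>. norm (x - x0) < R \<and> u x < aj \<longrightarrow> \<omega> (norm (x - x0)) \<le> \<delta> (Suc j))" for j
  proof -
    obtain b1 where b1: "b1 > 0" "\<And>x. x \<in> \<Phi> \<Longrightarrow> norm (x - x0) < R \<Longrightarrow> r \<le> norm (x - x0) \<Longrightarrow> b1 \<le> u x"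
      using ulow[OF r(1)] by blast
    obtain \<rho> where \<rho>: "\<rho> > 0" "\<And>x. x \<in> \<Phi> \<Longrightarrow> norm (x - x0) < \<rho> \<Longrightarrow> \<omega> (norm (x - x0)) \<le> \<delta> (Suc j)"
      using om[OF \<delta>] by blast
    obtain b2 where b2: "b2 > 0" "\<And>x. x \<in> \<Phi> \<Longrightarrow> norm (x - x0) < R \<Longrightarrow> \<rho> \<le> norm (x - x0) \<Longrightarrow> b2 \<le> u x"
      using ulow[OF \<rho>(1)] by blast
    show ?thesis
    proof (intro exI[of _ "Min {1 / real (Suc j), b1, b2}"] conjI ballI impI)
      fix x assume x: "x \<in> \<Phi>" "norm (x - x0) < R \<and> u x < Min {1 / real (Suc j), b1, b2}"
      then have "\<not> \<rho> \<le> norm (x - x0)" using b2(2)[of x] by auto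
      then show "\<omega> (norm (x - x0)) \<le> \<delta> (Suc j)" using \<rho>(2)[of x] x by simp
    next
      fix x assume x: "x \<in> \<Phi>" "norm (x - x0) < R \<and> r \<le> norm (x - x0)"
      then show "Min {1 / real (Suc j), b1, b2} \<le> u x"
        using b1(2)[of x] by (auto simp: min_le_iff_disj)
    qed (use b1 b2 in auto)
  qed
  then obtain aj where aj: "\<And>j. 0 < aj j" "\<And>j. aj j \<le> 1 / real (Suc j)"
    and aj_r: "\<And>j x. x \<in> \<Phi> \<Longrightarrow> norm (x - x0) < R \<Longrightarrow> r \<le> norm (x - x0) \<Longrightarrow> aj j \<le> u x"
    and aj_om: "\<And>j x. x \<in> \<Phi> \<Longrightarrow> norm (x - x0) < R \<Longrightarrow> u x < aj j \<Longrightarrow> \<omega> (norm (x - x0)) \<le> \<delta> (Suc j)"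
    by metis
  have aj1: "aj j \<le> 1" for j by (rule order_trans[OF aj(2)]) simp

  obtain F F1 F2 :: "real \<Rightarrow> real" where
    F_smooth: "smooth_on {0<..} F"
    and F: "\<And>u. u > 0 \<Longrightarrow> (F has_real_derivative F1 u) (at u)"
    and F1: "\<And>u. u > 0 \<Longrightarrow> (F1 has_real_derivative F2 u) (at u)"
    and F1_pos: "\<And>u. u > 0 \<Longrightarrow> F1 u > 0"
    and F2: "\<And>u. u > 0 \<Longrightarrow> F2 u + B * (F1 u)\<^sup>2 \<le> 0"
    and F1_ge: "\<And>u. u > 0 \<Longrightarrow> \<Lambda> * u \<le> 1 \<Longrightarrow> \<Lambda> / (B * (2 + E0)) \<le> F1 u"
    and F_nonneg: "\<And>u. u > 0 \<Longrightarrow> 0 \<le> F u"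
    and F_le: "\<And>u. u > 0 \<Longrightarrow> \<Lambda> * u \<le> 1 \<Longrightarrow> F u \<le> ln (2 + E0) / B"
    and F_0: "(F \<longlongrightarrow> 0) (at_right 0)"
    and F_ge: "\<And>u j. u \<ge> aj j \<Longrightarrow> \<Lambda> * u \<le> 1 \<Longrightarrow> E0 * ((1/2) ^ Suc j / 2) / (B * (2 + E0)) \<le> F u"
    and F_ge_all: "\<And>u. \<forall>j. u \<ge> aj j \<Longrightarrow> ln (1 + E0 / 2) / B \<le> F u"
    by (rule saturating_majorant[OF B E0 L aj(1) aj1]) (rule that)
  obtain \<psi> :: "real \<Rightarrow> real" where \<psi>: "smooth_on UNIV \<psi>" "\<And>t. t \<le> c / 2 \<Longrightarrow> \<psi> t = 0"
    "\<And>t. t \<ge> c \<Longrightarrow> \<psi> t = 1" "\<And>t. 0 \<le> \<psi> t" "\<And>t. \<psi> t \<le> 1"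
    by (rule smooth_cutoff[of "c / 2" c]) (use c in simp, rule that)
  define h where "h = (\<lambda>x. - (\<psi> (s x / (norm (x - x0))\<^sup>2) * F (u x)))"

  have h_Phi: "h x = - F (u x)" if "x \<in> \<Phi>" "norm (x - x0) < R" for x
  proof -
    have "c \<le> s x / (norm (x - x0))\<^sup>2" using Phi4[OF that] by (simp add: field_simps)
    then show ?thesis using \<psi>(3) by (simp add: h_def)
  qed

  have smooth: "smooth_on (ball x0 R - {x0}) h"
  proof -
    let ?D = "{x \<in> ball x0 R. c / 4 * (norm (x - x0))\<^sup>2 < n \<bullet> (x - x0)}"
    have "?D = ball x0 R \<inter> {x. c / 4 * (norm (x - x0))\<^sup>2 < n \<bullet> (x - x0)}" by auto
    also have "open \<dots>" by (intro open_Int open_Collect_less continuous_intros open_ball)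
    finally have oD: "open ?D" .
    have upD: "s x > 0" "p x > 0" "u x > 0" if "x \<in> ?D" for x
    proof -
      have "x \<noteq> x0" using that by auto
      then show "s x > 0" "p x > 0" "u x > 0"
        using up[of x] that by (auto simp: s_def dist_norm norm_minus_commute)
    qed
    have "smooth_on ?D p" unfolding p_def
      by (rule smooth_on_convex_profile[OF oD]) (use upD(1) in \<open>auto simp: s_def\<close>)
    then have "smooth_on ?D u" unfolding u_def
      by (rule smooth_on_compose[OF oD smooth_on_inverse]) (use upD(2) in force)
    then have "smooth_on ?D (\<lambda>x. F (u x))"
      by (rule smooth_on_compose[OF oD F_smooth]) (use upD(3) in auto)
    from smooth_on_paraboloid_cutoff[OF c this \<psi>(1,2)]
    show ?thesis unfolding h_def s_def
      by (intro smooth_on_minus) (auto intro: open_Diff)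
  qed

  have h_lim: "\<exists>d>0. \<forall>x. norm (x - x0) < d \<longrightarrow> \<bar>h x\<bar> < e" if e: "e > 0" for e
  proof -
    have "\<forall>\<^sub>F t in at_right 0. F t < e" using F_0 e by (rule order_tendstoD(2))
    then obtain d where d: "d > 0" "\<And>t. 0 < t \<Longrightarrow> t < d \<Longrightarrow> F t < e"
      unfolding eventually_at_right_field by auto
    show ?thesis
    proof (intro exI[of _ "min R (exp (- (1 / d + 1)))"] conjI allI impI)
      fix x assume x: "norm (x - x0) < min R (exp (- (1 / d + 1)))"
      show "\<bar>h x\<bar> < e"
      proof (cases "x \<noteq> x0 \<and> c / 4 * (norm (x - x0))\<^sup>2 \<le> s x")
        case True
        have u: "u x > 0" "- ln (norm (x - x0)) \<le> p x" using up[of x] True x by auto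
        have "ln (norm (x - x0)) \<le> ln (exp (- (1 / d + 1)))" using True x by (subst ln_le_cancel_iff) auto
        then have "1 / d < p x" using u(2) by simp
        from less_imp_inverse_less[OF this] have "u x < d" unfolding u_def using d(1) by simp
        then have "F (u x) < e" using d(2) u(1) by blast
        moreover have "\<bar>h x\<bar> \<le> F (u x)"
          unfolding h_def using \<psi>(4,5) F_nonneg[OF u(1)] by (simp add: abs_mult mult_left_le_one_le)
        ultimately show ?thesis by linarith
      next
        case False
        have "s x / (norm (x - x0))\<^sup>2 \<le> c / 2"
        proof (cases "x = x0")
          case x: False
          have "c / 4 * (norm (x - x0))\<^sup>2 \<le> c / 2 * (norm (x - x0))\<^sup>2"
            using c by (intro mult_right_mono) auto
          then have "s x \<le> c / 2 * (norm (x - x0))\<^sup>2" using False x by linarith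
          then show ?thesis using x by (simp add: pos_divide_le_eq)
        qed (use c in simp)
        then show ?thesis using \<psi>(2) e by (simp add: h_def)
      qed
    qed (use R in auto)
  qed
  have h0: "h x0 = 0" using \<psi>(2)[of 0] c by (simp add: h_def)

  have cont: "continuous_on (cball x0 r) h"
  proof (rule continuous_at_imp_continuous_on, rule ballI)
    fix x assume x: "x \<in> cball x0 r"
    show "isCont h x"
    proof (cases "x = x0")
      case True
      show ?thesis unfolding True continuous_at_eps_delta
        using h_lim h0 by (simp add: dist_norm)
    next
      case False
      have "Ck_on 0 (ball x0 R - {x0}) h" using smooth by (simp only: smooth_on_def)
      then have "continuous_on (ball x0 R - {x0}) h" by simp
      moreover have "x \<in> ball x0 R - {x0}" using x r False by auto
      ultimately show ?thesis by (metis continuous_on_eq_continuous_at open_ball open_delete)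
    qed
  qed

  have op: "L_op A m h x \<ge> K" "laplacian h x > 0" if x: "x \<in> \<Phi>" "norm (x - x0) < R" and m: "\<bar>m\<bar> \<le> m0" for x m
  proof -
    note P = Phi4[OF x]
    note U = up[OF P(3) x(2) P(2)]
    have xr3: "norm (x - x0) < r3" using x(2) R by linarith
    note N = near0[OF P(3) xr3 P(2)[folded s_eq], unfolded na, unfolded a_def]
    have xb: "x \<in> cball x0 r1" using x(2) R by (simp add: dist_norm norm_minus_commute)
    have xO: "x \<in> \<Omega>" using xb r1 by blast
    obtain g H where ju: "jet2 u x g H"
      and sup: "\<And>M \<delta>. (\<And>\<xi>. (\<xi> $ i1)\<^sup>2 \<le> \<xi> \<bullet> (M *v \<xi>)) \<Longrightarrow> \<delta> \<le> C * norm g \<Longrightarrow> hess_trace M H + \<delta> \<le> -1"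
    proof (rule inverse_profile_supersolution[of n x x0 C i1])
      show "n \<bullet> (x - x0) > 0" "C \<ge> 1" "norm n = 1" using U(1) C n by (simp_all add: s_eq)
    next
      fix g H
      assume "jet2 (\<lambda>y. inverse (convex_profile x0 n (axis i1 1) C y)) x g H"
        and 2: "\<And>M \<delta>. (\<And>\<xi>. (\<xi> $ i1)\<^sup>2 \<le> \<xi> \<bullet> (M *v \<xi>)) \<Longrightarrow> \<delta> \<le> C * norm g \<Longrightarrow> hess_trace M H + \<delta> \<le> -1"
      then have 1: "jet2 u x g H" by (simp add: u_def p_def a_def)
      show thesis by (rule that[OF 1]) (fact 2)
    qed (use N in blast)+
    have hx: "\<bar>h x\<bar> \<le> \<nu> + 1"
    proof -
      have "F (u x) \<le> ln (2 + E0) / B" using F_le U by blast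
      also have "2 + E0 = 2 * exp (B * \<nu>)" by (simp add: E0_def)
      also have "ln (2 * exp (B * \<nu>)) = ln 2 + B * \<nu>" by (simp add: ln_mult)
      also have "\<dots> / B = ln 2 / B + \<nu>" using B by (simp add: field_simps)
      also have "\<dots> \<le> 1 + \<nu>"
        using B ln_le_minus_one[of 2] by (simp add: field_simps)
      finally show ?thesis using h_Phi[OF x] F_nonneg[OF U(3)] by simp
    qed
    then have z: "h x + m \<in> {-M0..M0}" using m by (auto simp: M0_def)
    have S: "open (\<Phi> \<inter> ball x0 R)" "x \<in> \<Phi> \<inter> ball x0 R" "\<And>y. y \<in> \<Phi> \<inter> ball x0 R \<Longrightarrow> - F (u y) = h y"
      using opPhi x h_Phi by (auto simp: dist_norm norm_minus_commute)
    have C0: "C \<ge> 0" "B \<ge> 0" using C B by auto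
    note U' = U(3) F1[OF U(3)] F1_pos[OF U(3)] F2[OF U(3)]
    show "laplacian h x > 0"
      by (rule laplacian_barrier_pos[where ?F1.0=F1 and ?F2.0=F2 and S="\<Phi> \<inter> ball x0 R"])
        (fact ju sup F U' C0 S)+
    have drift': "\<bar>\<Sum>i\<in>UNIV. (frechet_derivative ?A (at (x, h x + m)) (axis i 1, 0) *v \<xi>) $ i\<bar> \<le> C * norm \<xi>" for \<xi>
      by (rule drift) (use xb z in blast)
    have "F1 (u x) \<le> L_op A m h x"
      by (rule L_op_barrier_ge[where ?F1.0=F1 and ?F2.0=F2 and S="\<Phi> \<inter> ball x0 R" and DA="frechet_derivative ?A (at (x, h x + m))"])
        (fact ju sup F U' C0 S DA[OF xO] ell[OF xO] drift' Zbound[OF xb z])+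
    moreover have "\<Lambda> / (B * (2 + E0)) = K" using B E0 by (simp add: \<Lambda>_def)
    ultimately show "L_op A m h x \<ge> K" using F1_ge[OF U(3,4)] by linarith
  qed

  have below_omega: "h x \<le> - \<omega> (norm (x - x0))" if x: "x \<in> \<Phi>" "norm (x - x0) < R" for x
  proof -
    note U = up[OF Phi4(3)[OF x] x(2) Phi4(2)[OF x]]
    obtain j0 where "1 / real (Suc j0) < u x" using nat_approx_posE[OF U(3)] by metis
    then have ex: "\<exists>j. aj j \<le> u x" using aj(2)[of j0] by (intro exI[of _ j0]) linarith
    \<comment> \<open>the first scale passed by \<open>u x\<close>; the previous one bounds \<open>\<omega>\<close> from above\<close>
    define j where "j = (LEAST j. aj j \<le> u x)"
    have j: "aj j \<le> u x" unfolding j_def using ex by (rule LeastI_ex)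
    have "\<omega> (norm (x - x0)) \<le> \<delta> j"
    proof (cases j)
      case 0
      then show ?thesis using r4(2)[of x] x R by simp
    next
      case (Suc i)
      then have "\<not> aj i \<le> u x" using not_less_Least[of i "\<lambda>j. aj j \<le> u x"] by (simp add: j_def)
      then show ?thesis using aj_om[OF x, of i] Suc by simp
    qed
    also have "\<delta> j \<le> F (u x)" unfolding \<delta>_def using F_ge[OF j U(4)] .
    finally show ?thesis using h_Phi[OF x] by simp
  qed

  have sphere: "h x \<le> - \<nu>" if x: "x \<in> \<Phi>" "norm (x - x0) = r" for x
  proof -
    have xR: "norm (x - x0) < R" using x r by simp
    have "ln (1 + E0 / 2) / B \<le> F (u x)" using aj_r[OF x(1) xR] x(2) by (intro F_ge_all) auto
    moreover have "1 + E0 / 2 = exp (B * \<nu>)" by (simp add: E0_def field_simps)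
    then have "ln (1 + E0 / 2) / B = \<nu>" using B by simp
    ultimately show ?thesis using h_Phi[OF x(1) xR] by simp
  qed

  show "\<exists>N h. open N \<and> x0 \<in> N \<and> N \<subseteq> {x. norm (x - x0) < \<eta>} \<and>
      continuous_on (closure N) h \<and> smooth_on (N - {x0}) h \<and> h x0 = 0 \<and>
      (\<forall>x\<in>\<Phi> \<inter> N. h x \<le> - \<omega> (norm (x - x0))) \<and>
      (\<forall>x\<in>\<Phi> \<inter> frontier N. h x \<le> - \<nu>) \<and>
      (\<forall>x\<in>\<Phi> \<inter> N. \<forall>m. \<bar>m\<bar> \<le> m0 \<longrightarrow> L_op A m h x \<ge> K) \<and>
      (\<forall>x\<in>\<Phi> \<inter> N. laplacian h x > 0)"
  proof (intro exI[of _ "ball x0 r"] exI[of _ h] conjI ballI allI impI)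
    have nb: "norm (x - x0) < R" if "x \<in> ball x0 r" for x
      using that r by (simp add: dist_norm norm_minus_commute)
    show "open (ball x0 r)" "x0 \<in> ball x0 r" using r by auto
    show "ball x0 r \<subseteq> {x. norm (x - x0) < \<eta>}" using nb R(2) by fastforce
    show "continuous_on (closure (ball x0 r)) h" using cont r by simp
    show "smooth_on (ball x0 r - {x0}) h" by (rule smooth_on_subset[OF smooth]) (use r in auto)
    show "h x0 = 0" by (rule h0)
    show "h x \<le> - \<omega> (norm (x - x0))" if "x \<in> \<Phi> \<inter> ball x0 r" for x using below_omega nb that by blast
    show "h x \<le> - \<nu>" if "x \<in> \<Phi> \<inter> frontier (ball x0 r)" for x
      using sphere[of x] that r by (simp add: frontier_ball dist_norm norm_minus_commute)
    show "L_op A m h x \<ge> K" if "x \<in> \<Phi> \<inter> ball x0 r" "\<bar>m\<bar> \<le> m0" for x m using op(1) nb that by blast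
    show "laplacian h x > 0" if "x \<in> \<Phi> \<inter> ball x0 r" for x using op(2)[of x 0] nb that m0 by auto
  qed
qed

end
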